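(* Up to isomorphism, the non-abelian powerfully nilpotent $2$-groups of order $16$, $32$ and $64$ are exactly the following groups, which are pairwise non-isomorphic. In each presentation, all commutators of pairs of the listed generators that are not explicitly given are trivial (i.e. the corresponding relations $[x,y]=1$ are part of the presentation). Order $16$ (1 group; together with the 5 abelian groups, 6 powerfully nilpotent groups in total): - $\langle a,b \mid a^{8}=b^{2}=1,\ [a,b]=a^{4}\rangle$. Order $32$ (4 groups; together with the 7 abelian groups, 11 powerfully nilpotent groups in total): - $\langle a,b \mid a^{8}=b^{4}=1,\ [a,b]=a^{4}\rangle$; - $\langle a,b \mid a^{16}=b^{2}=1,\ [a,b]=a^{8}\rangle$; - $\langle a,b,c \mid a^{2}=b^{2}=c^{8}=1,\ [a,b]=c^{4}\rangle$; - $\langle a,b,c \mid a^{2}=b^{2}=c^{8}=1,\ [a,c]=c^{4}\rangle$. Order $64$ (12 groups; together with the 11 abelian groups, 23 powerfully nilpotent groups in total): - $\langle a,b,c \mid a^{2}=b^{4}=c^{8}=1,\ [b,c]=c^{4}\rangle$; - $\langle a,b,c \mid a^{2}=b^{4}=c^{8}=1,\ [a,c]=c^{4}\rangle$; - $\langle a,b,c \mid a^{2}=b^{4}=c^{8}=1,\ [a,b]=c^{4}\rangle$; - $\langle a,b,c,d \mid a^{2}=b^{2}=c^{2}=d^{8}=1,\ [a,b]=d^{4}\rangle$; - $\langle a,b,c \mid a^{2}=b^{2}=c^{16}=1,\ [a,b]=c^{8}\rangle$; - $\langle a,b,c,d \mid a^{2}=b^{2}=c^{2}=d^{8}=1,\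 [a,d]=d^{4}\rangle$; - $\langle a,b,c,d \mid a^{2}=b^{2}=c^{2}=d^{8}=1,\ [a,b]=d^{4},\ [c,d]=d^{4}\rangle$; - $\langle a,b,c \mid a^{2}=b^{2}=c^{16}=1,\ [a,c]=c^{8}\rangle$; - $\langle a,b \mid a^{8}=b^{8}=1,\ [a,b]=a^{4}\rangle$; - $\langle a,b \mid a^{32}=b^{2}=1,\ [a,b]=a^{16}\rangle$; - $\langle a,b \mid a^{16}=b^{4}=1,\ [a,b]=a^{4}\rangle$; - $\langle a,b \mid a^{16}=b^{4}=1,\ [a,b]=a^{8}\rangle$.
   Context: $[x,y]=x^{-1}y^{-1}xy$. For a group $H$ and a positive integer $k$, $H^{k}$ denotes the subgroup generated by all $k$-th powers of elements of $H$. A finite $2$-group $G$ is powerful if $[G,G]\le G^{4}$. A powerful $2$-group $G$ is powerfully nilpotent if it has an ascending chain of subgroups $\{1\}=H_{0}\le H_{1}\le\cdots\le H_{n}=G$ such that $[H_{i},G]\le H_{i-1}^{2}$ for $i=1,\ldots,n$. Every finite abelian $2$-group is powerfully nilpotent. *)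

theory Defs
  imports "HOL-Algebra.Generated_Groups"
begin

section \<open>Powerfully nilpotent 2-groups\<close>

definition grp_comm :: "('a, 'b) monoid_scheme \<Rightarrow> 'a \<Rightarrow> 'a \<Rightarrow> 'a" where
  "grp_comm G x y = inv\<^bsub>G\<^esub> x \<otimes>\<^bsub>G\<^esub> inv\<^bsub>G\<^esub> y \<otimes>\<^bsub>G\<^esub> x \<otimes>\<^bsub>G\<^esub> y"

definition comm_subgroup :: "('a, 'b) monoid_scheme \<Rightarrow> 'a set \<Rightarrow> 'a set \<Rightarrow> 'a set" where
  "comm_subgroup G H K = generate G {grp_comm G x y | x y. x \<in> H \<and> y \<in> K}"

definition power_subgroup :: "('a, 'b) monoid_scheme \<Rightarrow> 'a set \<Rightarrow> nat \<Rightarrow> 'a set" where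
  "power_subgroup G H k = generate G {x [^]\<^bsub>G\<^esub> k | x. x \<in> H}"

definition finite_2group :: "('a, 'b) monoid_scheme \<Rightarrow> bool" where
  "finite_2group G \<longleftrightarrow> group G \<and> finite (carrier G) \<and> (\<exists>m. order G = 2 ^ m)"

definition powerful_2group :: "('a, 'b) monoid_scheme \<Rightarrow> bool" where
  "powerful_2group G \<longleftrightarrow> finite_2group G \<and>
     comm_subgroup G (carrier G) (carrier G) \<subseteq> power_subgroup G (carrier G) 4"

definition powerfully_nilpotent :: "('a, 'b) monoid_scheme \<Rightarrow> bool" where
  "powerfully_nilpotent G \<longleftrightarrow> powerful_2group G \<and>
     (\<exists>(n::nat) H. H 0 = {\<one>\<^bsub>G\<^esub>} \<and> H n = carrier G \<and>
        (\<forall>i\<le>n. subgroup (H i) G) \<and>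
        (\<forall>i<n. H i \<subseteq> H (Suc i)) \<and>
        (\<forall>i\<in>{1..n}. comm_subgroup G (H i) (carrier G) \<subseteq> power_subgroup G (H (i - 1)) 2))"


section \<open>Groups given by generators and relations\<close>

text \<open>A letter \<open>(x, True)\<close> stands for the generator \<open>x\<close> and \<open>(x, False)\<close> for its formal
  inverse; a pair of words \<open>(u, v)\<close> stands for the relation \<open>u = v\<close>.\<close>

type_synonym 'g word = "('g \<times> bool) list"

definition words :: "'g set \<Rightarrow> 'g word set" where
  "words X = lists (X \<times> UNIV)"

inductive_set word_cong :: "'g set \<Rightarrow> ('g word \<times> 'g word) set \<Rightarrow> ('g word \<times> 'g word) set"
  for X R where
  refl: "w \<in> words X \<Longrightarrow> (w, w) \<in> word_cong X R"
| sym: "(u, v) \<in> word_cong X R \<Longrightarrow> (v, u) \<in> word_cong X R"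
| trans: "(u, v) \<in> word_cong X R \<Longrightarrow> (v, w) \<in> word_cong X R \<Longrightarrow> (u, w) \<in> word_cong X R"
| append: "(u, u') \<in> word_cong X R \<Longrightarrow> (v, v') \<in> word_cong X R
    \<Longrightarrow> (u @ v, u' @ v') \<in> word_cong X R"
| cancel: "x \<in> X \<Longrightarrow> ([(x, e), (x, \<not> e)], []) \<in> word_cong X R"
| rel: "(u, v) \<in> R \<Longrightarrow> u \<in> words X \<Longrightarrow> v \<in> words X \<Longrightarrow> (u, v) \<in> word_cong X R"

definition presented_group :: "'g set \<Rightarrow> ('g word \<times> 'g word) set \<Rightarrow> 'g word set monoid" where
  "presented_group X R =
     \<lparr>carrier = words X // word_cong X R,
      mult = (\<lambda>A B. word_cong X R `` {u @ v | u v. u \<in> A \<and> v \<in> B}),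
      one = word_cong X R `` {[]}\<rparr>"

definition word_pow :: "'g \<Rightarrow> nat \<Rightarrow> 'g word" where
  "word_pow x k = replicate k (x, True)"

definition word_comm :: "'g \<Rightarrow> 'g \<Rightarrow> 'g word" where
  "word_comm x y = [(x, False), (y, False), (x, True), (y, True)]"

text \<open>In \<open>pc_group ps cs\<close>, an entry \<open>(x, k)\<close> of \<open>ps\<close> introduces a generator \<open>x\<close> with the
  relation \<open>x\<^sup>k = 1\<close>, and an entry \<open>((x, y), (z, k))\<close> of \<open>cs\<close> is the relation \<open>[x, y] = z\<^sup>k\<close>.
  Generators \<open>x \<noteq> y\<close> whose commutator is not listed in \<open>cs\<close> (in either order) are made to
  commute.\<close>

definition pc_rels ::
  "('g \<times> nat) list \<Rightarrow> (('g \<times> 'g) \<times> ('g \<times> nat)) list \<Rightarrow> ('g word \<times> 'g word) set" where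
  "pc_rels ps cs =
     {(word_pow x k, []) | x k. (x, k) \<in> set ps}
   \<union> {(word_comm x y, word_pow z k) | x y z k. ((x, y), (z, k)) \<in> set cs}
   \<union> {(word_comm x y, []) | x y. x \<in> fst ` set ps \<and> y \<in> fst ` set ps \<and> x \<noteq> y \<and>
        (x, y) \<notin> fst ` set cs \<and> (y, x) \<notin> fst ` set cs}"

definition pc_group ::
  "('g \<times> nat) list \<Rightarrow> (('g \<times> 'g) \<times> ('g \<times> nat)) list \<Rightarrow> 'g word set monoid" where
  "pc_group ps cs = presented_group (fst ` set ps) (pc_rels ps cs)"

datatype gen = ga | gb | gc | gd

definition groups16 :: "gen word set monoid list" where
  "groups16 =
    [pc_group [(ga, 8), (gb, 2)] [((ga, gb), (ga, 4))]]"

definition groups32 :: "gen word set monoid list" where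
  "groups32 =
    [pc_group [(ga, 8), (gb, 4)] [((ga, gb), (ga, 4))],
     pc_group [(ga, 16), (gb, 2)] [((ga, gb), (ga, 8))],
     pc_group [(ga, 2), (gb, 2), (gc, 8)] [((ga, gb), (gc, 4))],
     pc_group [(ga, 2), (gb, 2), (gc, 8)] [((ga, gc), (gc, 4))]]"

definition groups64 :: "gen word set monoid list" where
  "groups64 =
    [pc_group [(ga, 2), (gb, 4), (gc, 8)] [((gb, gc), (gc, 4))],
     pc_group [(ga, 2), (gb, 4), (gc, 8)] [((ga, gc), (gc, 4))],
     pc_group [(ga, 2), (gb, 4), (gc, 8)] [((ga, gb), (gc, 4))],
     pc_group [(ga, 2), (gb, 2), (gc, 2), (gd, 8)] [((ga, gb), (gd, 4))],
     pc_group [(ga, 2), (gb, 2), (gc, 16)] [((ga, gb), (gc, 8))],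
     pc_group [(ga, 2), (gb, 2), (gc, 2), (gd, 8)] [((ga, gd), (gd, 4))],
     pc_group [(ga, 2), (gb, 2), (gc, 2), (gd, 8)] [((ga, gb), (gd, 4)), ((gc, gd), (gd, 4))],
     pc_group [(ga, 2), (gb, 2), (gc, 16)] [((ga, gc), (gc, 8))],
     pc_group [(ga, 8), (gb, 8)] [((ga, gb), (ga, 4))],
     pc_group [(ga, 32), (gb, 2)] [((ga, gb), (ga, 16))],
     pc_group [(ga, 16), (gb, 4)] [((ga, gb), (ga, 4))],
     pc_group [(ga, 16), (gb, 4)] [((ga, gb), (ga, 8))]]"


section \<open>Counting isomorphism classes\<close>

text \<open>Every finite group has an isomorphic copy whose carrier is a set of natural numbers, so
  isomorphism classes of finite groups can be counted inside \<^typ>\<open>nat monoid\<close>. An infinite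
  number of classes would be counted as 0.\<close>

definition num_iso_classes :: "(nat monoid \<Rightarrow> bool) \<Rightarrow> nat" where
  "num_iso_classes P = card ({G. group G \<and> P G} // {(G, H). group G \<and> group H \<and> G \<cong> H})"

end

theory Submission
  imports Defs "HOL-Number_Theory.Cong" "HOL-Algebra.Multiplicative_Group"
begin

text \<open>
  Every listed group has generators whose commutators are \<open>1\<close> or \<open>c\<^sup>w\<close> for one generator \<open>c\<close>, where
  \<open>c\<^sup>w\<close> is central. Collecting words bounds the order of such a group from above, and a model on exponent
  vectors shows that the bound is attained; counting the roots of unity and the central roots of unity in the model separates the groups.

  For completeness, let \<open>G\<close> be powerfully nilpotent and nonabelian of order at most \<open>64\<close>. If \<open>[G, G]\<close>
  has order \<open>2\<close>, generated by \<open>z\<close>, then \<open>z\<close> is a fourth power. Choose \<open>c\<close> and the largest \<open>k\<close> with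
  \<open>c\<close> to the power \<open>2\<^sup>k\<close> equal to \<open>z\<close>; a basis of \<open>G / \<langle>c\<rangle>\<close> lifts to elements of the same orders, and the
  commutator becomes an alternating form over the field with two elements, which is brought to normal
  form by a change of generators. If \<open>[G, G]\<close> is larger, dividing by a central involution in \<open>[G, G]\<close>
  leads to a group of the first kind, and only \<open>C\<^bsub>16\<^esub> \<rtimes> C\<^sub>4\<close> with \<open>[a, b] = a\<^sup>4\<close> survives.\<close>

section \<open>Presented groups\<close>

text \<open>Fourth powering controls the completeness half. If commutators are central of square 1,
  then \<open>(x y)^4 = x^4 y^4\<close>, because \<open>4 choose 2\<close> is even. Fourth powers
  then form a subgroup, and \<open>[G, G] \<le> G^4\<close> turns \<open>z\<close> into the fourth
  power of a single element. This gives \<open>2 \<le> k\<close>, so half of the cyclic group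
  \<open>\<langle>c\<rangle>\<close>, namely \<open>\<langle>c^2\<rangle>\<close>, is central and
  contains a square root of \<open>z\<close>, which repairs elements whose square is
  \<open>z\<close>.

  Maximality of \<open>k\<close> is what lets a basis lift: if \<open>y^(2^e) = c^s\<close> and
  \<open>2^e\<close> did not divide \<open>s\<close>, some power of \<open>y\<close> would be a
  deeper root of \<open>z\<close> than \<open>c\<close>.

  The bound 64 enters through the quotient by a central involution. It has order at most 32, and its
  cyclic subgroup has order at least 8, so the remaining basis orders have product at most 4. If all
  of them are 2, every commutator has square 1 and the fourth powers are confined to one cyclic
  group, which is too small. The only other choice is a single 4.\<close>

lemma words_Nil [simp]: "[] \<in> words X"
  by (simp add: words_def)

lemma words_append [simp]: "u @ v \<in> words X \<longleftrightarrow> u \<in> words X \<and> v \<in> words X"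
  by (auto simp: words_def)

lemma words_Cons [simp]: "p # w \<in> words X \<longleftrightarrow> fst p \<in> X \<and> w \<in> words X"
  by (cases p) (auto simp: words_def)

lemma words_word_pow [simp]: "x \<in> X \<Longrightarrow> word_pow x k \<in> words X"
  by (auto simp: word_pow_def words_def)

lemma words_word_comm [simp]: "x \<in> X \<Longrightarrow> y \<in> X \<Longrightarrow> word_comm x y \<in> words X"
  by (simp add: word_comm_def)

lemma word_cong_in_words:
  "(u, v) \<in> word_cong X R \<Longrightarrow> u \<in> words X \<and> v \<in> words X"
  by (induction rule: word_cong.induct) auto

lemma equiv_word_cong: "equiv (words X) (word_cong X R)"
proof (rule equivI)
  show "word_cong X R \<subseteq> words X \<times> words X"
    using word_cong_in_words by fast
  show "refl_on (words X) (word_cong X R)"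
    by (rule refl_onI) (rule word_cong.refl)
  show "sym (word_cong X R)" by (rule symI) (rule word_cong.sym)
  show "trans (word_cong X R)" by (rule transI) (rule word_cong.trans)
qed

definition word_class :: "'g set \<Rightarrow> ('g word \<times> 'g word) set \<Rightarrow> 'g word \<Rightarrow> 'g word set" where
  "word_class X R w = word_cong X R `` {w}"

lemma word_class_eq_iff:
  assumes "u \<in> words X" "v \<in> words X"
  shows "word_class X R u = word_class X R v \<longleftrightarrow> (u, v) \<in> word_cong X R"
  unfolding word_class_def using eq_equiv_class_iff[OF equiv_word_cong assms] .

text \<open>The rule \<open>append\<close> makes the congruence compatible with concatenation, so
  the closure taken in the definition of the product is a single class.\<close>

lemma word_class_mult:
  assumes "u \<in> words X" "v \<in> words X"
  shows "word_class X R u \<otimes>\<^bsub>presented_group X R\<^esub> word_class X R v = word_class X R (u @ v)"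
proof -
  have "word_cong X R `` {a @ b |a b. a \<in> word_cong X R `` {u} \<and> b \<in> word_cong X R `` {v}}
      = word_cong X R `` {u @ v}" (is "?L = ?R")
  proof
    show "?L \<subseteq> ?R"
      by (auto intro: word_cong.trans word_cong.append)
    have "u @ v \<in> {a @ b |a b. a \<in> word_cong X R `` {u} \<and> b \<in> word_cong X R `` {v}}"
      using assms word_cong.refl[of _ X R] by blast
    then show "?R \<subseteq> ?L" by blast
  qed
  then show ?thesis by (simp add: presented_group_def word_class_def)
qed

lemma carrier_presented_group:
  "carrier (presented_group X R) = word_class X R ` words X"
  by (auto simp: presented_group_def word_class_def quotient_def)

lemma one_presented_group: "\<one>\<^bsub>presented_group X R\<^esub> = word_class X R []"
  by (simp add: presented_group_def word_class_def)

definition word_inv :: "'g word \<Rightarrow> 'g word" where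
  "word_inv w = rev (map (\<lambda>(x, e). (x, \<not> e)) w)"

lemma word_inv_in_words: "w \<in> words X \<Longrightarrow> word_inv w \<in> words X"
  by (force simp: word_inv_def words_def lists_eq_set)

lemma word_inv_cancel:
  "w \<in> words X \<Longrightarrow> (word_inv w @ w, []) \<in> word_cong X R"
proof (induction w)
  case Nil
  show ?case by (auto simp: word_inv_def intro: word_cong.refl)
next
  case (Cons p w)
  obtain x e where p: "p = (x, e)" by force
  have w: "w \<in> words X" and x: "x \<in> X" using Cons.prems p by auto
  have "([(x, \<not> e), (x, \<not> \<not> e)], []) \<in> word_cong X R" using x by (rule word_cong.cancel)
  then have "(word_inv w @ ([(x, \<not> e), (x, e)] @ w), word_inv w @ ([] @ w)) \<in> word_cong X R"
    using w by (intro word_cong.append word_cong.refl word_inv_in_words) auto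
  with Cons.IH[OF w] have "(word_inv w @ ([(x, \<not> e), (x, e)] @ w), []) \<in> word_cong X R"
    by (auto intro: word_cong.trans)
  then show ?case by (simp add: word_inv_def p)
qed

lemma group_presented_group: "group (presented_group X R)"
proof (rule groupI)
  fix A B
  assume "A \<in> carrier (presented_group X R)" "B \<in> carrier (presented_group X R)"
  then show "A \<otimes>\<^bsub>presented_group X R\<^esub> B \<in> carrier (presented_group X R)"
    by (auto simp: carrier_presented_group word_class_mult)
next
  fix A B C
  assume "A \<in> carrier (presented_group X R)" "B \<in> carrier (presented_group X R)"
    "C \<in> carrier (presented_group X R)"
  then show "A \<otimes>\<^bsub>presented_group X R\<^esub> B \<otimes>\<^bsub>presented_group X R\<^esub> C =
    A \<otimes>\<^bsub>presented_group X R\<^esub> (B \<otimes>\<^bsub>presented_group X R\<^esub> C)"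
    by (auto simp: carrier_presented_group word_class_mult)
next
  fix A assume "A \<in> carrier (presented_group X R)"
  then obtain w where w: "w \<in> words X" "A = word_class X R w"
    by (auto simp: carrier_presented_group)
  then show "\<one>\<^bsub>presented_group X R\<^esub> \<otimes>\<^bsub>presented_group X R\<^esub> A = A"
    by (simp add: one_presented_group word_class_mult)
  have "word_class X R (word_inv w) \<otimes>\<^bsub>presented_group X R\<^esub> A = \<one>\<^bsub>presented_group X R\<^esub>"
    using w word_inv_in_words[of w X] word_inv_cancel[of w X R]
    by (simp add: one_presented_group word_class_mult word_class_eq_iff)
  then show "\<exists>B\<in>carrier (presented_group X R).
      B \<otimes>\<^bsub>presented_group X R\<^esub> A = \<one>\<^bsub>presented_group X R\<^esub>"
    using word_inv_in_words[OF w(1)] by (auto simp: carrier_presented_group)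
qed (auto simp: carrier_presented_group one_presented_group)

section \<open>Evaluation of words and the universal property of a presentation\<close>

fun word_eval :: "('a, 'b) monoid_scheme \<Rightarrow> ('g \<Rightarrow> 'a) \<Rightarrow> 'g word \<Rightarrow> 'a" where
  "word_eval G f [] = \<one>\<^bsub>G\<^esub>"
| "word_eval G f ((x, e) # w) = (if e then f x else inv\<^bsub>G\<^esub> f x) \<otimes>\<^bsub>G\<^esub> word_eval G f w"

context group
begin

lemma word_eval_closed [simp]:
  "f \<in> X \<rightarrow> carrier G \<Longrightarrow> w \<in> words X \<Longrightarrow> word_eval G f w \<in> carrier G"
  by (induction w) (auto simp: Pi_iff)

lemma word_eval_append:
  "f \<in> X \<rightarrow> carrier G \<Longrightarrow> u \<in> words X \<Longrightarrow> v \<in> words X \<Longrightarrow>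
    word_eval G f (u @ v) = word_eval G f u \<otimes> word_eval G f v"
proof (induction u)
  case (Cons p u)
  obtain x e where p: "p = (x, e)" by force
  have "f x \<in> carrier G" "word_eval G f u \<in> carrier G" "word_eval G f v \<in> carrier G"
    using Cons.prems p by auto
  then show ?case using Cons by (simp add: p m_assoc)
qed simp

lemma word_eval_word_pow:
  "f x \<in> carrier G \<Longrightarrow> word_eval G f (word_pow x k) = f x [^] k"
  by (induction k) (simp_all add: word_pow_def nat_pow_Suc2[symmetric])

lemma word_eval_word_comm:
  "f x \<in> carrier G \<Longrightarrow> f y \<in> carrier G \<Longrightarrow> word_eval G f (word_comm x y) = grp_comm G (f x) (f y)"
  by (simp add: word_comm_def grp_comm_def m_assoc)

text \<open>Every rule of \<open>word_cong\<close> preserves values in a group; the second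
  hypothesis is exactly what the rule \<open>rel\<close> asks for.\<close>

lemma word_eval_cong:
  assumes f: "f \<in> X \<rightarrow> carrier G"
    and R: "\<And>u v. (u, v) \<in> R \<Longrightarrow> u \<in> words X \<Longrightarrow> v \<in> words X \<Longrightarrow> word_eval G f u = word_eval G f v"
  shows "(u, v) \<in> word_cong X R \<Longrightarrow> word_eval G f u = word_eval G f v"
proof (induction rule: word_cong.induct)
  case (append u u' v v')
  then show ?case using word_cong_in_words[of _ _ X R] f by (simp add: word_eval_append)
next
  case (cancel x e)
  then show ?case using f by (auto simp: Pi_iff)
qed (use R in auto)

text \<open>Von Dyck's theorem for a generating family. A class is sent to the value of a chosen
  representative, and \<open>word_eval_cong\<close> makes the choice irrelevant.\<close>

lemma presented_group_universal:
  assumes f: "f \<in> X \<rightarrow> carrier G"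
    and R: "\<And>u v. (u, v) \<in> R \<Longrightarrow> u \<in> words X \<Longrightarrow> v \<in> words X \<Longrightarrow> word_eval G f u = word_eval G f v"
    and gen: "generate G (f ` X) = carrier G"
  obtains h where "h \<in> hom (presented_group X R) G" "h ` carrier (presented_group X R) = carrier G"
    "\<And>x. x \<in> X \<Longrightarrow> h (word_class X R [(x, True)]) = f x"
proof -
  define h where "h A = word_eval G f (SOME w. w \<in> A)" for A
  have h: "h (word_class X R w) = word_eval G f w" if "w \<in> words X" for w
  proof -
    have "w \<in> word_class X R w"
      using that by (auto simp: word_class_def intro: word_cong.refl)
    then have "(SOME w'. w' \<in> word_class X R w) \<in> word_class X R w" by (rule someI)
    then show ?thesis
      using word_eval_cong[OF f R, where u = w] by (simp add: h_def word_class_def)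
  qed
  have hom: "h \<in> hom (presented_group X R) G"
    using f by (auto simp: hom_def carrier_presented_group h word_class_mult word_eval_append)
  interpret h: group_hom "presented_group X R" G h
    using hom by (simp add: group_hom_def group_hom_axioms_def group_presented_group group_axioms)
  have hx: "h (word_class X R [(x, True)]) = f x" if "x \<in> X" for x
    using that f by (auto simp: h Pi_iff)
  have "carrier G \<subseteq> h ` carrier (presented_group X R)"
  proof -
    have "f ` X \<subseteq> h ` carrier (presented_group X R)"
    proof
      fix a assume "a \<in> f ` X"
      then obtain x where x: "x \<in> X" "a = f x" by blast
      then have "word_class X R [(x, True)] \<in> carrier (presented_group X R)"
        by (auto simp: carrier_presented_group)
      then show "a \<in> h ` carrier (presented_group X R)" using hx[OF x(1)] x(2) by (metis imageI)
    qed
    then have "generate G (f ` X) \<subseteq> h ` carrier (presented_group X R)"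
      using h.img_is_subgroup by (rule generate_subgroup_incl)
    then show ?thesis using gen by simp
  qed
  then have "h ` carrier (presented_group X R) = carrier G"
    using h.hom_closed by blast
  from that[OF hom this] hx show thesis by blast
qed

end

lemma inv_word_class:
  assumes "x \<in> X"
  shows "inv\<^bsub>presented_group X R\<^esub> word_class X R [(x, True)] = word_class X R [(x, False)]"
proof -
  interpret P: group "presented_group X R" by (rule group_presented_group)
  have "([(x, False), (x, \<not> False)], []) \<in> word_cong X R" using assms by (rule word_cong.cancel)
  then have "word_class X R [(x, False)] \<otimes>\<^bsub>presented_group X R\<^esub> word_class X R [(x, True)]
      = \<one>\<^bsub>presented_group X R\<^esub>"
    using assms by (simp add: word_class_mult one_presented_group word_class_eq_iff)
  then show ?thesis
    using assms by (intro P.inv_equality) (auto simp: carrier_presented_group)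
qed

text \<open>Evaluating at the tautological generators recovers the class of the word. From this
  follow both that the presented group satisfies its relations and that it is generated by its
  letters.\<close>

lemma word_eval_presented_group:
  "w \<in> words X \<Longrightarrow> word_eval (presented_group X R) (\<lambda>x. word_class X R [(x, True)]) w = word_class X R w"
proof (induction w)
  case (Cons p w)
  obtain x e where p: "p = (x, e)" by force
  then have "word_eval (presented_group X R) (\<lambda>x. word_class X R [(x, True)]) (p # w) =
      word_class X R [(x, e)] \<otimes>\<^bsub>presented_group X R\<^esub> word_class X R w"
    using Cons by (auto simp: inv_word_class)
  then show ?case using Cons.prems p by (simp add: word_class_mult)
qed (simp add: one_presented_group)

lemma (in group) word_eval_in_generate:
  "f \<in> X \<rightarrow> carrier G \<Longrightarrow> w \<in> words X \<Longrightarrow> word_eval G f w \<in> generate G (f ` X)"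
  by (induction w)
    (auto intro: generate.one generate.incl[OF imageI] generate.inv[OF imageI] intro!: generate.eng)

lemma generate_presented_group:
  "generate (presented_group X R) ((\<lambda>x. word_class X R [(x, True)]) ` X) = carrier (presented_group X R)"
proof -
  interpret P: group "presented_group X R" by (rule group_presented_group)
  let ?f = "\<lambda>x. word_class X R [(x, True)]"
  have f: "?f \<in> X \<rightarrow> carrier (presented_group X R)" by (auto simp: carrier_presented_group)
  have "word_class X R w \<in> generate (presented_group X R) (?f ` X)" if "w \<in> words X" for w
    using P.word_eval_in_generate[OF f that] word_eval_presented_group[OF that, of R] by simp
  moreover have "?f ` X \<subseteq> carrier (presented_group X R)" using f by auto
  note P.generate_incl[OF this]
  ultimately show ?thesis
    unfolding carrier_presented_group by blast
qed

section \<open>Groups satisfying power and commutator relations\<close>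

text \<open>When all letters are declared, the groups satisfying this are the quotients of
  \<open>pc_group ps cs\<close>, each with a marked family of generators \<open>f\<close>. The
  classification reaches its presentations in this form.\<close>

definition pc_sat :: "('g \<times> nat) list \<Rightarrow> (('g \<times> 'g) \<times> ('g \<times> nat)) list \<Rightarrow>
    ('a, 'b) monoid_scheme \<Rightarrow> ('g \<Rightarrow> 'a) \<Rightarrow> bool" where
  "pc_sat ps cs G f \<longleftrightarrow> f \<in> fst ` set ps \<rightarrow> carrier G \<and>
     (\<forall>(x, k)\<in>set ps. f x [^]\<^bsub>G\<^esub> k = \<one>\<^bsub>G\<^esub>) \<and>
     (\<forall>((x, y), (z, k))\<in>set cs. grp_comm G (f x) (f y) = f z [^]\<^bsub>G\<^esub> k) \<and>
     (\<forall>x\<in>fst ` set ps. \<forall>y\<in>fst ` set ps. x \<noteq> y \<longrightarrow> (x, y) \<notin> fst ` set cs \<longrightarrow>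
        (y, x) \<notin> fst ` set cs \<longrightarrow> grp_comm G (f x) (f y) = \<one>\<^bsub>G\<^esub>) \<and>
     generate G (f ` fst ` set ps) = carrier G"

lemma group_pc_group: "group (pc_group ps cs)"
  by (simp add: pc_group_def group_presented_group)

definition pc_gen :: "('g \<times> nat) list \<Rightarrow> (('g \<times> 'g) \<times> ('g \<times> nat)) list \<Rightarrow> 'g \<Rightarrow> 'g word set" where
  "pc_gen ps cs x = word_class (fst ` set ps) (pc_rels ps cs) [(x, True)]"

text \<open>The rule \<open>rel\<close> skips relations with letters outside the generating set, so
  a relation in \<open>cs\<close> with an undeclared letter would not be imposed.\<close>

definition pc_letters_ok :: "('g \<times> nat) list \<Rightarrow> (('g \<times> 'g) \<times> ('g \<times> nat)) list \<Rightarrow> bool" where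
  "pc_letters_ok ps cs \<longleftrightarrow> (\<forall>((x, y), (z, k))\<in>set cs. {x, y, z} \<subseteq> fst ` set ps)"

lemma pc_sat_pc_group:
  assumes ok: "pc_letters_ok ps cs"
  shows "pc_sat ps cs (pc_group ps cs) (pc_gen ps cs)"
proof -
  let ?X = "fst ` set ps" and ?R = "pc_rels ps cs"
  let ?P = "pc_group ps cs" and ?f = "pc_gen ps cs"
  interpret P: group ?P by (rule group_pc_group)
  have f: "?f x \<in> carrier ?P" if "x \<in> ?X" for x
    using that unfolding pc_gen_def pc_group_def carrier_presented_group by (intro imageI) simp
  have rel: "word_eval ?P ?f u = word_eval ?P ?f v"
    if "(u, v) \<in> ?R" "u \<in> words ?X" "v \<in> words ?X" for u v
  proof -
    have "(u, v) \<in> word_cong ?X ?R" using that by (rule word_cong.rel)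
    moreover have "word_eval ?P ?f w = word_class ?X ?R w" if "w \<in> words ?X" for w
      using word_eval_presented_group[OF that, of ?R] by (simp add: pc_group_def pc_gen_def[abs_def])
    ultimately show ?thesis using that by (simp add: word_class_eq_iff)
  qed
  have 1: "?f x [^]\<^bsub>?P\<^esub> k = \<one>\<^bsub>?P\<^esub>" if "(x, k) \<in> set ps" for x k
  proof -
    have x: "x \<in> ?X" using that by force
    have "(word_pow x k, []) \<in> ?R" using that by (auto simp: pc_rels_def)
    then have "word_eval ?P ?f (word_pow x k) = word_eval ?P ?f []"
      using x by (intro rel) auto
    then show ?thesis using P.word_eval_word_pow[of ?f x k] f[OF x] by simp
  qed
  have 2: "grp_comm ?P (?f x) (?f y) = ?f z [^]\<^bsub>?P\<^esub> k" if c: "((x, y), (z, k)) \<in> set cs" for x y z k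
  proof -
    have "{x, y, z} \<subseteq> ?X" using bspec[OF ok[unfolded pc_letters_ok_def] c] by simp
    then have x: "x \<in> ?X" "y \<in> ?X" "z \<in> ?X" by auto
    have "(word_comm x y, word_pow z k) \<in> ?R" using c by (auto simp: pc_rels_def)
    then have "word_eval ?P ?f (word_comm x y) = word_eval ?P ?f (word_pow z k)"
      using x by (intro rel) auto
    then show ?thesis
      using P.word_eval_word_pow[of ?f z k] P.word_eval_word_comm[of ?f x y] f x by simp
  qed
  have 3: "grp_comm ?P (?f x) (?f y) = \<one>\<^bsub>?P\<^esub>"
    if x: "x \<in> ?X" "y \<in> ?X" "x \<noteq> y" "(x, y) \<notin> fst ` set cs" "(y, x) \<notin> fst ` set cs" for x y
  proof -
    have "(word_comm x y, []) \<in> ?R" using x unfolding pc_rels_def by blast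
    then have "word_eval ?P ?f (word_comm x y) = word_eval ?P ?f []"
      using x by (intro rel) auto
    then show ?thesis
      using P.word_eval_word_comm[of ?f x y] f x by simp
  qed
  have "?f ` ?X = (\<lambda>x. word_class ?X ?R [(x, True)]) ` ?X" by (simp add: pc_gen_def[abs_def])
  then have "generate ?P (?f ` ?X) = carrier ?P"
    using generate_presented_group[of ?X ?R] by (simp only: pc_group_def)
  moreover have "\<forall>(x, k)\<in>set ps. ?f x [^]\<^bsub>?P\<^esub> k = \<one>\<^bsub>?P\<^esub>" by (clarify, rule 1)
  moreover have "\<forall>((x, y), (z, k))\<in>set cs. grp_comm ?P (?f x) (?f y) = ?f z [^]\<^bsub>?P\<^esub> k"
    by (clarify, rule 2)
  ultimately show ?thesis unfolding pc_sat_def using f 3 by blast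
qed

lemma (in group) pc_sat_hom:
  assumes sat: "pc_sat ps cs G f" and ok: "pc_letters_ok ps cs"
  obtains h where "h \<in> hom (pc_group ps cs) G" "h ` carrier (pc_group ps cs) = carrier G"
    "\<And>x. x \<in> fst ` set ps \<Longrightarrow> h (pc_gen ps cs x) = f x"
proof -
  let ?X = "fst ` set ps" and ?R = "pc_rels ps cs"
  have f: "f \<in> ?X \<rightarrow> carrier G" and gen: "generate G (f ` ?X) = carrier G"
    using sat by (simp_all add: pc_sat_def)
  have "word_eval G f u = word_eval G f v" if "(u, v) \<in> ?R" for u v
    using that unfolding pc_rels_def
  proof (elim UnE CollectE exE conjE)
    fix x k assume *: "(u, v) = (word_pow x k, [])" "(x, k) \<in> set ps"
    then have "x \<in> ?X" by force
    then have "f x \<in> carrier G" using f by blast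
    moreover have "f x [^] k = \<one>" using * sat by (auto simp: pc_sat_def)
    ultimately show ?thesis using * by (simp add: word_eval_word_pow)
  next
    fix x y z k assume *: "(u, v) = (word_comm x y, word_pow z k)" "((x, y), z, k) \<in> set cs"
    then have "{x, y, z} \<subseteq> ?X" using bspec[OF ok[unfolded pc_letters_ok_def] *(2)] by simp
    then have "f x \<in> carrier G" "f y \<in> carrier G" "f z \<in> carrier G" using f by auto
    moreover have "grp_comm G (f x) (f y) = f z [^] k" using * sat by (auto simp: pc_sat_def)
    ultimately show ?thesis using * by (simp add: word_eval_word_pow word_eval_word_comm)
  next
    fix x y assume *: "(u, v) = (word_comm x y, [])" "x \<in> ?X" "y \<in> ?X" "x \<noteq> y"
      "(x, y) \<notin> fst ` set cs" "(y, x) \<notin> fst ` set cs"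
    have c: "f x \<in> carrier G" "f y \<in> carrier G" using f *(2,3) by auto
    have "grp_comm G (f x) (f y) = \<one>" using * sat unfolding pc_sat_def by blast
    with c show ?thesis using *(1) by (simp add: word_eval_word_comm)
  qed
  then obtain h where "h \<in> hom (presented_group ?X ?R) G"
    "h ` carrier (presented_group ?X ?R) = carrier G"
    "\<And>x. x \<in> ?X \<Longrightarrow> h (word_class ?X ?R [(x, True)]) = f x"
    using presented_group_universal[OF f _ gen, of ?R] by blast
  then show thesis using that[of h] by (simp add: pc_group_def pc_gen_def)
qed

section \<open>Commutators and cyclic extensions\<close>

context group
begin

section \<open>Commutator identities and centralizers\<close>

lemma grp_comm_closed [simp]:
  "x \<in> carrier G \<Longrightarrow> y \<in> carrier G \<Longrightarrow> grp_comm G x y \<in> carrier G"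
  by (simp add: grp_comm_def)

lemma inv_mult_cancel: "x \<in> carrier G \<Longrightarrow> y \<in> carrier G \<Longrightarrow> inv x \<otimes> (x \<otimes> y) = y"
  by (simp flip: m_assoc)

lemma mult_inv_cancel: "x \<in> carrier G \<Longrightarrow> y \<in> carrier G \<Longrightarrow> x \<otimes> (inv x \<otimes> y) = y"
  by (simp flip: m_assoc)

lemmas group_word_simps = m_assoc inv_mult_group inv_mult_cancel mult_inv_cancel

lemma mult_grp_comm:
  assumes "x \<in> carrier G" "y \<in> carrier G"
  shows "x \<otimes> y = y \<otimes> x \<otimes> grp_comm G x y"
  using assms by (simp add: grp_comm_def group_word_simps)

lemma grp_comm_eqI:
  assumes "x \<in> carrier G" "y \<in> carrier G" "d \<in> carrier G" "x \<otimes> y = y \<otimes> x \<otimes> d"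
  shows "grp_comm G x y = d"
proof -
  have "y \<otimes> x \<otimes> d = y \<otimes> x \<otimes> grp_comm G x y"
    using assms mult_grp_comm[of x y] by simp
  then show ?thesis using assms by simp
qed

lemma grp_comm_swap:
  assumes "x \<in> carrier G" "y \<in> carrier G"
  shows "grp_comm G y x = inv (grp_comm G x y)"
  using assms by (simp add: grp_comm_def group_word_simps)

lemma grp_comm_eq_one_iff:
  assumes "x \<in> carrier G" "y \<in> carrier G"
  shows "grp_comm G x y = \<one> \<longleftrightarrow> x \<otimes> y = y \<otimes> x"
  using assms mult_grp_comm[of x y] grp_comm_eqI[of x y \<one>] by auto

lemma subgroup_centralizer:
  assumes "S \<subseteq> carrier G"
  shows "subgroup {g \<in> carrier G. \<forall>s\<in>S. g \<otimes> s = s \<otimes> g} G"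
proof (rule subgroupI)
  fix a assume a: "a \<in> {g \<in> carrier G. \<forall>s\<in>S. g \<otimes> s = s \<otimes> g}"
  have "inv a \<otimes> s = s \<otimes> inv a" if "s \<in> S" for s
  proof -
    have s: "s \<in> carrier G" "a \<otimes> s = s \<otimes> a" using a that assms by auto
    then have "inv a \<otimes> (s \<otimes> a) \<otimes> inv a = inv a \<otimes> (a \<otimes> s) \<otimes> inv a" by simp
    then show ?thesis using a s(1) by (simp add: group_word_simps)
  qed
  then show "inv a \<in> {g \<in> carrier G. \<forall>s\<in>S. g \<otimes> s = s \<otimes> g}" using a by auto
next
  fix a b
  assume a: "a \<in> {g \<in> carrier G. \<forall>s\<in>S. g \<otimes> s = s \<otimes> g}"
    and b: "b \<in> {g \<in> carrier G. \<forall>s\<in>S. g \<otimes> s = s \<otimes> g}"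
  have "a \<otimes> b \<otimes> s = s \<otimes> (a \<otimes> b)" if "s \<in> S" for s
  proof -
    have s: "s \<in> carrier G" "a \<otimes> s = s \<otimes> a" "b \<otimes> s = s \<otimes> b" using a b that assms by auto
    have "a \<otimes> b \<otimes> s = a \<otimes> (s \<otimes> b)" using a b s by (simp add: m_assoc)
    also have "\<dots> = (a \<otimes> s) \<otimes> b" using a b s(1) by (simp add: m_assoc)
    also have "\<dots> = s \<otimes> (a \<otimes> b)" using a b s by (simp add: m_assoc)
    finally show ?thesis .
  qed
  then show "a \<otimes> b \<in> {g \<in> carrier G. \<forall>s\<in>S. g \<otimes> s = s \<otimes> g}" using a b by auto
next
  have "\<one> \<in> {g \<in> carrier G. \<forall>s\<in>S. g \<otimes> s = s \<otimes> g}" using assms by auto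
  then show "{g \<in> carrier G. \<forall>s\<in>S. g \<otimes> s = s \<otimes> g} \<noteq> {}" by blast
qed auto

lemma commutes_with_generate:
  assumes S: "S \<subseteq> carrier G" and z: "z \<in> carrier G" "\<And>s. s \<in> S \<Longrightarrow> z \<otimes> s = s \<otimes> z"
    and g: "g \<in> generate G S"
  shows "z \<otimes> g = g \<otimes> z"
proof -
  have "S \<subseteq> {g \<in> carrier G. \<forall>s\<in>{z}. g \<otimes> s = s \<otimes> g}" using S z(2) by auto
  then have "generate G S \<subseteq> {g \<in> carrier G. \<forall>s\<in>{z}. g \<otimes> s = s \<otimes> g}"
    by (rule generate_subgroup_incl) (use z subgroup_centralizer[of "{z}"] in auto)
  then show ?thesis using g by auto
qed

text \<open>Centralizers are subgroups, and this is used twice: each generator commutes with the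
  whole group, and therefore each element commutes with every generator and then with the whole
  group.\<close>

lemma comm_groupI_generate:
  assumes S: "S \<subseteq> carrier G" "generate G S = carrier G"
    and comm: "\<And>x y. x \<in> S \<Longrightarrow> y \<in> S \<Longrightarrow> x \<otimes> y = y \<otimes> x"
  shows "comm_group G"
proof (rule group_comm_groupI)
  have 1: "s \<otimes> g = g \<otimes> s" if "s \<in> S" "g \<in> carrier G" for s g
    using commutes_with_generate[of S s g] that S comm by auto
  show "x \<otimes> y = y \<otimes> x" if "x \<in> carrier G" "y \<in> carrier G" for x y
    using commutes_with_generate[of S x y] that S 1[of _ x] by auto
qed

section \<open>Commutators modulo a normal subgroup\<close>

lemma grp_comm_in_normal_iff:
  assumes N: "N \<lhd> G" and xy: "x \<in> carrier G" "y \<in> carrier G"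
  shows "grp_comm G x y \<in> N \<longleftrightarrow> N #> (x \<otimes> y) = N #> (y \<otimes> x)"
proof -
  interpret N: normal N G by (rule N)
  have "N #> (x \<otimes> y) = (y \<otimes> x) <# (grp_comm G x y <# N)"
    using xy N.coset_eq mult_grp_comm[OF xy] by (simp add: lcos_m_assoc N.subset)
  moreover have "N #> (y \<otimes> x) = (y \<otimes> x) <# N" using N.coset_eq xy by simp
  ultimately have *: "N #> (x \<otimes> y) = N #> (y \<otimes> x) \<longleftrightarrow>
      (y \<otimes> x) <# (grp_comm G x y <# N) = (y \<otimes> x) <# N" by simp
  have "(y \<otimes> x) <# A = (y \<otimes> x) <# B \<longleftrightarrow> A = B" if "A \<subseteq> carrier G" "B \<subseteq> carrier G" for A B
  proof
    assume "(y \<otimes> x) <# A = (y \<otimes> x) <# B"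
    then have "inv (y \<otimes> x) <# ((y \<otimes> x) <# A) = inv (y \<otimes> x) <# ((y \<otimes> x) <# B)" by simp
    then show "A = B" using xy that by (simp add: lcos_m_assoc lcos_mult_one)
  qed simp
  with * have "N #> (x \<otimes> y) = N #> (y \<otimes> x) \<longleftrightarrow> grp_comm G x y <# N = N"
    using xy N.subset by (simp add: l_coset_subset_G)
  also have "\<dots> \<longleftrightarrow> grp_comm G x y \<in> N"
    using xy N.coset_eq coset_join1[of N "grp_comm G x y"] coset_join2[of "grp_comm G x y" N]
      N.subset N.subgroup_axioms by auto
  finally show ?thesis by simp
qed

text \<open>A conjugate of \<open>h\<close> differs from \<open>h\<close> by a commutator:
  \<open>x h x^-1 = [x^-1, h^-1] h\<close>.\<close>

lemma normal_if_commutators: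
  assumes H: "subgroup H G" and c: "\<And>x y. x \<in> carrier G \<Longrightarrow> y \<in> carrier G \<Longrightarrow> grp_comm G x y \<in> H"
  shows "H \<lhd> G"
proof (rule normal_invI[OF H])
  fix x h assume x: "x \<in> carrier G" and h: "h \<in> H"
  have hG: "h \<in> carrier G" using subgroup.mem_carrier[OF H h] .
  have "x \<otimes> h \<otimes> inv x = grp_comm G (inv x) (inv h) \<otimes> h"
    using x hG by (simp add: grp_comm_def group_word_simps)
  then show "x \<otimes> h \<otimes> inv x \<in> H"
    using c[of "inv x" "inv h"] x hG h subgroup.m_closed[OF H] by simp
qed

lemma comm_group_Mod_iff:
  assumes N: "N \<lhd> G"
  shows "comm_group (G Mod N) \<longleftrightarrow> (\<forall>x\<in>carrier G. \<forall>y\<in>carrier G. grp_comm G x y \<in> N)"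
proof -
  interpret N: normal N G by (rule N)
  interpret Q: group "G Mod N" by (rule N.factorgroup_is_group)
  have m: "(N #> x) \<otimes>\<^bsub>G Mod N\<^esub> (N #> y) = N #> (x \<otimes> y)"
    if "x \<in> carrier G" "y \<in> carrier G" for x y
    using that by (simp add: N.rcos_sum)
  show ?thesis
  proof
    assume "comm_group (G Mod N)"
    then interpret comm_group "G Mod N" .
    have "N #> (x \<otimes> y) = N #> (y \<otimes> x)" if "x \<in> carrier G" "y \<in> carrier G" for x y
    proof -
      have "N #> x \<in> carrier (G Mod N)" "N #> y \<in> carrier (G Mod N)"
        using that by (auto simp: carrier_FactGroup)
      from m_comm[OF this] show ?thesis unfolding m[OF that] m[OF that(2,1)] .
    qed
    then show "\<forall>x\<in>carrier G. \<forall>y\<in>carrier G. grp_comm G x y \<in> N"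
      by (simp add: grp_comm_in_normal_iff[OF N])
  next
    assume *: "\<forall>x\<in>carrier G. \<forall>y\<in>carrier G. grp_comm G x y \<in> N"
    show "comm_group (G Mod N)"
    proof (rule Q.group_comm_groupI)
      fix A B assume "A \<in> carrier (G Mod N)" "B \<in> carrier (G Mod N)"
      then obtain x y where xy: "x \<in> carrier G" "y \<in> carrier G" "A = N #> x" "B = N #> y"
        by (auto simp: carrier_FactGroup)
      then have "N #> (x \<otimes> y) = N #> (y \<otimes> x)"
        using grp_comm_in_normal_iff[OF N] * by blast
      then show "A \<otimes>\<^bsub>G Mod N\<^esub> B = B \<otimes>\<^bsub>G Mod N\<^esub> A"
        using m[of x y] m[of y x] xy by simp
    qed
  qed
qed

lemma generate_Mod:
  assumes N: "N \<lhd> G" and S: "S \<subseteq> carrier G" "generate G S = carrier G"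
  shows "generate (G Mod N) ((\<lambda>x. N #> x) ` S) = carrier (G Mod N)"
proof -
  interpret N: normal N G by (rule N)
  interpret h: group_hom G "G Mod N" "\<lambda>x. N #> x"
    using N.r_coset_hom_Mod N.factorgroup_is_group
    by (simp add: group_hom_def group_hom_axioms_def group_axioms)
  show ?thesis
    using h.generate_img[OF S(1)] S(2) by (simp add: carrier_FactGroup)
qed

text \<open>The quotient is generated by pairwise commuting cosets, hence abelian, so it suffices to
  look at commutators of generators.\<close>

lemma grp_comm_in_normal_if_generators:
  assumes N: "N \<lhd> G" and S: "S \<subseteq> carrier G" "generate G S = carrier G"
    and c: "\<And>x y. x \<in> S \<Longrightarrow> y \<in> S \<Longrightarrow> grp_comm G x y \<in> N"
    and xy: "x \<in> carrier G" "y \<in> carrier G"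
  shows "grp_comm G x y \<in> N"
proof -
  interpret N: normal N G by (rule N)
  interpret Q: group "G Mod N" by (rule N.factorgroup_is_group)
  have "comm_group (G Mod N)"
  proof (rule Q.comm_groupI_generate[OF _ generate_Mod[OF N S]])
    show "(\<lambda>x. N #> x) ` S \<subseteq> carrier (G Mod N)" using S(1) by (auto simp: carrier_FactGroup)
    fix A B assume "A \<in> (\<lambda>x. N #> x) ` S" "B \<in> (\<lambda>x. N #> x) ` S"
    then obtain x y where xy: "x \<in> S" "y \<in> S" "A = N #> x" "B = N #> y" by blast
    then have "x \<in> carrier G" "y \<in> carrier G" using S by auto
    then show "A \<otimes>\<^bsub>G Mod N\<^esub> B = B \<otimes>\<^bsub>G Mod N\<^esub> A"
      using grp_comm_in_normal_iff[OF N, of x y] c[OF xy(1,2)] xy(3,4) by (simp add: N.rcos_sum)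
  qed
  then show ?thesis using comm_group_Mod_iff[OF N] xy by blast
qed

text \<open>Normality allows all powers of \<open>g\<close> to be collected on the right, and
  \<open>g^k \<in> N\<close> bounds the exponents. The cardinality estimates for adjoining one
  generator come from this description.\<close>

lemma generate_insert_normal:
  assumes N: "N \<lhd> G" and g: "g \<in> carrier G" "g [^] k \<in> N" "k > (0::nat)"
  shows "generate G (insert g N) = (\<lambda>(h, i). h \<otimes> g [^] i) ` (N \<times> {..<k})"
proof
  interpret N: normal N G by (rule N)
  \<comment> \<open>Integer exponents make closure under inverses immediate; division with remainder
    by \<open>k\<close> brings them into the finite range afterwards.\<close>
  define T where "T = {h \<otimes> g [^] (i::int) | h i. h \<in> N}"
  have conj: "g [^] i \<otimes> h \<otimes> inv (g [^] i) \<in> N" if "h \<in> N" for h and i :: int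
    using N.inv_op_closed2[of "g [^] i" h] g that by simp
  have "subgroup T G"
  proof (rule subgroupI)
    show "T \<subseteq> carrier G" using g by (auto simp: T_def)
    have "\<one> \<otimes> g [^] (0::int) \<in> T" unfolding T_def using N.one_closed by blast
    then show "T \<noteq> {}" by blast
    fix a assume "a \<in> T"
    then obtain h i where a: "a = h \<otimes> g [^] (i::int)" "h \<in> N" by (auto simp: T_def)
    have h: "h \<in> carrier G" using a by simp
    have "inv a = (g [^] (-i) \<otimes> inv h \<otimes> inv (g [^] (-i))) \<otimes> g [^] (-i)"
      using a h g by (simp add: group_word_simps int_pow_neg)
    moreover have "g [^] (-i) \<otimes> inv h \<otimes> inv (g [^] (-i)) \<in> N" using a by (intro conj) simp
    ultimately show "inv a \<in> T" unfolding T_def by blast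
    fix b assume "b \<in> T"
    then obtain h' j where b: "b = h' \<otimes> g [^] (j::int)" "h' \<in> N" by (auto simp: T_def)
    have h': "h' \<in> carrier G" using b by simp
    have "a \<otimes> b = (h \<otimes> (g [^] i \<otimes> h' \<otimes> inv (g [^] i))) \<otimes> g [^] (i + j)"
      using a b h h' int_pow_mult[OF g(1), of i j] g by (simp add: group_word_simps)
    then show "a \<otimes> b \<in> T" unfolding T_def using a b conj[of h' i] by blast
  qed
  moreover have "insert g N \<subseteq> T"
  proof
    fix x assume "x \<in> insert g N"
    then show "x \<in> T"
    proof
      assume "x = g"
      then have "x = \<one> \<otimes> g [^] (1::int)" using g by simp
      then show ?thesis unfolding T_def using N.one_closed by blast
    next
      assume "x \<in> N"
      then have "x = x \<otimes> g [^] (0::int)" by simp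
      then show ?thesis unfolding T_def using \<open>x \<in> N\<close> by blast
    qed
  qed
  ultimately have "generate G (insert g N) \<subseteq> T" by (rule generate_subgroup_incl[rotated])
  also have "T \<subseteq> (\<lambda>(h, i). h \<otimes> g [^] i) ` (N \<times> {..<k})"
  proof
    fix x assume "x \<in> T"
    then obtain h i where x: "x = h \<otimes> g [^] (i::int)" "h \<in> N" by (auto simp: T_def)
    have "g [^] i = (g [^] int k) [^] (i div int k) \<otimes> g [^] (i mod int k)"
      using g int_pow_mult[OF g(1), of "int k * (i div int k)" "i mod int k"] by (simp add: int_pow_pow)
    also have "g [^] (i mod int k) = g [^] nat (i mod int k)"
      using g by (simp flip: int_pow_int)
    finally have "x = (h \<otimes> (g [^] int k) [^] (i div int k)) \<otimes> g [^] nat (i mod int k)"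
      using x g by (simp add: m_assoc)
    moreover have "h \<otimes> (g [^] int k) [^] (i div int k) \<in> N"
      using x g subgroup_int_pow_closed[OF N.subgroup_axioms, of "g [^] k" "i div int k"]
      by (simp add: int_pow_int)
    moreover have "nat (i mod int k) < k" using g by (simp add: nat_less_iff)
    ultimately show "x \<in> (\<lambda>(h, i). h \<otimes> g [^] i) ` (N \<times> {..<k})"
      by (intro image_eqI[of _ _ "(h \<otimes> (g [^] int k) [^] (i div int k), nat (i mod int k))"]) auto
  qed
  finally show "generate G (insert g N) \<subseteq> (\<lambda>(h, i). h \<otimes> g [^] i) ` (N \<times> {..<k})" .
  have "h \<otimes> g [^] i \<in> generate G (insert g N)" if "h \<in> N" for h and i :: nat
  proof -
    have sub: "subgroup (generate G (insert g N)) G"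
      using g N.subset by (intro generate_is_subgroup) auto
    have "g [^] i \<in> generate G (insert g N)"
      using subgroup_int_pow_closed[OF sub generate.incl[of g], of "int i"] by (simp add: int_pow_int)
    with that show ?thesis by (intro generate.eng[OF generate.incl]) auto
  qed
  then show "(\<lambda>(h, i). h \<otimes> g [^] i) ` (N \<times> {..<k}) \<subseteq> generate G (insert g N)" by auto
qed

lemma card_generate_insert_normal_le:
  assumes "N \<lhd> G" "g \<in> carrier G" "g [^] k \<in> N" "k > (0::nat)" "finite N"
  shows "finite (generate G (insert g N))" "card (generate G (insert g N)) \<le> card N * k"
proof -
  have "card ((\<lambda>(h, i). h \<otimes> g [^] i) ` (N \<times> {..<k})) \<le> card (N \<times> {..<k})"
    by (rule card_image_le) (use assms in auto)
  then show "finite (generate G (insert g N))" "card (generate G (insert g N)) \<le> card N * k"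
    using assms by (auto simp: generate_insert_normal card_cartesian_product)
qed

lemma card_generate_insert_normal:
  assumes N: "N \<lhd> G" and g: "g \<in> carrier G" "g [^] k \<in> N" "k > (0::nat)"
    and min: "\<And>j. 0 < j \<Longrightarrow> j < k \<Longrightarrow> g [^] (j::nat) \<notin> N"
  shows "card (generate G (insert g N)) = card N * k"
proof -
  interpret N: normal N G by (rule N)
  \<comment> \<open>Equal products with different exponents would put the power
    \<open>g^(j - i)\<close>, whose exponent is positive and smaller than \<open>k\<close>, into
    \<open>N\<close>.\<close>
  have aux: False if "h \<otimes> g [^] i = h' \<otimes> g [^] j" "i < j" "j < k" "h \<in> N" "h' \<in> N" for h h' i j
  proof -
    have h: "h \<in> carrier G" "h' \<in> carrier G" using that by auto
    have "g [^] j = g [^] (j - i) \<otimes> g [^] i" using g that by (simp add: nat_pow_mult)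
    then have "h \<otimes> g [^] i = (h' \<otimes> g [^] (j - i)) \<otimes> g [^] i" using that(1) g h by (simp add: m_assoc)
    then have "h = h' \<otimes> g [^] (j - i)" using g h by simp
    then have "g [^] (j - i) = inv h' \<otimes> h" using g h by (simp add: group_word_simps)
    then have "g [^] (j - i) \<in> N" using that by simp
    then show False using min[of "j - i"] that by simp
  qed
  have "inj_on (\<lambda>(h, i). h \<otimes> g [^] i) (N \<times> {..<k})"
  proof (rule inj_onI, clarsimp)
    fix h i h' j assume *: "h \<in> N" "i < k" "h' \<in> N" "j < k" "h \<otimes> g [^] i = h' \<otimes> g [^] j"
    have "i = j" using aux[of h i h' j] aux[of h' j h i] * by (cases i j rule: linorder_cases) auto
    then show "h = h' \<and> i = j" using * g by simp
  qed
  then show ?thesis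
    using g by (simp add: generate_insert_normal[OF N] card_image card_cartesian_product)
qed

end

section \<open>Admissible presentations\<close>

text \<open>The divisibility conditions make \<open>c\<^sup>w\<close> central with \<open>c\<^bsup>4w\<^esup> = 1\<close>, and make \<open>c\<^bsup>w e f\<^esup>\<close> depend only
  on the exponents \<open>e\<close>, \<open>f\<close> of two noncommuting generators modulo their orders.\<close>

definition pc_ok :: "('g \<times> nat) list \<Rightarrow> (('g \<times> 'g) \<times> ('g \<times> nat)) list \<Rightarrow> 'g \<Rightarrow> nat \<Rightarrow> bool" where
  "pc_ok ps cs c w \<longleftrightarrow> distinct (map fst ps) \<and> distinct (map fst cs) \<and> list_all (\<lambda>(x, k). 0 < k) ps \<and> c \<in> set (map fst ps) \<and>
     4 dvd w \<and> the (map_of ps c) dvd 4 * w \<and>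
     list_all (\<lambda>((x, y), (z, k)). z = c \<and> k = w \<and> x \<noteq> y \<and> x \<in> set (map fst ps) \<and> y \<in> set (map fst ps) \<and>
       the (map_of ps c) dvd w * the (map_of ps x) \<and> the (map_of ps c) dvd w * the (map_of ps y) \<and>
       (y, x) \<notin> set (map fst cs)) cs"

locale pc_data =
  fixes ps :: "('g \<times> nat) list" and cs :: "(('g \<times> 'g) \<times> ('g \<times> nat)) list" and c :: 'g and w :: nat
  assumes ok: "pc_ok ps cs c w"
begin

definition X where "X = fst ` set ps"
definition gen_ord where "gen_ord x = the (map_of ps x)"
definition S where "S = fst ` set cs"

lemma finite_X: "finite X" by (simp add: X_def)

lemma c_X: "c \<in> X" using ok by (simp add: pc_ok_def X_def)

lemma set_ps: "(x, k) \<in> set ps \<longleftrightarrow> x \<in> X \<and> k = gen_ord x"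
proof -
  have d: "distinct (map fst ps)" using ok by (simp add: pc_ok_def)
  show ?thesis
  proof
    assume "(x, k) \<in> set ps"
    then have "map_of ps x = Some k" "x \<in> X" using d by (auto simp: X_def intro: rev_image_eqI)
    then show "x \<in> X \<and> k = gen_ord x" by (simp add: gen_ord_def)
  next
    assume *: "x \<in> X \<and> k = gen_ord x"
    then obtain k' where "(x, k') \<in> set ps" by (auto simp: X_def)
    then show "(x, k) \<in> set ps" using d * by (auto simp: gen_ord_def)
  qed
qed

lemma ord_pos: "x \<in> X \<Longrightarrow> 0 < gen_ord x"
  using ok set_ps[of x "gen_ord x"] by (auto simp: pc_ok_def list_all_iff)

lemma prod_ord: "(\<Prod>x\<in>X. gen_ord x) = prod_list (map snd ps)"
proof -
  have d: "distinct (map fst ps)" using ok by (simp add: pc_ok_def)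
  have "(\<Prod>x\<in>X. gen_ord x) = (\<Prod>x\<in>set (map fst ps). gen_ord x)" by (simp add: X_def)
  also have "\<dots> = prod_list (map gen_ord (map fst ps))" using d by (rule prod.distinct_set_conv_list)
  also have "map gen_ord (map fst ps) = map snd ps" using set_ps by (auto simp: X_def)
  finally show ?thesis .
qed

lemma w_dvd: "4 dvd w" "gen_ord c dvd 4 * w" using ok by (simp_all add: pc_ok_def gen_ord_def)

text \<open>This is the arithmetic behind the centrality of \<open>c^w\<close>: a commutator of
  \<open>c^w\<close> with a generator is a power of \<open>c^(w * w)\<close>.\<close>

lemma ord_dvd_w2: "gen_ord c dvd w * w"
proof -
  obtain v where "w = 4 * v" using w_dvd(1) by blast
  then have "w * w = 4 * w * v" by simp
  then show ?thesis using w_dvd(2) by (metis dvd_mult2)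
qed

lemma cs_D:
  assumes "((x, y), (z, k)) \<in> set cs"
  shows "z = c \<and> k = w \<and> x \<noteq> y \<and> x \<in> X \<and> y \<in> X \<and> gen_ord c dvd w * gen_ord x \<and> gen_ord c dvd w * gen_ord y \<and> (y, x) \<notin> S"
proof -
  have "list_all (\<lambda>((x, y), (z, k)). z = c \<and> k = w \<and> x \<noteq> y \<and> x \<in> set (map fst ps) \<and>
       y \<in> set (map fst ps) \<and>
       the (map_of ps c) dvd w * the (map_of ps x) \<and> the (map_of ps c) dvd w * the (map_of ps y) \<and>
       (y, x) \<notin> set (map fst cs)) cs"
    using ok by (simp only: pc_ok_def)
  from bspec[OF this[unfolded list_all_iff] assms] show ?thesis
    unfolding X_def gen_ord_def S_def set_map case_prod_conv by blast
qed

lemma cs_iff: "((x, y), (z, k)) \<in> set cs \<longleftrightarrow> (x, y) \<in> S \<and> z = c \<and> k = w"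
proof
  assume *: "((x, y), (z, k)) \<in> set cs"
  then have "fst ((x, y), (z, k)) \<in> S" unfolding S_def by (rule imageI)
  then show "(x, y) \<in> S \<and> z = c \<and> k = w" using cs_D[OF *] by simp
next
  assume *: "(x, y) \<in> S \<and> z = c \<and> k = w"
  then obtain z' k' where "((x, y), (z', k')) \<in> set cs" by (auto simp: S_def)
  then show "((x, y), (z, k)) \<in> set cs" using cs_D * by metis
qed

lemma S_D:
  assumes "(x, y) \<in> S"
  shows "x \<in> X" "y \<in> X" "x \<noteq> y" "(y, x) \<notin> S" "gen_ord c dvd w * gen_ord x" "gen_ord c dvd w * gen_ord y"
  using cs_D[of x y c w] assms cs_iff by auto

lemma letters_ok: "pc_letters_ok ps cs"
  unfolding pc_letters_ok_def using S_D c_X by (auto simp: cs_iff X_def[symmetric])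

lemma pc_sat_alt:
  "pc_sat ps cs G f \<longleftrightarrow> f \<in> X \<rightarrow> carrier G \<and> (\<forall>x\<in>X. f x [^]\<^bsub>G\<^esub> gen_ord x = \<one>\<^bsub>G\<^esub>) \<and>
     (\<forall>(x, y)\<in>S. grp_comm G (f x) (f y) = f c [^]\<^bsub>G\<^esub> w) \<and>
     (\<forall>x\<in>X. \<forall>y\<in>X. x \<noteq> y \<longrightarrow> (x, y) \<notin> S \<longrightarrow> (y, x) \<notin> S \<longrightarrow> grp_comm G (f x) (f y) = \<one>\<^bsub>G\<^esub>) \<and>
     generate G (f ` X) = carrier G"
proof -
  have "(\<forall>(x, k)\<in>set ps. f x [^]\<^bsub>G\<^esub> k = \<one>\<^bsub>G\<^esub>) \<longleftrightarrow> (\<forall>x\<in>X. f x [^]\<^bsub>G\<^esub> gen_ord x = \<one>\<^bsub>G\<^esub>)"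
    unfolding Ball_def split_paired_All case_prod_conv set_ps by blast
  moreover have "(\<forall>((x, y), (z, k))\<in>set cs. grp_comm G (f x) (f y) = f z [^]\<^bsub>G\<^esub> k) \<longleftrightarrow>
      (\<forall>(x, y)\<in>S. grp_comm G (f x) (f y) = f c [^]\<^bsub>G\<^esub> w)"
    unfolding Ball_def split_paired_All case_prod_conv cs_iff by blast
  ultimately show ?thesis
    by (simp add: pc_sat_def flip: X_def S_def)
qed

end

section \<open>Upper bound for the order of a group satisfying an admissible presentation\<close>

locale pc_sat_group = pc_data + group G for G (structure) +
  fixes f
  assumes sat: "pc_sat ps cs G f"
begin

lemma f_closed: "x \<in> X \<Longrightarrow> f x \<in> carrier G" using sat by (auto simp: pc_sat_alt)

lemma f_pow: "x \<in> X \<Longrightarrow> f x [^] gen_ord x = \<one>" using sat by (auto simp: pc_sat_alt)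

lemma f_gen: "generate G (f ` X) = carrier G" "f ` X \<subseteq> carrier G"
  using sat f_closed by (auto simp: pc_sat_alt)

definition "zc = f c [^] w"

lemma zc_closed: "zc \<in> carrier G" by (simp add: zc_def f_closed c_X)

lemma f_c_pow_eq_one: "gen_ord c dvd n \<Longrightarrow> f c [^] n = \<one>"
  using f_pow[OF c_X] f_closed[OF c_X] by (auto simp: nat_pow_pow[symmetric] elim!: dvdE)

lemma grp_comm_gens:
  assumes "x \<in> X" "y \<in> X"
  shows "grp_comm G (f x) (f y) \<in> {\<one>, zc, inv zc}"
proof -
  consider "x = y" | "(x, y) \<in> S" | "(y, x) \<in> S" | "x \<noteq> y" "(x, y) \<notin> S" "(y, x) \<notin> S" by blast
  then show ?thesis
  proof cases
    case 1 then show ?thesis using assms f_closed by (simp add: grp_comm_eq_one_iff)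
  next
    case 2 then show ?thesis using sat by (auto simp: pc_sat_alt zc_def)
  next
    case 3 then show ?thesis
      using sat assms f_closed by (auto simp: pc_sat_alt zc_def grp_comm_swap[of "f y" "f x"])
  next
    case 4 then show ?thesis using sat assms by (auto simp: pc_sat_alt)
  qed
qed

text \<open>Conjugation by a generator sends \<open>f c\<close> to \<open>f c\<close> times a power of \<open>f c\<^sup>w\<close>; hence it fixes
  \<open>f c\<^sup>w\<close>, because the order of \<open>f c\<close> divides \<open>w\<^sup>2\<close>.\<close>

lemma zc_commutes_gens:
  assumes x: "x \<in> X"
  shows "zc \<otimes> f x = f x \<otimes> zc"
proof -
  let ?g = "f c" and ?d = "grp_comm G (f c) (f x)"
  have g: "?g \<in> carrier G" "f x \<in> carrier G" using x c_X f_closed by auto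
  have dz: "?d \<in> {\<one>, zc, inv zc}" using grp_comm_gens c_X x by blast
  have zg: "zc \<otimes> ?g = ?g \<otimes> zc" using g nat_pow_comm[of ?g w 1] by (simp add: zc_def)
  then have "inv zc \<otimes> (zc \<otimes> ?g) \<otimes> inv zc = inv zc \<otimes> (?g \<otimes> zc) \<otimes> inv zc" by simp
  then have "?g \<otimes> inv zc = inv zc \<otimes> ?g" using g zc_closed by (simp add: group_word_simps)
  then have dg: "?d \<otimes> ?g = ?g \<otimes> ?d"
    using dz zg g by auto
  have zw: "zc [^] w = \<one>"
    using f_c_pow_eq_one[OF ord_dvd_w2] g by (simp add: zc_def nat_pow_pow)
  have dw: "?d [^] w = \<one>" using dz zw zc_closed by (auto simp: nat_pow_inv)
  have "inv (f x) \<otimes> ?g \<otimes> f x = ?g \<otimes> ?d"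
    using mult_grp_comm[of ?g "f x"] g by (simp add: group_word_simps)
  moreover have "(inv (f x) \<otimes> ?g \<otimes> f x) [^] n = inv (f x) \<otimes> ?g [^] n \<otimes> f x" for n :: nat
    using g by (induction n) (simp_all add: group_word_simps)
  ultimately have "inv (f x) \<otimes> zc \<otimes> f x = (?g \<otimes> ?d) [^] w" by (simp add: zc_def)
  also have "\<dots> = zc"
    using pow_mult_distrib[OF dg[symmetric], of w] g dw by (simp add: zc_def)
  finally have "f x \<otimes> (inv (f x) \<otimes> zc \<otimes> f x) = f x \<otimes> zc" by simp
  then show ?thesis using g zc_closed by (simp add: group_word_simps)
qed

lemma zc_central: "g \<in> carrier G \<Longrightarrow> zc \<otimes> g = g \<otimes> zc"
  using commutes_with_generate[of "f ` X" zc g] f_gen zc_closed zc_commutes_gens by auto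

lemma zc_gen_central:
  assumes z: "z \<in> generate G {zc}" and g: "g \<in> carrier G"
  shows "z \<otimes> g = g \<otimes> z"
  using commutes_with_generate[of "{zc}" g z] zc_closed zc_central[OF g] z g by auto

text \<open>The cyclic group generated by \<open>zc\<close> is central, hence normal, and it
  contains the commutators of the generators.\<close>

lemma grp_comm_zc:
  assumes "x \<in> carrier G" "y \<in> carrier G"
  shows "grp_comm G x y \<in> generate G {zc}"
proof (rule grp_comm_in_normal_if_generators[OF _ f_gen(2,1) _ assms])
  have sub: "subgroup (generate G {zc}) G" using zc_closed by (intro generate_is_subgroup) auto
  show "generate G {zc} \<lhd> G"
  proof (rule normal_invI[OF sub])
    fix x h assume "x \<in> carrier G" "h \<in> generate G {zc}"
    moreover from this have "h \<in> carrier G" using subgroup.mem_carrier[OF sub] by blast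
    ultimately show "x \<otimes> h \<otimes> inv x \<in> generate G {zc}"
      using zc_gen_central[of h x, symmetric] by (simp add: m_assoc)
  qed
  fix x y assume "x \<in> f ` X" "y \<in> f ` X"
  then have "grp_comm G x y \<in> {\<one>, zc, inv zc}" using grp_comm_gens by blast
  then show "grp_comm G x y \<in> generate G {zc}"
    by (auto intro: generate.one generate.incl generate.inv)
qed

text \<open>The generator \<open>c\<close> comes first, so every stage contains \<open>zc\<close>
  and with it all commutators. Each stage is therefore normal, and adjoining \<open>y\<close>
  multiplies its order by at most \<open>gen_ord y\<close>.\<close>

lemma card_le_aux:
  assumes "finite Y" "Y \<subseteq> X - {c}"
  shows "finite (generate G (f ` insert c Y)) \<and>
    card (generate G (f ` insert c Y)) \<le> gen_ord c * (\<Prod>y\<in>Y. gen_ord y)"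
  using assms
proof (induction Y rule: finite_induct)
  case empty
  have "{\<one>} \<lhd> G" by (rule one_is_normal)
  moreover have "generate G (insert (f c) {\<one>}) = generate G {f c}"
  proof
    have "insert (f c) {\<one>} \<subseteq> generate G {f c}" by (auto intro: generate.one generate.incl)
    then show "generate G (insert (f c) {\<one>}) \<subseteq> generate G {f c}"
      by (rule generate_subgroup_incl) (simp add: f_closed c_X generate_is_subgroup)
    show "generate G {f c} \<subseteq> generate G (insert (f c) {\<one>})" by (rule mono_generate) auto
  qed
  ultimately show ?case
    using card_generate_insert_normal_le[of "{\<one>}" "f c" "gen_ord c"] f_closed c_X f_pow[OF c_X] ord_pos[OF c_X]
    by simp
next
  case (insert y Y)
  let ?H = "generate G (f ` insert c Y)"
  have Y: "insert c Y \<subseteq> X" using insert.prems c_X by auto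
  then have fY: "f ` insert c Y \<subseteq> carrier G" using f_closed by auto
  have y: "y \<in> X" using insert.prems by auto
  have sub: "subgroup ?H G" using fY by (rule generate_is_subgroup)
  have "zc \<in> ?H"
  proof -
    have "f c \<in> ?H" by (auto intro: generate.incl)
    then show ?thesis unfolding zc_def
      using subgroup_int_pow_closed[OF sub, of "f c" "int w"] by (simp add: int_pow_int)
  qed
  then have "generate G {zc} \<subseteq> ?H" using sub by (intro generate_subgroup_incl) auto
  then have N: "?H \<lhd> G" using grp_comm_zc by (intro normal_if_commutators[OF sub]) blast
  have "f y [^] gen_ord y \<in> ?H" using f_pow[OF y] generate.one by metis
  note * = card_generate_insert_normal_le[OF N f_closed[OF y] this ord_pos[OF y]]
  have "f ` insert c (insert y Y) \<subseteq> generate G (insert (f y) ?H)"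
    by (auto intro: generate.incl)
  then have le: "generate G (f ` insert c (insert y Y)) \<subseteq> generate G (insert (f y) ?H)"
    using subgroup.subset[OF sub] f_closed[OF y] by (intro generate_subgroup_incl generate_is_subgroup) auto
  have IH: "finite ?H" "card ?H \<le> gen_ord c * (\<Prod>y\<in>Y. gen_ord y)" using insert by auto
  have "card (generate G (f ` insert c (insert y Y))) \<le> card ?H * gen_ord y"
    using card_mono[OF *(1)[OF IH(1)] le] *(2)[OF IH(1)] by linarith
  also have "\<dots> \<le> gen_ord c * (\<Prod>y\<in>Y. gen_ord y) * gen_ord y" using IH by simp
  also have "\<dots> = gen_ord c * (\<Prod>y\<in>insert y Y. gen_ord y)" using insert by simp
  finally show ?case using finite_subset[OF le *(1)[OF IH(1)]] by blast
qed

lemma finite_carrier: "finite (carrier G)" and card_carrier_le: "card (carrier G) \<le> (\<Prod>x\<in>X. gen_ord x)"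
proof -
  have i: "insert c (X - {c}) = X" using c_X by auto
  have "finite (carrier G) \<and> card (carrier G) \<le> gen_ord c * (\<Prod>y\<in>X - {c}. gen_ord y)"
    using card_le_aux[of "X - {c}"] finite_X f_gen(1) unfolding i by auto
  then show "finite (carrier G)" "card (carrier G) \<le> (\<Prod>x\<in>X. gen_ord x)"
    using prod.remove[OF finite_X c_X, of gen_ord] by auto
qed

end

context pc_data
begin

lemma pc_sat_group_pc_group: "pc_sat_group ps cs c w (pc_group ps cs) (pc_gen ps cs)"
  by (simp add: pc_sat_group_def pc_data_axioms group_pc_group pc_sat_group_axioms_def
      pc_sat_pc_group letters_ok)

text \<open>The presented group maps onto \<open>G\<close> and has at most as many elements as the
  product of the orders, so a \<open>G\<close> that attains this number forces injectivity. Applied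
  to the model this computes the order of the presented group; applied to a group under
  classification it identifies that group.\<close>

lemma iso_pc_group_if_pc_sat:
  assumes G: "group G" and sat: "pc_sat ps cs G f" and order: "(\<Prod>x\<in>X. gen_ord x) \<le> order G"
  shows "pc_group ps cs \<cong> G" "order G = (\<Prod>x\<in>X. gen_ord x)" "order (pc_group ps cs) = (\<Prod>x\<in>X. gen_ord x)"
proof -
  interpret P: pc_sat_group ps cs c w "pc_group ps cs" "pc_gen ps cs" by (rule pc_sat_group_pc_group)
  interpret G: pc_sat_group ps cs c w G f
    using G sat by (simp add: pc_sat_group_def pc_data_axioms pc_sat_group_axioms_def)
  obtain h where h: "h \<in> hom (pc_group ps cs) G" "h ` carrier (pc_group ps cs) = carrier G"
    using G.pc_sat_hom[OF sat letters_ok] by metis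
  have le: "card (carrier G) \<le> card (carrier (pc_group ps cs))"
    using card_image_le[OF P.finite_carrier, of h] h by simp
  then have eq: "card (carrier G) = card (carrier (pc_group ps cs))"
      "card (carrier G) = (\<Prod>x\<in>X. gen_ord x)"
    using P.card_carrier_le G.card_carrier_le order by (auto simp: order_def)
  then have "inj_on h (carrier (pc_group ps cs))"
    using h P.finite_carrier by (intro eq_card_imp_inj_on) auto
  then show "pc_group ps cs \<cong> G"
    using h by (auto simp: is_iso_def iso_def bij_betw_def)
  show "order G = (\<Prod>x\<in>X. gen_ord x)" "order (pc_group ps cs) = (\<Prod>x\<in>X. gen_ord x)"
    using eq by (simp_all add: order_def)
qed

end

section \<open>A model of an admissible presentation\<close>

text \<open>A list instead of a set, so that the invariants can be evaluated by filtering.\<close>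

fun exponent_vectors :: "('g \<times> nat) list \<Rightarrow> ('g \<Rightarrow> int) list" where
  "exponent_vectors [] = [\<lambda>_. 0]"
| "exponent_vectors ((x, k) # ps) =
    concat (map (\<lambda>e. map (\<lambda>v. e(x := v)) [0..int k - 1]) (exponent_vectors ps))"

lemma exponent_vectors_outside:
  "e \<in> set (exponent_vectors ps) \<Longrightarrow> y \<notin> fst ` set ps \<Longrightarrow> e y = 0"
  by (induction ps arbitrary: e rule: exponent_vectors.induct) auto

lemma length_exponent_vectors: "length (exponent_vectors ps) = prod_list (map snd ps)"
  by (induction ps rule: exponent_vectors.induct)
    (auto simp: length_concat sum_list_triv o_def)

lemma set_exponent_vectors:
  "distinct (map fst ps) \<Longrightarrow> set (exponent_vectors ps) =
    {e. (\<forall>(x, k)\<in>set ps. 0 \<le> e x \<and> e x < int k) \<and> (\<forall>y. y \<notin> fst ` set ps \<longrightarrow> e y = 0)}"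
proof (induction ps rule: exponent_vectors.induct)
  case 1
  show ?case by auto
next
  case (2 x k ps)
  have d: "distinct (map fst ps)" "x \<notin> fst ` set ps" using 2 by auto
  show ?case (is "?L = ?R")
  proof
    show "?L \<subseteq> ?R"
    proof
      fix e assume "e \<in> ?L"
      then obtain e' v where e: "e = e'(x := v)" "e' \<in> set (exponent_vectors ps)" "0 \<le> v" "v \<le> int k - 1"
        by auto
      then have e': "\<forall>(y, k)\<in>set ps. 0 \<le> e' y \<and> e' y < int k" "\<forall>y. y \<notin> fst ` set ps \<longrightarrow> e' y = 0"
        using 2(1)[OF d(1)] by auto
      have "0 \<le> e y \<and> e y < int k'" if "(y, k') \<in> set ps" for y k'
      proof -
        have "y \<noteq> x" using that d by force
        then show ?thesis using that e'(1) e(1) by auto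
      qed
      then show "e \<in> ?R" using e e' by auto
    qed
    show "?R \<subseteq> ?L"
    proof
      fix e assume e: "e \<in> ?R"
      have "0 \<le> (e(x := 0)) y \<and> (e(x := 0)) y < int k'" if "(y, k') \<in> set ps" for y k'
      proof -
        have "y \<noteq> x" using that d by force
        then show ?thesis using that e by auto
      qed
      then have "e(x := 0) \<in> set (exponent_vectors ps)" using 2(1)[OF d(1)] e by auto
      moreover have "e = (e(x := 0))(x := e x)" "0 \<le> e x" "e x \<le> int k - 1" using e by auto
      ultimately show "e \<in> ?L" by (auto intro!: bexI[of _ "e(x := 0)"] image_eqI[of _ _ "e x"])
    qed
  qed
qed

lemma card_set_exponent_vectors:
  assumes "distinct (map fst ps)"
  shows "card (set (exponent_vectors ps)) = prod_list (map snd ps)"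
  using assms
proof (induction ps rule: exponent_vectors.induct)
  case (2 x k ps)
  have d: "distinct (map fst ps)" "x \<notin> fst ` set ps" using 2 by auto
  have "set (exponent_vectors ((x, k) # ps)) =
      (\<lambda>(e, v). e(x := v)) ` (set (exponent_vectors ps) \<times> {0..int k - 1})" by force
  moreover have "inj_on (\<lambda>(e, v). e(x := v)) (set (exponent_vectors ps) \<times> {0..int k - 1})"
  proof (rule inj_onI, clarsimp)
    fix e v e' v'
    assume *: "e \<in> set (exponent_vectors ps)" "e' \<in> set (exponent_vectors ps)"
      and eq: "e(x := v) = e'(x := v')"
    have "e y = e' y" for y
      using fun_cong[OF eq, of y] exponent_vectors_outside[OF *(1) d(2)] exponent_vectors_outside[OF *(2) d(2)]
      by (auto split: if_splits)
    then show "e = e' \<and> v = v'" using fun_cong[OF eq, of x] by auto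
  qed
  ultimately show ?case using 2(1)[OF d(1)] by (simp add: card_image card_cartesian_product)
qed simp

lemma distinct_exponent_vectors: "distinct (map fst ps) \<Longrightarrow> distinct (exponent_vectors ps)"
  by (simp add: card_distinct card_set_exponent_vectors length_exponent_vectors)

text \<open>A bilinear cocycle, not an alternating form; its antisymmetrization describes the
  commutators. A pair \<open>(x, y)\<close> of \<open>cs\<close> contributes when \<open>x\<close>
  stands to the left of \<open>y\<close>, so collected words have \<open>y\<close> before
  \<open>x\<close>.\<close>

definition pc_form :: "(('g \<times> 'g) \<times> ('g \<times> nat)) list \<Rightarrow> ('g \<Rightarrow> int) \<Rightarrow> ('g \<Rightarrow> int) \<Rightarrow> int" where
  "pc_form cs e f = (\<Sum>((x, y), _)\<leftarrow>cs. e x * f y)"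

definition single :: "'g \<Rightarrow> int \<Rightarrow> 'g \<Rightarrow> int" where
  "single x t = (\<lambda>y. if y = x then t else 0)"

lemma single_simps [simp]:
  "single x t x = t" "y \<noteq> x \<Longrightarrow> single x t y = 0" "single x 0 = (\<lambda>_. 0)"
  by (auto simp: single_def)

text \<open>\<open>collect e f\<close> is the exponent vector of the collected form of the product of the words with
  exponent vectors \<open>e\<close> and \<open>f\<close>: moving generators past each other produces the central factor
  \<open>c\<^bsup>w \<cdot> pc_form e f\<^esup>\<close>.\<close>

context pc_data
begin

definition collect where
  "collect e f = (\<lambda>x. e x + f x + single c (int w * pc_form cs e f) x)"

definition red :: "('g \<Rightarrow> int) \<Rightarrow> 'g \<Rightarrow> int" where
  "red e = (\<lambda>x. if x \<in> X then e x mod int (gen_ord x) else 0)"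

definition model :: "('g \<Rightarrow> int) monoid" where
  "model = \<lparr>carrier = set (exponent_vectors ps), monoid.mult = \<lambda>e f. red (collect e f), one = \<lambda>_. 0\<rparr>"

lemma pc_form_eq_sum: "pc_form cs e f = (\<Sum>(x, y)\<in>S. e x * f y)"
proof -
  have d: "distinct (map fst cs)" using ok by (simp add: pc_ok_def)
  have "pc_form cs e f = sum_list (map (\<lambda>(x, y). e x * f y) (map fst cs))"
    by (simp add: pc_form_def o_def case_prod_unfold)
  also have "\<dots> = (\<Sum>(x, y)\<in>set (map fst cs). e x * f y)"
    using d by (rule sum_list_distinct_conv_sum_set)
  finally show ?thesis by (simp add: S_def)
qed

lemma finite_S: "finite S" by (simp add: S_def)

lemma pc_form_add:
  "pc_form cs (\<lambda>x. e x + e' x) f = pc_form cs e f + pc_form cs e' f"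
  "pc_form cs e (\<lambda>x. f x + f' x) = pc_form cs e f + pc_form cs e f'"
  by (simp_all add: pc_form_eq_sum algebra_simps sum.distrib case_prod_unfold)

lemma pc_form_scale:
  "pc_form cs (\<lambda>x. t * e x) f = t * pc_form cs e f"
  "pc_form cs e (\<lambda>x. t * f x) = t * pc_form cs e f"
  by (simp_all add: pc_form_eq_sum algebra_simps sum_distrib_left case_prod_unfold)

lemma pc_form_zero: "pc_form cs (\<lambda>_. 0) f = 0" "pc_form cs e (\<lambda>_. 0) = 0"
  by (simp_all add: pc_form_eq_sum)

lemma pc_form_minus:
  "pc_form cs (\<lambda>x. - e x) f = - pc_form cs e f"
  "pc_form cs e (\<lambda>x. - f x) = - pc_form cs e f"
  using pc_form_scale(1)[of "-1" e f] pc_form_scale(2)[of e "-1" f] by simp_all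

lemma pc_form_single_single:
  "pc_form cs (single x s) (single y t) = (if (x, y) \<in> S then s * t else 0)"
proof -
  have "pc_form cs (single x s) (single y t) = (\<Sum>p\<in>S. if p = (x, y) then s * t else 0)"
    unfolding pc_form_eq_sum by (rule sum.cong) (auto simp: single_def split: if_splits)
  then show ?thesis using finite_S by simp
qed

lemma single_scale: "single x (t * s) = (\<lambda>y. t * single x s y)" by (auto simp: single_def)

text \<open>Changing \<open>e x\<close> by a multiple of \<open>gen_ord x\<close> changes the sum by
  a multiple of \<open>w * gen_ord x\<close>, which \<open>gen_ord c\<close> divides. Multiplication
  is thereby well defined on reduced vectors.\<close>

lemma w_pc_form_cong:
  assumes "\<And>x. x \<in> X \<Longrightarrow> [e x = e' x] (mod int (gen_ord x))"
    and "\<And>x. x \<in> X \<Longrightarrow> [f x = f' x] (mod int (gen_ord x))"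
  shows "[int w * pc_form cs e f = int w * pc_form cs e' f'] (mod int (gen_ord c))"
proof -
  have "[int w * (e x * f y) = int w * (e' x * f' y)] (mod int (gen_ord c))" if xy: "(x, y) \<in> S" for x y
  proof -
    obtain s t where s: "e x = e' x + int (gen_ord x) * s" and t: "f y = f' y + int (gen_ord y) * t"
      using cong_sym[OF assms(1)[OF S_D(1)[OF xy]]] cong_sym[OF assms(2)[OF S_D(2)[OF xy]]]
      unfolding cong_iff_lin by blast
    have "int w * (e x * f y) - int w * (e' x * f' y)
        = int (w * gen_ord x) * (s * f y) + int (w * gen_ord y) * (t * e' x)"
      by (simp add: s t algebra_simps)
    moreover have "int (gen_ord c) dvd int (w * gen_ord x) * (s * f y) + int (w * gen_ord y) * (t * e' x)"
      using S_D(5,6)[OF xy] by (intro dvd_add dvd_mult2) (simp_all only: of_nat_dvd_iff)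
    ultimately show ?thesis by (simp add: cong_iff_dvd_diff)
  qed
  then show ?thesis
    unfolding pc_form_eq_sum sum_distrib_left by (intro cong_sum) auto
qed

text \<open>The centrality of \<open>c^w\<close> inside the model: bilinearity produces a second
  factor \<open>w\<close>, and \<open>gen_ord c\<close> divides \<open>w * w\<close>.\<close>

lemma w_pc_form_single:
  assumes "int w dvd t"
  shows "[int w * pc_form cs (single c t) f = 0] (mod int (gen_ord c))"
    "[int w * pc_form cs f (single c t) = 0] (mod int (gen_ord c))"
proof -
  obtain s where t: "t = int w * s" using assms by blast
  have "int (gen_ord c) dvd int w * int w"
    using ord_dvd_w2 unfolding of_nat_mult[symmetric] of_nat_dvd_iff .
  then have *: "int (gen_ord c) dvd int w * (t * r)" for r
    unfolding t by (metis dvd_mult2 mult.assoc)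
  have "single c t = (\<lambda>y. t * single c 1 y)" using single_scale[of c t 1] by simp
  then have "pc_form cs (single c t) f = t * pc_form cs (single c 1) f"
    "pc_form cs f (single c t) = t * pc_form cs f (single c 1)"
    by (simp_all only: pc_form_scale)
  then show "[int w * pc_form cs (single c t) f = 0] (mod int (gen_ord c))"
    "[int w * pc_form cs f (single c t) = 0] (mod int (gen_ord c))"
    using * by (simp_all add: cong_0_iff)
qed

lemma red_eq_iff: "red e = red f \<longleftrightarrow> (\<forall>x\<in>X. [e x = f x] (mod int (gen_ord x)))"
  unfolding red_def fun_eq_iff cong_def by auto

lemma red_eqI:
  assumes "\<And>x. x \<in> X \<Longrightarrow> x \<noteq> c \<Longrightarrow> e x = f x" "[e c = f c] (mod int (gen_ord c))"
  shows "red e = red f"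
  unfolding red_eq_iff using assms by (metis cong_refl)

lemma red_cong: "x \<in> X \<Longrightarrow> [red e x = e x] (mod int (gen_ord x))"
  by (simp add: red_def cong_def)

lemma set_vectors:
  "set (exponent_vectors ps) = {e. (\<forall>x\<in>X. 0 \<le> e x \<and> e x < int (gen_ord x)) \<and> (\<forall>x. x \<notin> X \<longrightarrow> e x = 0)}"
proof -
  have d: "distinct (map fst ps)" using ok by (simp add: pc_ok_def)
  show ?thesis
    unfolding set_exponent_vectors[OF d] X_def[symmetric] Ball_def split_paired_All case_prod_conv set_ps
    by blast
qed

lemma red_in_vectors: "red e \<in> set (exponent_vectors ps)"
  using ord_pos by (auto simp: set_vectors red_def)

lemma red_vectors: "e \<in> set (exponent_vectors ps) \<Longrightarrow> red e = e"
  by (auto simp: set_vectors red_def fun_eq_iff)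

lemma vectorsE:
  assumes "e \<in> set (exponent_vectors ps)"
  obtains e' where "e = red e'"
  using red_vectors[OF assms] by metis

lemma red_collect_red: "red (collect (red e) (red f)) = red (collect e f)"
proof -
  have "[int w * pc_form cs (red e) (red f) = int w * pc_form cs e f] (mod int (gen_ord c))"
    by (intro w_pc_form_cong red_cong)
  then show ?thesis
    unfolding red_eq_iff collect_def single_def
    by (auto intro!: cong_add red_cong)
qed

lemma mult_model: "red e \<otimes>\<^bsub>model\<^esub> red f = red (collect e f)"
  by (simp add: model_def red_collect_red)

lemma one_model: "\<one>\<^bsub>model\<^esub> = red (\<lambda>_. 0)"
  by (auto simp: model_def red_def fun_eq_iff)

lemma carrier_model: "carrier model = set (exponent_vectors ps)"
  by (simp add: model_def)

text \<open>A central factor \<open>c^t\<close> may be pulled out of either argument. Associativity,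
  inverses, powers and commutators in the model are all computed by this rule.\<close>

lemma collect_shift:
  assumes "int w dvd t"
  shows "red (collect (\<lambda>x. e x + single c t x) f) = red (\<lambda>x. collect e f x + single c t x)"
    "red (collect f (\<lambda>x. e x + single c t x)) = red (\<lambda>x. collect f e x + single c t x)"
proof -
  have "[(e c + t) + f c + (int w * pc_form cs e f + int w * pc_form cs (single c t) f) =
      (e c + t) + f c + (int w * pc_form cs e f + 0)] (mod int (gen_ord c))"
    by (intro cong_add cong_refl w_pc_form_single assms)
  moreover have "collect (\<lambda>x. e x + single c t x) f c =
      (e c + t) + f c + (int w * pc_form cs e f + int w * pc_form cs (single c t) f)"
    by (simp add: collect_def pc_form_add distrib_left)
  moreover have "collect e f c + single c t c = (e c + t) + f c + (int w * pc_form cs e f + 0)"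
    by (simp add: collect_def)
  ultimately show "red (collect (\<lambda>x. e x + single c t x) f) = red (\<lambda>x. collect e f x + single c t x)"
    by (intro red_eqI) (simp_all only:, simp add: collect_def)
  have "[f c + (e c + t) + (int w * pc_form cs f e + int w * pc_form cs f (single c t)) =
      f c + (e c + t) + (int w * pc_form cs f e + 0)] (mod int (gen_ord c))"
    by (intro cong_add cong_refl w_pc_form_single assms)
  moreover have "collect f (\<lambda>x. e x + single c t x) c =
      f c + (e c + t) + (int w * pc_form cs f e + int w * pc_form cs f (single c t))"
    by (simp add: collect_def pc_form_add distrib_left)
  moreover have "collect f e c + single c t c = f c + (e c + t) + (int w * pc_form cs f e + 0)"
    by (simp add: collect_def)
  ultimately show "red (collect f (\<lambda>x. e x + single c t x)) = red (\<lambda>x. collect f e x + single c t x)"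
    by (intro red_eqI) (simp_all only:, simp add: collect_def)
qed

text \<open>Once the central factors are pulled out, both sides carry the sum of the form over the
  pairs \<open>(e, f)\<close>, \<open>(e, g)\<close> and \<open>(f, g)\<close>.\<close>

lemma collect_assoc: "red (collect (collect e f) g) = red (collect e (collect f g))"
proof -
  have 1: "collect e f = (\<lambda>x. (e x + f x) + single c (int w * pc_form cs e f) x)" for e f
    by (simp add: collect_def)
  have "red (collect (collect e f) g)
      = red (\<lambda>x. collect (\<lambda>x. e x + f x) g x + single c (int w * pc_form cs e f) x)"
    unfolding 1[of e f] by (rule collect_shift) simp
  also have "(\<lambda>x. collect (\<lambda>x. e x + f x) g x + single c (int w * pc_form cs e f) x)
      = (\<lambda>x. collect e (\<lambda>x. f x + g x) x + single c (int w * pc_form cs f g) x)"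
    by (auto simp: collect_def single_def pc_form_add algebra_simps)
  also have "red \<dots> = red (collect e (collect f g))"
    unfolding 1[of f g] by (rule collect_shift[symmetric]) simp
  finally show ?thesis .
qed

lemma group_model: "group model"
proof (rule groupI)
  fix e f assume "e \<in> carrier model" "f \<in> carrier model"
  then show "e \<otimes>\<^bsub>model\<^esub> f \<in> carrier model"
    by (simp add: model_def red_in_vectors)
next
  show "\<one>\<^bsub>model\<^esub> \<in> carrier model" by (simp add: one_model carrier_model red_in_vectors)
next
  fix e f g assume "e \<in> carrier model" "f \<in> carrier model" "g \<in> carrier model"
  then show "e \<otimes>\<^bsub>model\<^esub> f \<otimes>\<^bsub>model\<^esub> g = e \<otimes>\<^bsub>model\<^esub> (f \<otimes>\<^bsub>model\<^esub> g)"
    unfolding carrier_model by (auto elim!: vectorsE simp: mult_model collect_assoc)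
next
  fix e assume e: "e \<in> carrier model"
  have 0: "collect (\<lambda>_. 0) e = e" for e
    by (simp add: collect_def pc_form_zero)
  show "\<one>\<^bsub>model\<^esub> \<otimes>\<^bsub>model\<^esub> e = e"
    using e unfolding carrier_model by (auto elim!: vectorsE simp: one_model mult_model 0)
  \<comment> \<open>The negated vector alone leaves the central exponent
    \<open>- w * pc_form cs e e\<close>; the correction at \<open>c\<close> cancels it.\<close>
  let ?f = "\<lambda>x. - e x + single c (int w * pc_form cs e e) x"
  have "red (collect ?f e) = red (\<lambda>x. collect (\<lambda>x. - e x) e x + single c (int w * pc_form cs e e) x)"
    by (rule collect_shift) simp
  also have "(\<lambda>x. collect (\<lambda>x. - e x) e x + single c (int w * pc_form cs e e) x) = (\<lambda>_. 0)"
    by (auto simp: collect_def single_def pc_form_minus)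
  finally have "red ?f \<otimes>\<^bsub>model\<^esub> red e = \<one>\<^bsub>model\<^esub>" by (simp add: mult_model one_model)
  then show "\<exists>f\<in>carrier model. f \<otimes>\<^bsub>model\<^esub> e = \<one>\<^bsub>model\<^esub>"
    using e red_in_vectors by (auto simp: carrier_model red_vectors)
qed

lemma order_model: "order model = (\<Prod>x\<in>X. gen_ord x)"
proof -
  have "distinct (map fst ps)" using ok by (simp add: pc_ok_def)
  then show ?thesis by (simp add: order_def carrier_model card_set_exponent_vectors prod_ord)
qed

text \<open>The successive multiplications by \<open>e\<close> contribute
  \<open>i * pc_form cs e e\<close> for \<open>i < n\<close>, and these multiples add up to the
  binomial coefficient.\<close>

lemma nat_pow_model:
  "red e [^]\<^bsub>model\<^esub> (n::nat) =
    red (\<lambda>x. int n * e x + single c (int w * (int (n choose 2) * pc_form cs e e)) x)"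
proof (induction n)
  case 0
  interpret group model by (rule group_model)
  show ?case by (simp add: one_model numeral_2_eq_2)
next
  case (Suc n)
  interpret group model by (rule group_model)
  have "red e [^]\<^bsub>model\<^esub> Suc n = red (collect
      (\<lambda>x. int n * e x + single c (int w * (int (n choose 2) * pc_form cs e e)) x) e)"
    by (simp add: Suc mult_model)
  also have "\<dots> = red (\<lambda>x. collect (\<lambda>x. int n * e x) e x +
      single c (int w * (int (n choose 2) * pc_form cs e e)) x)"
    by (rule collect_shift) simp
  also have "(\<lambda>x. collect (\<lambda>x. int n * e x) e x + single c (int w * (int (n choose 2) * pc_form cs e e)) x)
      = (\<lambda>x. int (Suc n) * e x + single c (int w * (int (Suc n choose 2) * pc_form cs e e)) x)"
    by (auto simp: collect_def single_def pc_form_scale algebra_simps numeral_2_eq_2)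
  finally show ?case .
qed

lemma nat_pow_model_single:
  assumes "x \<in> X"
  shows "red (single x 1) [^]\<^bsub>model\<^esub> (n::nat) = red (single x (int n))"
proof -
  have "pc_form cs (single x 1) (single x 1) = 0"
    using S_D(3)[of x x] by (auto simp: pc_form_single_single)
  then show ?thesis using single_scale[of x "int n" 1] by (simp add: nat_pow_model)
qed

lemma red_single_in_generate:
  assumes "0 \<le> t" "x \<in> X"
  shows "red (single x t) \<in> generate model ((\<lambda>x. red (single x 1)) ` X)"
proof -
  interpret group model by (rule group_model)
  have sub: "subgroup (generate model ((\<lambda>x. red (single x 1)) ` X)) model"
    by (intro generate_is_subgroup) (auto simp: carrier_model red_in_vectors)
  obtain n where t: "t = int n" using assms(1) by (rule nonneg_int_cases)
  have "red (single x 1) [^]\<^bsub>model\<^esub> int n \<in> generate model ((\<lambda>x. red (single x 1)) ` X)"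
    by (intro subgroup_int_pow_closed[OF sub] generate.incl imageI assms)
  then show ?thesis using assms by (simp add: int_pow_int nat_pow_model_single t)
qed

lemma generate_model: "generate model ((\<lambda>x. red (single x 1)) ` X) = carrier model"
proof
  interpret group model by (rule group_model)
  let ?H = "generate model ((\<lambda>x. red (single x 1)) ` X)"
  show "?H \<subseteq> carrier model"
    by (intro generate_incl) (auto simp: carrier_model red_in_vectors)
  have "red e \<in> ?H" if "\<And>x. x \<in> X \<Longrightarrow> 0 \<le> e x" for e
    using that
  \<comment> \<open>The exponent of \<open>c\<close> is left out of the measure, since splitting off
    another generator may shift it by a multiple of \<open>w\<close>.\<close>
  proof (induction "\<Sum>x\<in>X - {c}. nat (e x)" arbitrary: e rule: less_induct)
    case less
    show ?case
    proof (cases "\<exists>x\<in>X - {c}. e x \<noteq> 0")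
      case False
      then have "red e = red (single c (e c))" by (auto simp: red_eq_iff single_def)
      then show ?thesis using red_single_in_generate[OF less(2)[OF c_X] c_X] by simp
    next
      case True
      then obtain x where x: "x \<in> X" "x \<noteq> c" "e x \<noteq> 0" by blast
      then have pos: "e x > 0" using less(2)[OF x(1)] by simp
      define f where "f = e(x := e x - 1)"
      define k where "k = pc_form cs f (single x 1)"
      \<comment> \<open>The exponent \<open>- w * k\<close> would cancel the central factor; the
        remainder modulo \<open>gen_ord c\<close> replaces \<open>- k\<close> by a nonnegative
        number, as \<open>red_single_in_generate\<close> requires.\<close>
      define t where "t = int w * ((- k) mod int (gen_ord c))"
      have "(\<Sum>y\<in>X - {c}. nat (f y)) < (\<Sum>y\<in>X - {c}. nat (e y))"
        using x pos finite_X by (intro sum_strict_mono_ex1) (auto simp: f_def)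
      then have f: "red f \<in> ?H" by (rule less(1)) (use less(2) pos in \<open>auto simp: f_def\<close>)
      have t0: "0 \<le> t" using ord_pos[OF c_X] by (simp add: t_def)
      have "red f \<otimes>\<^bsub>model\<^esub> red (single x 1) \<otimes>\<^bsub>model\<^esub> red (single c t) \<in> ?H"
        by (intro generate.eng f red_single_in_generate t0 x c_X) simp
      also have "red f \<otimes>\<^bsub>model\<^esub> red (single x 1) \<otimes>\<^bsub>model\<^esub> red (single c t)
          = red (collect (collect f (single x 1)) (\<lambda>x. 0 + single c t x))"
        by (simp add: mult_model)
      also have "\<dots> = red (\<lambda>y. collect (collect f (single x 1)) (\<lambda>_. 0) y + single c t y)"
        by (rule collect_shift) (simp add: t_def)
      also have "(\<lambda>y. collect (collect f (single x 1)) (\<lambda>_. 0) y + single c t y) =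
          (\<lambda>y. e y + single c (int w * k + t) y)"
      proof
        have "collect f (single x 1) y = f y + single x 1 y + single c (int w * k) y" for y
          by (simp add: collect_def k_def)
        moreover have "collect e' (\<lambda>_. 0) y = e' y" for e' y
          by (simp add: collect_def pc_form_zero)
        ultimately show "collect (collect f (single x 1)) (\<lambda>_. 0) y + single c t y =
            e y + single c (int w * k + t) y" for y
          by (simp add: single_def f_def)
      qed
      also have "red \<dots> = red e"
      proof (rule red_eqI)
        have "[- k mod int (gen_ord c) = - k] (mod int (gen_ord c))" by (simp add: cong_def)
        then have "[e c + (int w * k + t) = e c + (int w * k + int w * (- k))] (mod int (gen_ord c))"
          unfolding t_def by (intro cong_add cong_refl cong_mult)
        then show "[e c + single c (int w * k + t) c = e c] (mod int (gen_ord c))" by (simp add: single_def)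
      qed (simp add: single_def)
      finally show ?thesis .
    qed
  qed
  then have "e \<in> ?H" if "e \<in> carrier model" for e
    using that red_vectors[of e] unfolding carrier_model set_vectors by (metis (mono_tags, lifting) mem_Collect_eq)
  then show "carrier model \<subseteq> ?H" by blast
qed

text \<open>The two products agree in every coordinate except \<open>c\<close>, where they differ by
  \<open>w\<close> times the antisymmetrized form.\<close>

lemma model_commute_iff:
  "red e \<otimes>\<^bsub>model\<^esub> red f = red f \<otimes>\<^bsub>model\<^esub> red e \<longleftrightarrow>
    int (gen_ord c) dvd int w * (pc_form cs e f - pc_form cs f e)"
proof -
  have "red e \<otimes>\<^bsub>model\<^esub> red f = red f \<otimes>\<^bsub>model\<^esub> red e \<longleftrightarrow>
      [collect e f c = collect f e c] (mod int (gen_ord c))"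
    unfolding mult_model red_eq_iff using c_X by (auto simp: collect_def single_def algebra_simps)
  also have "\<dots> \<longleftrightarrow> int (gen_ord c) dvd int w * (pc_form cs e f - pc_form cs f e)"
    by (simp add: cong_iff_dvd_diff collect_def single_def algebra_simps)
  finally show ?thesis .
qed

lemma pc_sat_model: "pc_sat ps cs model (\<lambda>x. red (single x 1))"
  unfolding pc_sat_alt
proof (intro conjI ballI impI)
  interpret group model by (rule group_model)
  let ?u = "\<lambda>x. red (single x 1)"
  show u: "?u \<in> X \<rightarrow> carrier model" by (simp add: carrier_model red_in_vectors)
  show "generate model (?u ` X) = carrier model" by (rule generate_model)
  show "?u x [^]\<^bsub>model\<^esub> gen_ord x = \<one>\<^bsub>model\<^esub>" if "x \<in> X" for x
    using that by (simp add: nat_pow_model_single one_model red_eq_iff) (auto simp: single_def cong_0_iff)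
  show "case p of (x, y) \<Rightarrow> grp_comm model (?u x) (?u y) = ?u c [^]\<^bsub>model\<^esub> w" if "p \<in> S" for p
  proof -
    obtain x y where p: "p = (x, y)" by force
    have xy: "(x, y) \<in> S" "(y, x) \<notin> S" using that p S_D(4) by auto
    \<comment> \<open>The form takes the value 1 on \<open>(x, y)\<close> and 0 on
      \<open>(y, x)\<close>, because only the first pair lies in \<open>S\<close>. Hence the product
      of \<open>x\<close> and \<open>y\<close> is that of \<open>y\<close> and \<open>x\<close>
      times \<open>c^w\<close>.\<close>
    have "red (collect (collect (single y 1) (single x 1)) (\<lambda>x. 0 + single c (int w) x)) =
        red (\<lambda>z. collect (collect (single y 1) (single x 1)) (\<lambda>_. 0) z + single c (int w) z)"
      by (rule collect_shift) simp
    also have "(\<lambda>z. collect (collect (single y 1) (single x 1)) (\<lambda>_. 0) z + single c (int w) z) =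
        collect (single x 1) (single y 1)"
    proof
      have "collect (single y 1) (single x 1) z = single y 1 z + single x 1 z"
        "collect (single x 1) (single y 1) z = single x 1 z + single y 1 z + single c (int w) z" for z
        using xy by (simp_all add: collect_def pc_form_single_single)
      moreover have "collect e' (\<lambda>_. 0) z = e' z" for e' z
        by (simp add: collect_def pc_form_zero)
      ultimately show "collect (collect (single y 1) (single x 1)) (\<lambda>_. 0) z + single c (int w) z =
          collect (single x 1) (single y 1) z" for z
        by simp
    qed
    finally have "?u x \<otimes>\<^bsub>model\<^esub> ?u y = ?u y \<otimes>\<^bsub>model\<^esub> ?u x \<otimes>\<^bsub>model\<^esub> red (single c (int w))"
      by (simp add: mult_model)
    then show ?thesis
      using u S_D(1,2)[OF xy(1)] c_X by (simp add: p nat_pow_model_single) (intro grp_comm_eqI, auto simp: carrier_model red_in_vectors)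
  qed
  show "grp_comm model (?u x) (?u y) = \<one>\<^bsub>model\<^esub>"
    if "x \<in> X" "y \<in> X" "(x, y) \<notin> S" "(y, x) \<notin> S" for x y
    using that model_commute_iff[of "single x 1" "single y 1"]
      grp_comm_eq_one_iff[of "?u x" "?u y"] red_in_vectors
    by (simp add: pc_form_single_single carrier_model)
qed

theorem pc_group_iso_model: "pc_group ps cs \<cong> model"
  and order_pc_group: "order (pc_group ps cs) = prod_list (map snd ps)"
  using iso_pc_group_if_pc_sat[OF group_model pc_sat_model] order_model prod_ord by auto

end

section \<open>Isomorphism invariants\<close>

definition root_count :: "('a, 'b) monoid_scheme \<Rightarrow> nat \<Rightarrow> nat" where
  "root_count G n = card {x \<in> carrier G. x [^]\<^bsub>G\<^esub> n = \<one>\<^bsub>G\<^esub>}"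

definition central_root_count :: "('a, 'b) monoid_scheme \<Rightarrow> nat \<Rightarrow> nat" where
  "central_root_count G n = card {x \<in> carrier G. x [^]\<^bsub>G\<^esub> n = \<one>\<^bsub>G\<^esub> \<and>
     (\<forall>y\<in>carrier G. x \<otimes>\<^bsub>G\<^esub> y = y \<otimes>\<^bsub>G\<^esub> x)}"

text \<open>The exponent \<open>0\<close> in the second list makes its first entry the order of the centre.\<close>

definition grp_inv :: "('a, 'b) monoid_scheme \<Rightarrow> nat list \<times> nat list" where
  "grp_inv G = (map (root_count G) [2, 4, 8], map (central_root_count G) [0, 2, 4])"

lemma grp_inv_iso:
  assumes G: "group G" "group H" and iso: "G \<cong> H"
  shows "grp_inv G = grp_inv H"
proof -
  obtain h where h: "h \<in> hom G H" "bij_betw h (carrier G) (carrier H)"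
    using iso by (auto simp: is_iso_def iso_def)
  interpret h: group_hom G H h using G h by (simp add: group_hom_def group_hom_axioms_def)
  have inj: "h x = h y \<longleftrightarrow> x = y" if "x \<in> carrier G" "y \<in> carrier G" for x y
    using h(2) that by (meson bij_betw_imp_inj_on inj_on_eq_iff)
  have im: "h ` carrier G = carrier H" using h(2) by (simp add: bij_betw_def)
  have pow: "h x [^]\<^bsub>H\<^esub> n = \<one>\<^bsub>H\<^esub> \<longleftrightarrow> x [^]\<^bsub>G\<^esub> n = \<one>\<^bsub>G\<^esub>" if "x \<in> carrier G" for x and n :: nat
    using inj[of "x [^]\<^bsub>G\<^esub> n" "\<one>\<^bsub>G\<^esub>"] that by (simp add: h.hom_nat_pow)
  have cen: "h x \<otimes>\<^bsub>H\<^esub> h y = h y \<otimes>\<^bsub>H\<^esub> h x \<longleftrightarrow> x \<otimes>\<^bsub>G\<^esub> y = y \<otimes>\<^bsub>G\<^esub> x"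
    if "x \<in> carrier G" "y \<in> carrier G" for x y
    using inj[of "x \<otimes>\<^bsub>G\<^esub> y" "y \<otimes>\<^bsub>G\<^esub> x"] that by simp
  have card: "card {x \<in> carrier G. P (h x)} = card {x \<in> carrier H. P x}" for P
  proof -
    have "{x \<in> carrier H. P x} = h ` {x \<in> carrier G. P (h x)}" using im by auto
    moreover have "inj_on h {x \<in> carrier G. P (h x)}" by (rule inj_onI) (simp add: inj)
    ultimately show ?thesis by (simp add: card_image)
  qed
  have r: "root_count G n = root_count H n" for n
    using card[of "\<lambda>x. x [^]\<^bsub>H\<^esub> n = \<one>\<^bsub>H\<^esub>"] by (simp add: root_count_def pow cong: conj_cong)
  have "(\<forall>y\<in>carrier H. h x \<otimes>\<^bsub>H\<^esub> y = y \<otimes>\<^bsub>H\<^esub> h x) \<longleftrightarrow> (\<forall>y\<in>carrier G. x \<otimes>\<^bsub>G\<^esub> y = y \<otimes>\<^bsub>G\<^esub> x)"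
    if "x \<in> carrier G" for x
    unfolding im[symmetric] using cen[OF that] by auto
  then have c: "central_root_count G n = central_root_count H n" for n
    using card[of "\<lambda>x. x [^]\<^bsub>H\<^esub> n = \<one>\<^bsub>H\<^esub> \<and> (\<forall>y\<in>carrier H. x \<otimes>\<^bsub>H\<^esub> y = y \<otimes>\<^bsub>H\<^esub> x)"]
    by (simp add: central_root_count_def pow cong: conj_cong)
  show ?thesis by (simp add: grp_inv_def r c)
qed

text \<open>The condition \<open>e^n = 1\<close> in the model, with the binomial coefficient of
  \<open>nat_pow_model\<close> written as \<open>n (n - 1) / 2\<close> so that integer arithmetic
  evaluates it.\<close>

definition vector_root :: "('g \<times> nat) list \<Rightarrow> (('g \<times> 'g) \<times> ('g \<times> nat)) list \<Rightarrow> 'g \<Rightarrow> nat \<Rightarrow>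
    nat \<Rightarrow> ('g \<Rightarrow> int) \<Rightarrow> bool" where
  "vector_root ps cs c w n e \<longleftrightarrow> list_all (\<lambda>(y, k).
     (int n * e y + (if y = c then int w * ((int n * (int n - 1) div 2) * pc_form cs e e) else 0)) mod int k = 0) ps"

text \<open>An element is central once it commutes with the generators, so a test over
  \<open>ps\<close> is enough.\<close>

definition vector_central :: "('g \<times> nat) list \<Rightarrow> (('g \<times> 'g) \<times> ('g \<times> nat)) list \<Rightarrow> 'g \<Rightarrow> nat \<Rightarrow>
    ('g \<Rightarrow> int) \<Rightarrow> bool" where
  "vector_central ps cs c w e \<longleftrightarrow> list_all (\<lambda>(y, k).
     (int w * (pc_form cs e (single y 1) - pc_form cs (single y 1) e)) mod int (the (map_of ps c)) = 0) ps"

definition pc_inv :: "('g \<times> nat) list \<Rightarrow> (('g \<times> 'g) \<times> ('g \<times> nat)) list \<Rightarrow> 'g \<Rightarrow> nat \<Rightarrow>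
    nat list \<times> nat list" where
  "pc_inv ps cs c w =
    (map (\<lambda>n. length (filter (vector_root ps cs c w n) (exponent_vectors ps))) [2, 4, 8],
     map (\<lambda>n. length (filter (\<lambda>e. vector_root ps cs c w n e \<and> vector_central ps cs c w e)
       (exponent_vectors ps))) [0, 2, 4])"

section \<open>Evaluation of the invariants in the model\<close>

context pc_data
begin

lemma list_all_ps: "list_all (\<lambda>(x, k). P x k) ps \<longleftrightarrow> (\<forall>x\<in>X. P x (gen_ord x))"
  unfolding list_all_iff Ball_def split_paired_All case_prod_conv set_ps by blast

lemma vector_root_iff:
  assumes "e \<in> carrier model"
  shows "e [^]\<^bsub>model\<^esub> n = \<one>\<^bsub>model\<^esub> \<longleftrightarrow> vector_root ps cs c w n e"
proof -
  have n: "int (n choose 2) = int n * (int n - 1) div 2"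
    by (cases n) (simp_all add: choose_two zdiv_int algebra_simps)
  have "e [^]\<^bsub>model\<^esub> n = red (\<lambda>x. int n * e x + single c (int w * (int (n choose 2) * pc_form cs e e)) x)"
    using nat_pow_model[of e n] assms by (simp add: carrier_model red_vectors)
  then show ?thesis
    by (simp add: one_model red_eq_iff vector_root_def list_all_ps n single_def cong_def)
qed

lemma vector_central_iff:
  assumes e: "e \<in> carrier model"
  shows "(\<forall>f\<in>carrier model. e \<otimes>\<^bsub>model\<^esub> f = f \<otimes>\<^bsub>model\<^esub> e) \<longleftrightarrow> vector_central ps cs c w e"
proof -
  interpret group model by (rule group_model)
  have u: "(\<lambda>x. red (single x 1)) ` X \<subseteq> carrier model" by (auto simp: carrier_model red_in_vectors)
  have "(\<forall>f\<in>carrier model. e \<otimes>\<^bsub>model\<^esub> f = f \<otimes>\<^bsub>model\<^esub> e) \<longleftrightarrow>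
      (\<forall>f\<in>(\<lambda>x. red (single x 1)) ` X. e \<otimes>\<^bsub>model\<^esub> f = f \<otimes>\<^bsub>model\<^esub> e)"
    using commutes_with_generate[OF u e] u unfolding generate_model by blast
  also have "\<dots> \<longleftrightarrow> (\<forall>x\<in>X. red e \<otimes>\<^bsub>model\<^esub> red (single x 1) = red (single x 1) \<otimes>\<^bsub>model\<^esub> red e)"
    using e by (simp add: carrier_model red_vectors)
  also have "\<dots> \<longleftrightarrow> vector_central ps cs c w e"
    unfolding model_commute_iff vector_central_def list_all_ps by (simp add: gen_ord_def dvd_eq_mod_eq_0)
  finally show ?thesis .
qed

lemma grp_inv_pc_group: "grp_inv (pc_group ps cs) = pc_inv ps cs c w"
proof -
  have "distinct (map fst ps)" using ok by (simp add: pc_ok_def)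
  then have d: "distinct (exponent_vectors ps)" by (rule distinct_exponent_vectors)
  have card: "card {e \<in> carrier model. P e} = length (filter P (exponent_vectors ps))" for P
    using distinct_length_filter[OF d, of P] by (simp add: carrier_model Int_def conj_commute)
  have "root_count model n = length (filter (vector_root ps cs c w n) (exponent_vectors ps))" for n
    unfolding root_count_def card[symmetric] using vector_root_iff by (metis (mono_tags, lifting))
  moreover have "central_root_count model n = length (filter (\<lambda>e. vector_root ps cs c w n e \<and>
      vector_central ps cs c w e) (exponent_vectors ps))" for n
  proof -
    have "{x \<in> carrier model. x [^]\<^bsub>model\<^esub> n = \<one>\<^bsub>model\<^esub> \<and> (\<forall>y\<in>carrier model. x \<otimes>\<^bsub>model\<^esub> y = y \<otimes>\<^bsub>model\<^esub> x)}
        = {x \<in> carrier model. vector_root ps cs c w n x \<and> vector_central ps cs c w x}"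
      using vector_root_iff vector_central_iff by blast
    then show ?thesis unfolding central_root_count_def card[symmetric] by simp
  qed
  ultimately have "grp_inv model = pc_inv ps cs c w" by (simp add: grp_inv_def pc_inv_def)
  then show ?thesis
    using grp_inv_iso[OF group_pc_group group_model pc_group_iso_model] by simp
qed

end

section \<open>The lists of groups\<close>

text \<open>A presentation together with the parameters \<open>c\<close> and \<open>w\<close> of
  \<open>pc_ok\<close>, from which the invariants are computed.\<close>

type_synonym 'g pc = "('g \<times> nat) list \<times> (('g \<times> 'g) \<times> ('g \<times> nat)) list \<times> 'g \<times> nat"

definition pcs16 :: "gen pc list" where
  "pcs16 = [([(ga, 8), (gb, 2)], [((ga, gb), (ga, 4))], ga, 4)]"

definition pcs32 :: "gen pc list" where
  "pcs32 =
    [([(ga, 8), (gb, 4)], [((ga, gb), (ga, 4))], ga, 4),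
     ([(ga, 16), (gb, 2)], [((ga, gb), (ga, 8))], ga, 8),
     ([(ga, 2), (gb, 2), (gc, 8)], [((ga, gb), (gc, 4))], gc, 4),
     ([(ga, 2), (gb, 2), (gc, 8)], [((ga, gc), (gc, 4))], gc, 4)]"

definition pcs64 :: "gen pc list" where
  "pcs64 =
    [([(ga, 2), (gb, 4), (gc, 8)], [((gb, gc), (gc, 4))], gc, 4),
     ([(ga, 2), (gb, 4), (gc, 8)], [((ga, gc), (gc, 4))], gc, 4),
     ([(ga, 2), (gb, 4), (gc, 8)], [((ga, gb), (gc, 4))], gc, 4),
     ([(ga, 2), (gb, 2), (gc, 2), (gd, 8)], [((ga, gb), (gd, 4))], gd, 4),
     ([(ga, 2), (gb, 2), (gc, 16)], [((ga, gb), (gc, 8))], gc, 8),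
     ([(ga, 2), (gb, 2), (gc, 2), (gd, 8)], [((ga, gd), (gd, 4))], gd, 4),
     ([(ga, 2), (gb, 2), (gc, 2), (gd, 8)], [((ga, gb), (gd, 4)), ((gc, gd), (gd, 4))], gd, 4),
     ([(ga, 2), (gb, 2), (gc, 16)], [((ga, gc), (gc, 8))], gc, 8),
     ([(ga, 8), (gb, 8)], [((ga, gb), (ga, 4))], ga, 4),
     ([(ga, 32), (gb, 2)], [((ga, gb), (ga, 16))], ga, 16),
     ([(ga, 16), (gb, 4)], [((ga, gb), (ga, 4))], ga, 4),
     ([(ga, 16), (gb, 4)], [((ga, gb), (ga, 8))], ga, 8)]"

text \<open>Without commutator relations \<open>c\<close> and \<open>w\<close> are placeholders:
  generator \<open>0\<close> and four times its order meet the divisibility conditions of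
  \<open>pc_ok\<close>. The exponents \<open>es\<close> are the parts of a partition.\<close>

definition abelian_pc :: "nat list \<Rightarrow> nat pc" where
  "abelian_pc es = (zip [0..<length es] (map (\<lambda>e. 2 ^ e) es), [], 0, 4 * 2 ^ hd es)"

fun pc_valid :: "'g pc \<Rightarrow> bool" where "pc_valid (ps, cs, c, w) = pc_ok ps cs c w"
fun pc_to_group :: "'g pc \<Rightarrow> 'g word set monoid" where "pc_to_group (ps, cs, c, w) = pc_group ps cs"
fun pc_invariant :: "'g pc \<Rightarrow> nat list \<times> nat list" where "pc_invariant (ps, cs, c, w) = pc_inv ps cs c w"
fun pc_order :: "'g pc \<Rightarrow> nat" where "pc_order (ps, cs, c, w) = prod_list (map snd ps)"

lemma groups_eq_pcs:
  "groups16 = map pc_to_group pcs16" "groups32 = map pc_to_group pcs32" "groups64 = map pc_to_group pcs64"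
  by (simp_all add: groups16_def groups32_def groups64_def pcs16_def pcs32_def pcs64_def)

lemma pcs_valid:
  "list_all pc_valid pcs16" "list_all pc_valid pcs32" "list_all pc_valid pcs64"
  by code_simp+

lemma pcs_order:
  "list_all (\<lambda>d. pc_order d = 16) pcs16" "list_all (\<lambda>d. pc_order d = 32) pcs32"
  "list_all (\<lambda>d. pc_order d = 64) pcs64"
  by code_simp+

text \<open>The partitions of \<open>n\<close> into parts of size at most \<open>m\<close>, written
  in nonincreasing order.\<close>

fun desc_parts :: "nat \<Rightarrow> nat \<Rightarrow> nat list list" where
  "desc_parts m n = (if n = 0 then [[]]
     else concat (map (\<lambda>k. map ((#) k) (desc_parts k (n - k))) [1..<Suc (min m n)]))"

declare desc_parts.simps [simp del]

lemma desc_parts_complete: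
  "sorted_wrt (\<ge>) es \<Longrightarrow> (\<And>e. e \<in> set es \<Longrightarrow> 0 < e \<and> e \<le> m) \<Longrightarrow> es \<in> set (desc_parts m (sum_list es))"
proof (induction es arbitrary: m)
  case Nil
  show ?case by (simp add: desc_parts.simps)
next
  case (Cons e es)
  have "es \<in> set (desc_parts e (sum_list es))" using Cons.prems by (intro Cons.IH) auto
  moreover have "0 < e" "e \<le> m" using Cons.prems(2)[of e] by auto
  ultimately show ?case
    by (subst desc_parts.simps) (auto simp del: upt_Suc intro!: bexI[of _ e])
qed

definition abelian_pcs :: "nat \<Rightarrow> nat pc list" where
  "abelian_pcs m = map abelian_pc (desc_parts m m)"

lemma length_abelian_pcs: "length (abelian_pcs 4) = 5" "length (abelian_pcs 5) = 7" "length (abelian_pcs 6) = 11"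
  by code_simp+

lemma abelian_pcs_valid:
  "list_all pc_valid (abelian_pcs 4)" "list_all pc_valid (abelian_pcs 5)" "list_all pc_valid (abelian_pcs 6)"
  by code_simp+

lemma abelian_pcs_order:
  "list_all (\<lambda>d. pc_order d = 16) (abelian_pcs 4)" "list_all (\<lambda>d. pc_order d = 32) (abelian_pcs 5)"
  "list_all (\<lambda>d. pc_order d = 64) (abelian_pcs 6)"
  by code_simp+

lemma pc_invariants_16:
  "map pc_invariant pcs16 =
    [([4, 8, 16], [4, 2, 4])]"
  "map pc_invariant (abelian_pcs 4) =
    [([16, 16, 16], [16, 16, 16]),
     ([8, 16, 16], [16, 8, 16]),
     ([4, 16, 16], [16, 4, 16]),
     ([4, 8, 16], [16, 4, 8]),
     ([2, 4, 8], [16, 2, 4])]"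
  by code_simp+

lemma pc_invariants_32:
  "map pc_invariant pcs32 =
    [([4, 16, 32], [8, 4, 8]),
     ([4, 8, 16], [8, 2, 4]),
     ([8, 16, 32], [8, 2, 4]),
     ([8, 16, 32], [8, 4, 8])]"
  "map pc_invariant (abelian_pcs 5) =
    [([32, 32, 32], [32, 32, 32]),
     ([16, 32, 32], [32, 16, 32]),
     ([8, 32, 32], [32, 8, 32]),
     ([8, 16, 32], [32, 8, 16]),
     ([4, 16, 32], [32, 4, 16]),
     ([4, 8, 16], [32, 4, 8]),
     ([2, 4, 8], [32, 2, 4])]"
  by code_simp+

text \<open>Root counts alone leave ties, for instance among the first three nonabelian groups; the
  counts of central roots break them.\<close>

lemma pc_invariants_64:
  "map pc_invariant pcs64 =
    [([8, 32, 64], [16, 8, 16]),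
     ([8, 32, 64], [16, 4, 16]),
     ([8, 32, 64], [16, 4, 8]),
     ([16, 32, 64], [16, 4, 8]),
     ([8, 16, 32], [16, 2, 4]),
     ([16, 32, 64], [16, 8, 16]),
     ([16, 32, 64], [4, 2, 4]),
     ([8, 16, 32], [16, 4, 8]),
     ([4, 16, 64], [16, 4, 16]),
     ([4, 8, 16], [16, 2, 4]),
     ([4, 16, 32], [4, 2, 4]),
     ([4, 16, 32], [16, 4, 8])]"
  "map pc_invariant (abelian_pcs 6) =
    [([64, 64, 64], [64, 64, 64]),
     ([32, 64, 64], [64, 32, 64]),
     ([16, 64, 64], [64, 16, 64]),
     ([8, 64, 64], [64, 8, 64]),
     ([16, 32, 64], [64, 16, 32]),
     ([8, 32, 64], [64, 8, 32]),
     ([4, 16, 64], [64, 4, 16]),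
     ([8, 16, 32], [64, 8, 16]),
     ([4, 16, 32], [64, 4, 16]),
     ([4, 8, 16], [64, 4, 8]),
     ([2, 4, 8], [64, 2, 4])]"
  by code_simp+

text \<open>The nonabelian and the abelian tables are compared jointly, because the total count runs
  over both lists at once.\<close>

lemma distinct_pc_invariants:
  "distinct (map pc_invariant pcs16 @ map pc_invariant (abelian_pcs 4))"
  "distinct (map pc_invariant pcs32 @ map pc_invariant (abelian_pcs 5))"
  "distinct (map pc_invariant pcs64 @ map pc_invariant (abelian_pcs 6))"
  unfolding pc_invariants_16 pc_invariants_32 pc_invariants_64 by simp_all

section \<open>Powerful nilpotency\<close>

definition pn_chain :: "('a, 'b) monoid_scheme \<Rightarrow> nat \<Rightarrow> (nat \<Rightarrow> 'a set) \<Rightarrow> bool" where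
  "pn_chain G n H \<longleftrightarrow> H 0 = {\<one>\<^bsub>G\<^esub>} \<and> H n = carrier G \<and>
     (\<forall>i\<le>n. subgroup (H i) G) \<and> (\<forall>i<n. H i \<subseteq> H (Suc i)) \<and>
     (\<forall>i\<in>{1..n}. comm_subgroup G (H i) (carrier G) \<subseteq> power_subgroup G (H (i - 1)) 2)"

lemma powerfully_nilpotent_iff:
  "powerfully_nilpotent G \<longleftrightarrow> powerful_2group G \<and> (\<exists>n H. pn_chain G n H)"
  by (simp add: powerfully_nilpotent_def pn_chain_def)

text \<open>Conjugation by \<open>y\<close> is a homomorphism taking \<open>x\<close> to
  \<open>x [x, y]\<close>, and powers of this product split because its two factors commute.\<close>

lemma (in group) grp_comm_int_pow:
  assumes x: "x \<in> carrier G" "y \<in> carrier G"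
    and c: "x \<otimes> grp_comm G x y = grp_comm G x y \<otimes> x"
  shows "grp_comm G (x [^] (i::int)) y = grp_comm G x y [^] i"
proof -
  let ?h = "\<lambda>g. inv y \<otimes> g \<otimes> y"
  have hom: "?h \<in> hom G G"
    by (rule homI) (use x in \<open>simp_all add: group_word_simps\<close>)
  interpret h: group_hom G G ?h
    using hom by (simp add: group_hom_def group_hom_axioms_def group_axioms)
  have "inv y \<otimes> x [^] i \<otimes> y = (inv y \<otimes> x \<otimes> y) [^] i"
    using h.hom_int_pow[OF x(1), of i] .
  also have "inv y \<otimes> x \<otimes> y = x \<otimes> grp_comm G x y"
    using x by (simp add: grp_comm_def group_word_simps)
  also have "\<dots> [^] i = x [^] i \<otimes> grp_comm G x y [^] i"
    using x c by (intro int_pow_mult_distrib) auto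
  finally have "y \<otimes> (inv y \<otimes> x [^] i \<otimes> y) = y \<otimes> (x [^] i \<otimes> grp_comm G x y [^] i)" by simp
  then show ?thesis using x by (intro grp_comm_eqI) (simp_all add: group_word_simps)
qed

lemma (in group) grp_comm_nat_pow:
  assumes "x \<in> carrier G" "y \<in> carrier G" "x \<otimes> grp_comm G x y = grp_comm G x y \<otimes> x"
  shows "grp_comm G (x [^] (n::nat)) y = grp_comm G x y [^] n"
  using grp_comm_int_pow[OF assms, of "int n"] by (simp add: int_pow_int)

lemma (in group) powerfully_nilpotentI_comm_group:
  assumes "comm_group G" "finite_2group G"
  shows "powerfully_nilpotent G"
proof -
  have "grp_comm G x y = \<one>" if "x \<in> carrier G" "y \<in> carrier G" for x y
    using that assms(1) comm_groupE(4)[of G x y] by (simp add: grp_comm_eq_one_iff)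
  then have "{grp_comm G x y |x y. x \<in> carrier G \<and> y \<in> carrier G} \<subseteq> {\<one>}" by auto
  then have "comm_subgroup G (carrier G) (carrier G) \<subseteq> generate G {\<one>}"
    unfolding comm_subgroup_def by (rule mono_generate)
  then have c: "comm_subgroup G (carrier G) (carrier G) \<subseteq> power_subgroup G A k" for A k
    unfolding generate_one power_subgroup_def by (auto intro: generate.one)
  define H where "H i = (if i = 0 then {\<one>} else carrier G)" for i :: nat
  have "pn_chain G 1 H"
    using c by (auto simp: pn_chain_def H_def triv_subgroup subgroup_self)
  then show ?thesis
    unfolding powerfully_nilpotent_iff powerful_2group_def using assms(2) c by blast
qed

context pc_sat_group
begin

text \<open>The chain \<open>1 \<le> \<langle>c\<^sup>4\<rangle> \<le> \<langle>c\<^sup>2\<rangle> \<le> G\<close> witnesses powerful nilpotency, because \<open>4\<close> divides \<open>w\<close>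
  and \<open>c\<^bsup>4w\<^esup> = 1\<close>.\<close>

lemma powerfully_nilpotent_if_pc_sat:
  assumes ord: "order G = 2 ^ m"
  shows "powerfully_nilpotent G"
proof -
  let ?g = "f c"
  have g: "?g \<in> carrier G" using f_closed c_X by blast
  have zc4: "zc [^] (4::nat) = \<one>"
    using f_c_pow_eq_one[of "w * 4"] w_dvd(2) g by (simp add: zc_def nat_pow_pow mult.commute)
  obtain v where v: "w = 4 * v" using w_dvd(1) by blast
  have comm_pow: "\<exists>j::int. \<forall>i::int. grp_comm G (?g [^] i) y = zc [^] (j * i)" if y: "y \<in> carrier G" for y
  proof -
    have d: "grp_comm G ?g y \<in> generate G {zc}" using grp_comm_zc[OF g y] .
    then obtain j :: int where "grp_comm G ?g y = zc [^] j"
      using generate_pow[OF zc_closed] by auto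
    moreover have "grp_comm G (?g [^] i) y = grp_comm G ?g y [^] i" for i :: int
      using grp_comm_int_pow[OF g y] zc_gen_central[OF d g] by simp
    ultimately show ?thesis using zc_closed by (auto simp: int_pow_pow)
  qed
  define H where "H i = (if i = 0 then {\<one>} else if i = 1 then generate G {?g [^] (4::int)}
     else if i = 2 then generate G {?g [^] (2::int)} else carrier G)" for i :: nat
  have H: "H 0 = {\<one>}" "H 1 = generate G {?g [^] (4::int)}" "H 2 = generate G {?g [^] (2::int)}"
    "H 3 = carrier G" by (simp_all add: H_def)
  have sub: "subgroup (H i) G" for i
    using g by (auto simp: H_def triv_subgroup subgroup_self intro: generate_is_subgroup)
  have pow_mem: "?g [^] (k * i) \<in> generate G {?g [^] k}" for k i :: int
    using generate_pow[of "?g [^] k"] g by (auto simp: int_pow_pow)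
  have sub_pow: "subgroup (power_subgroup G (H i) k) G" for i k
    unfolding power_subgroup_def using subgroup.subset[OF sub[of i]]
    by (intro generate_is_subgroup) auto
  have mem_pow: "x [^] k \<in> power_subgroup G A k" if "x \<in> A" for x A and k :: nat
    unfolding power_subgroup_def using that by (auto intro: generate.incl)
  \<comment> \<open>With \<open>w = 4 v\<close>, the element \<open>c^w\<close> is a fourth power in
    \<open>G\<close> and a square of an element of \<open>\<langle>c^2\<rangle>\<close>, and its
    square is a square of an element of \<open>\<langle>c^4\<rangle>\<close>. These three facts
    serve powerfulness and the links 3 and 2 of the chain; at link 1 the commutators are powers of
    \<open>zc^4 = 1\<close>.\<close>
  have zc_v: "zc = (?g [^] int v) [^] (4::nat)"
    unfolding zc_def using g by (simp add: v int_pow_int nat_pow_pow mult.commute)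
  have zc_v2: "zc = (?g [^] (2 * int v)) [^] (2::nat)"
    unfolding zc_def using g by (simp add: v nat_pow_pow int_pow_pow flip: int_pow_int)
  have zc_v4: "zc [^] (2::int) = (?g [^] (4 * int v)) [^] (2::nat)"
    unfolding zc_def using g by (simp add: v nat_pow_pow int_pow_pow flip: int_pow_int)
  have comm_le: "comm_subgroup G (carrier G) (carrier G) \<subseteq> K" if "subgroup K G" "zc \<in> K" for K
  proof -
    have "generate G {zc} \<subseteq> K" using that by (intro generate_subgroup_incl) auto
    then show ?thesis unfolding comm_subgroup_def
      using grp_comm_zc that by (intro generate_subgroup_incl) auto
  qed
  have powerful: "powerful_2group G"
    unfolding powerful_2group_def finite_2group_def
  proof (intro conjI)
    show "comm_subgroup G (carrier G) (carrier G) \<subseteq> power_subgroup G (carrier G) 4"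
    proof (rule comm_le)
      show "subgroup (power_subgroup G (carrier G) 4) G" using sub_pow[of 3] H(4) by simp
      show "zc \<in> power_subgroup G (carrier G) 4" unfolding zc_v using g by (intro mem_pow) simp
    qed
  qed (use ord finite_carrier group_axioms in auto)
  have 3: "comm_subgroup G (H 3) (carrier G) \<subseteq> power_subgroup G (H 2) 2"
    unfolding H(4)
  proof (rule comm_le[OF sub_pow])
    show "zc \<in> power_subgroup G (H 2) 2" unfolding zc_v2 by (rule mem_pow) (simp add: H pow_mem)
  qed
  have 2: "comm_subgroup G (H 2) (carrier G) \<subseteq> power_subgroup G (H 1) 2"
    unfolding comm_subgroup_def
  proof (rule generate_subgroup_incl[OF _ sub_pow], clarify)
    fix x y assume x: "x \<in> H 2" and y: "y \<in> carrier G"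
    obtain i :: int where x: "x = ?g [^] (2 * i)"
      using x[unfolded H] generate_pow[of "?g [^] (2::int)"] g by (auto simp: int_pow_pow)
    obtain j :: int where "grp_comm G x y = zc [^] (j * (2 * i))" using comm_pow[OF y] x by blast
    also have "\<dots> = (zc [^] (2::int)) [^] (j * i)" using zc_closed by (simp add: int_pow_pow mult_ac)
    also have "\<dots> \<in> power_subgroup G (H 1) 2"
    proof (rule subgroup_int_pow_closed[OF sub_pow])
      show "zc [^] (2::int) \<in> power_subgroup G (H 1) 2"
        unfolding zc_v4 by (rule mem_pow) (simp only: H pow_mem)
    qed
    finally show "grp_comm G x y \<in> power_subgroup G (H 1) 2" .
  qed
  have 1: "comm_subgroup G (H 1) (carrier G) \<subseteq> power_subgroup G (H 0) 2"
    unfolding comm_subgroup_def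
  proof (rule generate_subgroup_incl[OF _ sub_pow], clarify)
    fix x y assume x: "x \<in> H 1" and y: "y \<in> carrier G"
    obtain i :: int where x: "x = ?g [^] (4 * i)"
      using x[unfolded H] generate_pow[of "?g [^] (4::int)"] g by (auto simp: int_pow_pow)
    obtain j :: int where "grp_comm G x y = zc [^] (j * (4 * i))" using comm_pow[OF y] x by blast
    also have "\<dots> = (zc [^] int 4) [^] (j * i)" using zc_closed by (simp add: int_pow_pow mult_ac)
    also have "\<dots> = \<one>" using zc4 by (simp only: int_pow_int) simp
    finally show "grp_comm G x y \<in> power_subgroup G (H 0) 2"
      by (simp add: power_subgroup_def generate.one)
  qed
  have "H 1 \<subseteq> H 2"
  proof -
    have "?g [^] (4::int) \<in> H 2" using pow_mem[of 2 2] by (simp add: H)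
    then show ?thesis unfolding H(2) using sub by (intro generate_subgroup_incl) auto
  qed
  moreover have "H i \<subseteq> carrier G" "{\<one>} \<subseteq> H i" for i
    using subgroup.subset[OF sub] subgroup.one_closed[OF sub] by auto
  ultimately have "H i \<subseteq> H (Suc i)" if "i < 3" for i
  proof -
    have "i = 0 \<or> i = 1 \<or> i = 2" using that by auto
    then show ?thesis
      using \<open>H 1 \<subseteq> H 2\<close> \<open>\<And>i. H i \<subseteq> carrier G\<close> \<open>\<And>i. {\<one>} \<subseteq> H i\<close>
      unfolding One_nat_def[symmetric] H(1)[symmetric] H(4)[symmetric]
      by (elim disjE) (simp_all add: numeral_2_eq_2 numeral_3_eq_3)
  qed
  moreover have "comm_subgroup G (H i) (carrier G) \<subseteq> power_subgroup G (H (i - 1)) 2" if "i \<in> {1..3}" for i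
  proof -
    have "i = 1 \<or> i = 2 \<or> i = 3" using that by auto
    then show ?thesis using 1 2 3 by auto
  qed
  ultimately have "pn_chain G 3 H"
    using H(1,4) sub by (simp add: pn_chain_def)
  then show ?thesis unfolding powerfully_nilpotent_iff using powerful by blast
qed

end

lemma powerfully_nilpotentD:
  assumes "powerfully_nilpotent G"
  shows "group G" "finite (carrier G)" "\<exists>m. order G = 2 ^ m"
    "comm_subgroup G (carrier G) (carrier G) \<subseteq> power_subgroup G (carrier G) 4"
  using assms by (auto simp: powerfully_nilpotent_def powerful_2group_def finite_2group_def)

text \<open>Forming commutator subgroups and power subgroups commutes with taking images, so the
  chain can be pushed forward. It is applied both to quotient maps and to isomorphisms.\<close>

lemma powerfully_nilpotent_hom_image:
  assumes pn: "powerfully_nilpotent G" and H: "group H"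
    and h: "h \<in> hom G H" and im: "h ` carrier G = carrier H"
  shows "powerfully_nilpotent H"
proof -
  note G = powerfully_nilpotentD(1)[OF pn]
  interpret h: group_hom G H h using G H h by (simp add: group_hom_def group_hom_axioms_def)
  have fin: "finite (carrier H)" using powerfully_nilpotentD(2)[OF pn] im by (metis finite_imageI)
  have "order (G Mod kernel G H h) = order H"
    using iso_same_card[OF h.FactGroup_iso[OF im]] by (simp add: order_def)
  then have "order H dvd order G"
    using group.lagrange[OF G h.subgroup_kernel]
    by (simp add: order_def FactGroup_def) (metis dvd_triv_left)
  then obtain k where ord: "order H = 2 ^ k"
    using powerfully_nilpotentD(3)[OF pn] by (auto simp: divides_primepow_nat two_is_prime_nat)
  have comm: "comm_subgroup H (h ` A) (h ` B) = h ` comm_subgroup G A B"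
    if "A \<subseteq> carrier G" "B \<subseteq> carrier G" for A B
  proof -
    have *: "grp_comm H (h x) (h y) = h (grp_comm G x y)" if "x \<in> carrier G" "y \<in> carrier G" for x y
      using that by (simp add: grp_comm_def h.hom_inv)
    have "{grp_comm H x y |x y. x \<in> h ` A \<and> y \<in> h ` B} = h ` {grp_comm G x y |x y. x \<in> A \<and> y \<in> B}"
      (is "?L = ?R")
    proof
      show "?L \<subseteq> ?R"
      proof
        fix v assume "v \<in> ?L"
        then obtain x y where xy: "x \<in> A" "y \<in> B" "v = grp_comm H (h x) (h y)" by blast
        then have "v = h (grp_comm G x y)" using * that by (simp add: subset_iff)
        then show "v \<in> ?R" using xy by blast
      qed
      show "?R \<subseteq> ?L"
      proof
        fix v assume "v \<in> ?R"
        then obtain x y where xy: "x \<in> A" "y \<in> B" "v = h (grp_comm G x y)" by blast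
        then have "v = grp_comm H (h x) (h y)" using * that by (simp add: subset_iff)
        then show "v \<in> ?L" using xy by blast
      qed
    qed
    moreover have "{grp_comm G x y |x y. x \<in> A \<and> y \<in> B} \<subseteq> carrier G"
      using that group.grp_comm_closed[OF G] by blast
    ultimately show ?thesis
      unfolding comm_subgroup_def by (simp add: h.generate_img)
  qed
  have pow: "power_subgroup H (h ` A) k = h ` power_subgroup G A k" if "A \<subseteq> carrier G" for A and k :: nat
  proof -
    have "{x [^]\<^bsub>H\<^esub> k |x. x \<in> h ` A} = h ` {x [^]\<^bsub>G\<^esub> k |x. x \<in> A}"
      (is "?L = ?R")
    proof -
      have "?L = (\<lambda>x. h x [^]\<^bsub>H\<^esub> k) ` A" by auto
      also have "\<dots> = (\<lambda>x. h (x [^]\<^bsub>G\<^esub> k)) ` A"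
        using that by (intro image_cong) (auto simp: h.hom_nat_pow)
      also have "\<dots> = ?R" by auto
      finally show ?thesis .
    qed
    moreover have "{x [^]\<^bsub>G\<^esub> k |x. x \<in> A} \<subseteq> carrier G" using that G
      by (auto simp: subset_iff intro: monoid.nat_pow_closed group.is_monoid)
    ultimately show ?thesis
      unfolding power_subgroup_def by (simp add: h.generate_img)
  qed
  obtain n :: nat and C where C: "C 0 = {\<one>\<^bsub>G\<^esub>}" "C n = carrier G" "\<And>i. i \<le> n \<Longrightarrow> subgroup (C i) G"
    "\<And>i. i < n \<Longrightarrow> C i \<subseteq> C (Suc i)"
    "\<And>i. i \<in> {1..n} \<Longrightarrow> comm_subgroup G (C i) (carrier G) \<subseteq> power_subgroup G (C (i - 1)) 2"
  proof -
    obtain n C where "pn_chain G n C" using pn unfolding powerfully_nilpotent_iff by blast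
    then show thesis by (intro that[of C n]) (simp_all add: pn_chain_def)
  qed
  have Csub: "C i \<subseteq> carrier G" if "i \<le> n" for i using C(3)[OF that] by (rule subgroup.subset)
  have "comm_subgroup H (carrier H) (carrier H) \<subseteq> power_subgroup H (carrier H) 4"
    using image_mono[OF powerfully_nilpotentD(4)[OF pn], of h] comm[of "carrier G" "carrier G"]
      pow[of "carrier G" 4] by (simp add: im)
  then have "powerful_2group H"
    using H fin ord by (simp add: powerful_2group_def finite_2group_def)
  moreover have "comm_subgroup H (h ` C i) (carrier H) \<subseteq> power_subgroup H (h ` C (i - 1)) 2"
    if i: "i \<in> {1..n}" for i
  proof -
    have "comm_subgroup H (h ` C i) (h ` carrier G) = h ` comm_subgroup G (C i) (carrier G)"
      using i by (intro comm Csub) auto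
    moreover have "power_subgroup H (h ` C (i - 1)) 2 = h ` power_subgroup G (C (i - 1)) 2"
      using i by (intro pow Csub) auto
    ultimately show ?thesis using C(5)[OF i] by (auto simp: im)
  qed
  moreover have "subgroup (h ` C i) H" if "i \<le> n" for i
    using C(3)[OF that] by (rule h.subgroup_img_is_subgroup)
  moreover have "h ` C i \<subseteq> h ` C (Suc i)" if "i < n" for i using C(4)[OF that] by (rule image_mono)
  ultimately have "pn_chain H n (\<lambda>i. h ` C i)"
    using C(1,2) im by (simp add: pn_chain_def)
  then show ?thesis
    unfolding powerfully_nilpotent_iff using \<open>powerful_2group H\<close> by blast
qed

lemma powerfully_nilpotent_iso:
  assumes "powerfully_nilpotent G" "group H" "G \<cong> H"
  shows "powerfully_nilpotent H"
proof -
  obtain h where "h \<in> hom G H" "bij_betw h (carrier G) (carrier H)"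
    using assms(3) by (auto simp: is_iso_def iso_def)
  then show ?thesis using powerfully_nilpotent_hom_image[OF assms(1,2)] by (auto simp: bij_betw_def)
qed

section \<open>Counting isomorphism classes\<close>

text \<open>Classes are counted among groups on natural numbers, whereas the elements of the listed
  groups are sets of words; copies bridge the two.\<close>

lemma exists_nat_copy:
  fixes G :: "('a, 'b) monoid_scheme" (structure)
  assumes G: "group G" and fin: "finite (carrier G)"
  shows "\<exists>N :: nat monoid. group N \<and> G \<cong> N"
proof -
  interpret group G by (rule G)
  obtain h :: "'a \<Rightarrow> nat" where h: "bij_betw h (carrier G) {0..<card (carrier G)}"
    using ex_bij_betw_finite_nat[OF fin] by blast
  define g where "g = inv_into (carrier G) h"
  have gh: "g (h x) = x" if "x \<in> carrier G" for x
    using h that by (simp add: g_def bij_betw_def)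
  define N :: "nat monoid" where
    "N = \<lparr>carrier = h ` carrier G, monoid.mult = \<lambda>a b. h (g a \<otimes> g b), one = h \<one>\<rparr>"
  have "h \<in> iso G N"
    using h by (auto simp: iso_def hom_def N_def gh bij_betw_def)
  moreover have "monoid N"
    by (rule monoidI) (auto simp: N_def gh m_assoc)
  ultimately have "G \<cong> N" "group N" using iso_imp_group is_isoI by blast+
  then show ?thesis by blast
qed

lemma exists_nat_copies:
  assumes "\<And>P. P \<in> set Ps \<Longrightarrow> group P \<and> finite (carrier P)"
  shows "\<exists>Ns :: nat monoid list. list_all2 (\<lambda>P N. group N \<and> P \<cong> N) Ps Ns"
  using assms
proof (induction Ps)
  case (Cons P Ps)
  then obtain Ns :: "nat monoid list" where "list_all2 (\<lambda>P N. group N \<and> P \<cong> N) Ps Ns" by auto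
  moreover obtain N :: "nat monoid" where "group N \<and> P \<cong> N"
    using exists_nat_copy[of P] Cons.prems by auto
  ultimately have "list_all2 (\<lambda>P N. group N \<and> P \<cong> N) (P # Ps) (N # Ns)" by simp
  then show ?case by blast
next
  case Nil
  show ?case by (intro exI[of _ "[]"]) simp
qed

text \<open>Distinct values of an isomorphism invariant show that no class is listed twice, and the
  description of \<open>Q\<close> shows that none is missing.\<close>

lemma num_iso_classes_eq_length:
  fixes Ns :: "nat monoid list"
  assumes grp: "\<And>N. N \<in> set Ns \<Longrightarrow> group N"
    and inv: "distinct (map \<phi> Ns)" "\<And>N M. group N \<Longrightarrow> group M \<Longrightarrow> N \<cong> M \<Longrightarrow> \<phi> N = \<phi> M"
    and Q: "\<And>G. group G \<Longrightarrow> Q G \<longleftrightarrow> (\<exists>N\<in>set Ns. G \<cong> N)"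
  shows "num_iso_classes Q = length Ns"
proof -
  define r where "r = {(G :: nat monoid, H :: nat monoid). group G \<and> group H \<and> G \<cong> H}"
  have r: "r `` {G} = r `` {H}" if "group G" "group H" "G \<cong> H" for G H
    using that unfolding r_def by (auto intro: iso_trans group.iso_sym)
  have "{G. group G \<and> Q G} // r = (\<lambda>N. r `` {N}) ` set Ns"
  proof
    show "{G. group G \<and> Q G} // r \<subseteq> (\<lambda>N. r `` {N}) ` set Ns"
    proof
      fix A assume "A \<in> {G. group G \<and> Q G} // r"
      then obtain G where G: "group G" "Q G" "A = r `` {G}" by (auto elim: quotientE)
      then obtain N where "N \<in> set Ns" "G \<cong> N" using Q by blast
      then show "A \<in> (\<lambda>N. r `` {N}) ` set Ns" using r[OF G(1) grp] G(3) by blast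
    qed
    show "(\<lambda>N. r `` {N}) ` set Ns \<subseteq> {G. group G \<and> Q G} // r"
    proof
      fix A assume "A \<in> (\<lambda>N. r `` {N}) ` set Ns"
      then obtain N where N: "N \<in> set Ns" "A = r `` {N}" by blast
      then have "N \<in> {G. group G \<and> Q G}" using Q[OF grp[OF N(1)]] grp iso_refl by blast
      then show "A \<in> {G. group G \<and> Q G} // r" unfolding N(2) by (rule quotientI)
    qed
  qed
  moreover have "inj_on (\<lambda>N. r `` {N}) (set Ns)"
  proof (rule inj_onI)
    fix N M assume *: "N \<in> set Ns" "M \<in> set Ns" "r `` {N} = r `` {M}"
    have "M \<in> r `` {M}" using grp[OF *(2)] by (simp add: r_def)
    then have "N \<cong> M" using *(3) by (auto simp: r_def)
    then have "\<phi> N = \<phi> M" using inv(2) grp * by blast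
    then show "N = M" using inv(1) * by (metis distinct_map inj_onD)
  qed
  ultimately have "num_iso_classes Q = card (set Ns)"
    unfolding num_iso_classes_def r_def by (simp add: card_image)
  also have "\<dots> = length Ns" using inv(1) by (simp add: distinct_card distinct_map)
  finally show ?thesis .
qed

section \<open>Bases of finite abelian 2-groups\<close>

lemma (in group) pow_gcd_in_subgroup:
  assumes D: "subgroup D G" and a: "a \<in> carrier G" "a [^] (i::nat) \<in> D" "a [^] (j::nat) \<in> D"
  shows "a [^] gcd i j \<in> D"
proof -
  obtain u v where uv: "u * int i + v * int j = int (gcd i j)"
    using bezout_int[of "int i" "int j"] by auto
  have "a [^] int (gcd i j) = (a [^] i) [^] u \<otimes> (a [^] j) [^] v"
    using a int_pow_mult[OF a(1), of "u * int i" "v * int j"]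
    by (simp add: uv[symmetric] int_pow_pow mult.commute flip: int_pow_int)
  also have "\<dots> \<in> D"
    using a subgroup_int_pow_closed[OF D] subgroup.m_closed[OF D] by simp
  finally show ?thesis by (simp add: int_pow_int)
qed

text \<open>By Bezout the exponent \<open>gcd (2 ^ e) j\<close> also leads into \<open>D\<close>. It
  is a power of 2, so minimality of \<open>e\<close> makes it equal to \<open>2 ^ e\<close>.\<close>

lemma (in group) pow_in_subgroup_dvd:
  assumes D: "subgroup D G" and a: "a \<in> carrier G" "a [^] ((2::nat) ^ e) \<in> D"
    and min: "\<And>i. i < e \<Longrightarrow> a [^] ((2::nat) ^ i) \<notin> D" and j: "a [^] (j::nat) \<in> D"
  shows "2 ^ e dvd j"
proof -
  have "gcd (2 ^ e) j dvd 2 ^ e" by simp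
  then obtain i where i: "i \<le> e" "gcd (2 ^ e) j = 2 ^ i"
    unfolding divides_primepow_nat[OF two_is_prime_nat] by blast
  then have "i = e" using pow_gcd_in_subgroup[OF D a j] min[of i] by force
  then show ?thesis using i(2) by (metis gcd_dvd2)
qed

lemma (in group) nat_pow_in_subgroup:
  assumes "subgroup D G" "a \<in> D"
  shows "a [^] (n::nat) \<in> D"
  using subgroup_int_pow_closed[OF assms, of "int n"] by (simp add: int_pow_int)

lemma (in group) generate_eqI:
  assumes "generate G S = carrier G" "T \<subseteq> carrier G" "S \<subseteq> generate G T"
  shows "generate G T = carrier G"
  using generate_incl[OF assms(2)] generate_subgroup_incl[OF assms(3) generate_is_subgroup[OF assms(2)]]
    assms(1) by blast

text \<open>The cardinality equation replaces independence: in an abelian group the generation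
  condition and the orders give at most \<open>card D * 2 ^ sum_list es\<close> products, and
  equality makes them distinct. The sorting is that of \<open>desc_parts\<close>.\<close>

definition basis_modulo :: "('a, 'b) monoid_scheme \<Rightarrow> 'a set \<Rightarrow> 'a list \<Rightarrow> nat list \<Rightarrow> bool" where
  "basis_modulo G D xs es \<longleftrightarrow> set xs \<subseteq> carrier G \<and>
     list_all2 (\<lambda>x e. x [^]\<^bsub>G\<^esub> ((2::nat) ^ e) \<in> D) xs es \<and>
     generate G (D \<union> set xs) = carrier G \<and> card D * 2 ^ sum_list es = order G \<and>
     sorted_wrt (\<ge>) es \<and> (\<forall>e\<in>set es. 0 < e)"

text \<open>The bound of the \<open>es\<close> by every exponent of the quotient is what makes the induction work: it
  guarantees that a basis modulo \<open>D\<langle>a\<rangle>\<close>, with \<open>a\<close> of maximal order modulo \<open>D\<close>, can be adjusted by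
  powers of \<open>a\<close> to one modulo \<open>D\<close>.\<close>

lemma (in comm_group) exists_basis_modulo:
  assumes fin: "finite (carrier G)" and ord: "order G = 2 ^ m" and D: "subgroup D G"
  shows "\<exists>xs es. basis_modulo G D xs es \<and>
    (\<forall>M. (\<forall>y\<in>carrier G. y [^] ((2::nat) ^ M) \<in> D) \<longrightarrow> (\<forall>e\<in>set es. e \<le> M))"
  using D
proof (induction "order G - card D" arbitrary: D rule: less_induct)
  case less
  note D = less(2)
  have Dc: "D \<subseteq> carrier G" using D by (rule subgroup.subset)
  have finD: "finite D" using Dc fin by (rule finite_subset)
  show ?case
  proof (cases "D = carrier G")
    case True
    then have "basis_modulo G D [] []"
      using generate_incl[of "carrier G"] generate.incl[of _ "carrier G" G]
      by (auto simp: basis_modulo_def order_def)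
    then show ?thesis by (intro exI[of _ "[]"]) simp
  next
    case False
    define r where "r y = (LEAST i. y [^] ((2::nat) ^ i) \<in> D)" for y
    have r1: "y [^] ((2::nat) ^ r y) \<in> D" if "y \<in> carrier G" for y
    proof -
      have "y [^] ((2::nat) ^ m) \<in> D"
        using pow_order_eq_1[OF that] subgroup.one_closed[OF D] by (simp add: ord)
      then show ?thesis unfolding r_def by (rule LeastI)
    qed
    have r2: "y [^] ((2::nat) ^ i) \<notin> D" if "i < r y" for y i
      using not_less_Least[of i "\<lambda>i. y [^] ((2::nat) ^ i) \<in> D"] that by (simp add: r_def)
    define e where "e = Max (r ` carrier G)"
    have finr: "finite (r ` carrier G)" "r ` carrier G \<noteq> {}" using fin by auto
    obtain a where a: "a \<in> carrier G" "r a = e" using Max_in[OF finr] by (auto simp: e_def)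
    have r_le: "r y \<le> e" if "y \<in> carrier G" for y using Max_ge[OF finr(1)] that by (simp add: e_def)
    have pow_e: "y [^] ((2::nat) ^ e) \<in> D" if y: "y \<in> carrier G" for y
    proof -
      have "y [^] ((2::nat) ^ e) = (y [^] ((2::nat) ^ r y)) [^] ((2::nat) ^ (e - r y))"
        using y r_le[OF y] by (simp add: nat_pow_pow flip: power_add)
      then show ?thesis using nat_pow_in_subgroup[OF D r1[OF y]] by simp
    qed
    have a_dvd: "2 ^ e dvd j" if "a [^] (j::nat) \<in> D" for j
      using pow_in_subgroup_dvd[OF D a(1) pow_e[OF a(1)] _ that] r2[of _ a] a(2) by blast
    have e_pos: "0 < e"
    proof -
      obtain y where y: "y \<in> carrier G" "y \<notin> D" using False Dc by blast
      then have "r y \<noteq> 0" using r1[OF y(1)] by (metis nat_pow_eone power_0)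
      then show ?thesis using r_le[OF y(1)] by simp
    qed
    define D' where "D' = generate G (insert a D)"
    have N: "D \<lhd> G" using subgroup_imp_normal[OF D] .
    have D': "subgroup D' G" unfolding D'_def using a Dc by (intro generate_is_subgroup) auto
    have DD': "D \<subseteq> D'" "a \<in> D'" unfolding D'_def by (auto intro: generate.incl)
    have cD': "card D' = card D * 2 ^ e" unfolding D'_def
    proof (rule card_generate_insert_normal[OF N a(1) pow_e[OF a(1)]])
      fix j :: nat assume "0 < j" "j < 2 ^ e"
      then show "a [^] j \<notin> D" using a_dvd[of j] by (meson dvd_imp_le not_less)
    qed simp
    have D'_elem: "\<exists>d\<in>D. \<exists>s::nat. y = d \<otimes> a [^] s" if "y \<in> D'" for y
      using that unfolding D'_def generate_insert_normal[OF N a(1) pow_e[OF a(1)], simplified] by auto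
    have "card D > 0" using finD subgroup.one_closed[OF D] by (auto simp: card_gt_0_iff)
    moreover have "(2::nat) ^ 1 \<le> 2 ^ e" using e_pos by (intro power_increasing) auto
    ultimately have "card D < card D'" unfolding cD' by simp
    moreover have "card D' \<le> order G"
      unfolding order_def using subgroup.subset[OF D'] fin by (rule card_mono[rotated])
    ultimately have "order G - card D' < order G - card D" by simp
    from less(1)[OF this D'] obtain xs es where b: "basis_modulo G D' xs es"
      and M: "\<And>M. (\<forall>y\<in>carrier G. y [^] ((2::nat) ^ M) \<in> D') \<Longrightarrow> (\<forall>e\<in>set es. e \<le> M)" by blast
    \<comment> \<open>The bound of the induction hypothesis is taken with \<open>M = e\<close>: all
      \<open>2 ^ e\<close>-th powers lie in \<open>D\<close>, hence in \<open>D'\<close>.\<close>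
    have es_le: "\<forall>e'\<in>set es. e' \<le> e" using pow_e DD' by (intro M) auto
    have len: "length xs = length es" using b by (auto simp: basis_modulo_def dest: list_all2_lengthD)
    have xs: "xs ! i \<in> carrier G" "(xs ! i) [^] ((2::nat) ^ (es ! i)) \<in> D'" if "i < length es" for i
      using b that len by (auto simp: basis_modulo_def list_all2_conv_all_nth subset_iff)
    \<comment> \<open>Write \<open>x^(2^e_i) = d a^s\<close>. Raising this to the power
      \<open>2^(e - e_i)\<close> lands in \<open>D\<close>, so \<open>2^e\<close> divides
      \<open>s 2^(e - e_i)\<close>, that is \<open>s = 2^e_i t\<close>. Then the
      \<open>2^e_i\<close>-th power of \<open>x a^-t\<close> is \<open>d\<close>.\<close>
    have "\<exists>t::nat. (xs ! i \<otimes> inv (a [^] t)) [^] ((2::nat) ^ (es ! i)) \<in> D" if i: "i < length es" for i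
    proof -
      let ?x = "xs ! i" and ?e = "es ! i"
      note x = xs[OF i]
      obtain d and s :: nat where d: "d \<in> D" "?x [^] ((2::nat) ^ ?e) = d \<otimes> a [^] s"
        using D'_elem[OF x(2)] by blast
      have dG: "d \<in> carrier G" using d Dc by blast
      have le: "?e \<le> e" using es_le i by simp
      have "?x [^] ((2::nat) ^ e) = (?x [^] ((2::nat) ^ ?e)) [^] ((2::nat) ^ (e - ?e))"
        using x le by (simp add: nat_pow_pow flip: power_add)
      also have "\<dots> = d [^] ((2::nat) ^ (e - ?e)) \<otimes> a [^] (s * 2 ^ (e - ?e))"
        using a dG by (simp add: d(2) nat_pow_distrib nat_pow_pow)
      finally have "a [^] (s * 2 ^ (e - ?e)) =
          inv (d [^] ((2::nat) ^ (e - ?e))) \<otimes> ?x [^] ((2::nat) ^ e)"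
        using a dG by (simp add: group_word_simps)
      then have "a [^] (s * 2 ^ (e - ?e)) \<in> D"
        using pow_e[OF x(1)] nat_pow_in_subgroup[OF D d(1)] subgroup.m_closed[OF D]
          subgroup.m_inv_closed[OF D] by simp
      then have "2 ^ e dvd s * 2 ^ (e - ?e)" by (rule a_dvd)
      then have "2 ^ ?e * 2 ^ (e - ?e) dvd s * 2 ^ (e - ?e)" using le by (simp flip: power_add)
      then have "2 ^ ?e dvd s" by simp
      then obtain t where t: "s = 2 ^ ?e * t" by blast
      have "(?x \<otimes> inv (a [^] t)) [^] ((2::nat) ^ ?e) = ?x [^] ((2::nat) ^ ?e) \<otimes> inv (a [^] s)"
        using x a by (simp add: nat_pow_distrib nat_pow_inv nat_pow_pow t mult.commute)
      also have "\<dots> = d" using a dG by (simp add: d(2) group_word_simps)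
      finally show ?thesis using d(1) by auto
    qed
    then obtain t :: "nat \<Rightarrow> nat" where
      t: "\<And>i. i < length es \<Longrightarrow> (xs ! i \<otimes> inv (a [^] t i)) [^] ((2::nat) ^ (es ! i)) \<in> D" by metis
    define ys where "ys = map (\<lambda>i. xs ! i \<otimes> inv (a [^] t i)) [0..<length es]"
    have ysc: "set ys \<subseteq> carrier G" using xs(1) a by (auto simp: ys_def)
    have gen: "generate G (D \<union> set (a # ys)) = carrier G"
    proof (rule generate_eqI)
      let ?H = "generate G (D \<union> set (a # ys))"
      show "generate G (D' \<union> set xs) = carrier G" using b by (simp add: basis_modulo_def)
      show T: "D \<union> set (a # ys) \<subseteq> carrier G" using Dc a ysc by auto
      have H: "subgroup ?H G" by (rule generate_is_subgroup[OF T])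
      have aH: "a \<in> ?H" by (auto intro: generate.incl)
      have "D' \<subseteq> ?H" unfolding D'_def by (rule mono_generate) auto
      moreover have "xs ! i \<in> ?H" if i: "i < length es" for i
      proof -
        have "ys ! i \<in> ?H" using i by (intro generate.incl) (auto simp: ys_def)
        moreover have "xs ! i = ys ! i \<otimes> a [^] t i" using i xs(1)[OF i] a by (simp add: ys_def m_assoc)
        ultimately show ?thesis
          using nat_pow_in_subgroup[OF H aH] subgroup.m_closed[OF H] by simp
      qed
      ultimately show "D' \<union> set xs \<subseteq> ?H" by (auto simp: in_set_conv_nth len)
    qed
    have "basis_modulo G D (a # ys) (e # es)"
      unfolding basis_modulo_def
    proof (intro conjI gen)
      show "set (a # ys) \<subseteq> carrier G" using a ysc by simp
      show "list_all2 (\<lambda>x e. x [^] ((2::nat) ^ e) \<in> D) (a # ys) (e # es)"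
      proof -
        have "list_all2 (\<lambda>x e. x [^] ((2::nat) ^ e) \<in> D) ys es"
          using t by (simp add: list_all2_conv_all_nth ys_def)
        then show ?thesis using pow_e[OF a(1)] by simp
      qed
      show "card D * 2 ^ sum_list (e # es) = order G"
        using b by (simp add: basis_modulo_def cD' power_add mult.assoc)
      show "sorted_wrt (\<ge>) (e # es)" using b es_le by (simp add: basis_modulo_def)
      show "\<forall>e\<in>set (e # es). 0 < e" using b e_pos by (simp add: basis_modulo_def)
    qed
    moreover have "\<forall>e'\<in>set (e # es). e' \<le> M" if "\<forall>y\<in>carrier G. y [^] ((2::nat) ^ M) \<in> D" for M
    proof -
      have "2 ^ e dvd (2::nat) ^ M" using that a by (intro a_dvd) auto
      then have "e \<le> M" by (simp add: power_dvd_imp_le)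
      then show ?thesis using es_le by auto
    qed
    ultimately show ?thesis by blast
  qed
qed

lemma (in comm_group) exists_basis:
  assumes "finite (carrier G)" "order G = 2 ^ m"
  obtains xs es where "basis_modulo G {\<one>} xs es" "es \<in> set (desc_parts m m)"
proof -
  obtain xs es where b: "basis_modulo G {\<one>} xs es"
    using exists_basis_modulo[OF assms triv_subgroup] by blast
  then have "(2::nat) ^ sum_list es = 2 ^ m" using assms(2) by (simp add: basis_modulo_def)
  then have s: "sum_list es = m" by simp
  have "es \<in> set (desc_parts m (sum_list es))"
    using b member_le_sum_list[of _ es] by (intro desc_parts_complete) (auto simp: basis_modulo_def s)
  with that b s show thesis by blast
qed

lemma (in comm_group) iso_abelian_pc_group:
  assumes fin: "finite (carrier G)" and ord: "order G = 2 ^ m" and m: "0 < m"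
    and valid: "list_all pc_valid (abelian_pcs m)"
  shows "\<exists>d\<in>set (abelian_pcs m). G \<cong> pc_to_group d"
proof -
  obtain xs es where b: "basis_modulo G {\<one>} xs es" and es: "es \<in> set (desc_parts m m)"
    using exists_basis[OF fin ord] by blast
  have d: "abelian_pc es \<in> set (abelian_pcs m)" using es by (simp add: abelian_pcs_def)
  obtain ps c w where pc: "abelian_pc es = (ps, [], c, w)"
    and ps: "ps = zip [0..<length es] (map (\<lambda>e. 2 ^ e) es)" by (simp add: abelian_pc_def)
  have "pc_ok ps [] c w" using valid d pc by (auto simp: list_all_iff)
  then interpret pc_data ps "[]" c w by unfold_locales
  have len: "length xs = length es" using b by (auto simp: basis_modulo_def dest: list_all2_lengthD)
  have "map fst ps = [0..<length es]" by (simp add: ps)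
  then have fst_ps: "fst ` set ps = {..<length es}" by (metis atLeast_upt set_map)
  have "pc_sat ps [] G ((!) xs)"
    unfolding pc_sat_def fst_ps
  proof (intro conjI)
    show c: "(!) xs \<in> {..<length es} \<rightarrow> carrier G"
      using b len by (auto simp: basis_modulo_def subset_iff)
    show "\<forall>(x, k)\<in>set ps. xs ! x [^] k = \<one>"
      using b by (auto simp: ps set_zip basis_modulo_def list_all2_conv_all_nth)
    show "\<forall>x\<in>{..<length es}. \<forall>y\<in>{..<length es}. x \<noteq> y \<longrightarrow> (x, y) \<notin> fst ` set [] \<longrightarrow>
        (y, x) \<notin> fst ` set [] \<longrightarrow> grp_comm G (xs ! x) (xs ! y) = \<one>"
      using c by (auto simp: grp_comm_eq_one_iff m_comm Pi_iff)
    have "(!) xs ` {..<length es} = set xs" by (auto simp: in_set_conv_nth len image_iff)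
    moreover have "generate G (set xs) = carrier G"
    proof (rule generate_eqI)
      show "generate G ({\<one>} \<union> set xs) = carrier G" using b by (simp add: basis_modulo_def)
      show "set xs \<subseteq> carrier G" using b by (simp add: basis_modulo_def)
      show "{\<one>} \<union> set xs \<subseteq> generate G (set xs)" by (auto intro: generate.incl generate.one)
    qed
    ultimately show "generate G ((!) xs ` {..<length es}) = carrier G" by simp
  qed simp
  moreover have "(\<Prod>x\<in>X. pc_data.gen_ord ps x) = order G"
  proof -
    have "prod_list (map snd ps) = 2 ^ sum_list es"
      by (simp add: ps, induction es) (simp_all add: power_add)
    then show ?thesis using b by (simp add: basis_modulo_def prod_ord)
  qed
  ultimately have "pc_group ps [] \<cong> G"
    by (intro iso_pc_group_if_pc_sat(1)) (auto simp: group_axioms)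
  then have "G \<cong> pc_to_group (abelian_pc es)"
    using group.iso_sym[OF group_pc_group] by (simp add: pc)
  then show ?thesis using d by blast
qed

section \<open>Groups with a commutator subgroup of order two\<close>

text \<open>Passing from \<open>n\<close> to \<open>n + 1\<close> moves \<open>y^n\<close> past one
  \<open>x\<close> at the cost of \<open>d^n\<close>, and these costs add up to the binomial
  exponent.\<close>

lemma (in group) pow_mult_class2:
  assumes x: "x \<in> carrier G" "y \<in> carrier G" and d: "d = grp_comm G y x"
    and dx: "d \<otimes> x = x \<otimes> d" and dy: "d \<otimes> y = y \<otimes> d"
  shows "(x \<otimes> y) [^] (n::nat) = x [^] n \<otimes> y [^] n \<otimes> d [^] (n choose 2)"
proof (induction n)
  case 0
  show ?case by (simp add: numeral_2_eq_2)
next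
  case (Suc n)
  have dG: "d \<in> carrier G" using x d by simp
  have dn: "d [^] k \<otimes> g = g \<otimes> d [^] k" if "d \<otimes> g = g \<otimes> d" "g \<in> carrier G" for k :: nat and g
  proof (induction k)
    case (Suc k)
    have "d [^] k \<otimes> d \<otimes> g = (d [^] k \<otimes> g) \<otimes> d" using that dG by (simp add: m_assoc)
    also have "\<dots> = g \<otimes> (d [^] k \<otimes> d)" using Suc that dG by (simp add: m_assoc)
    finally show ?case by simp
  qed (use that in simp)
  have "grp_comm G (y [^] n) x = d [^] n" using grp_comm_nat_pow[of y x n] x d dy by simp
  then have yx: "y [^] n \<otimes> x = x \<otimes> y [^] n \<otimes> d [^] n" using mult_grp_comm[of "y [^] n" x] x by simp
  have "(x \<otimes> y) [^] Suc n = x [^] n \<otimes> y [^] n \<otimes> d [^] (n choose 2) \<otimes> x \<otimes> y" using Suc x dG by (simp add: m_assoc)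
  also have "\<dots> = x [^] n \<otimes> y [^] n \<otimes> x \<otimes> y \<otimes> d [^] (n choose 2)"
    using x dG dn[OF dx x(1), of "n choose 2"] dn[OF dy x(2), of "n choose 2"]
    by (simp add: m_assoc)
  also have "\<dots> = x [^] n \<otimes> (y [^] n \<otimes> x) \<otimes> y \<otimes> d [^] (n choose 2)" using x dG by (simp add: m_assoc)
  also have "\<dots> = x [^] n \<otimes> x \<otimes> y [^] n \<otimes> (d [^] n \<otimes> y) \<otimes> d [^] (n choose 2)"
    unfolding yx using x dG by (simp add: m_assoc)
  also have "\<dots> = (x [^] n \<otimes> x) \<otimes> (y [^] n \<otimes> y) \<otimes> (d [^] n \<otimes> d [^] (n choose 2))"
    unfolding dn[OF dy x(2)] using x dG by (simp add: m_assoc)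
  also have "d [^] n \<otimes> d [^] (n choose 2) = d [^] (Suc n choose 2)"
    using dG by (simp add: nat_pow_mult numeral_2_eq_2)
  finally show ?case by simp
qed

lemma (in group) generate_coset_lift:
  assumes N: "N \<lhd> G" and S: "S \<subseteq> carrier G" "generate (G Mod N) ((\<lambda>x. N #> x) ` S) = carrier (G Mod N)"
  shows "generate G (N \<union> S) = carrier G"
proof
  interpret N: normal N G by (rule N)
  interpret h: group_hom G "G Mod N" "\<lambda>x. N #> x"
    using N.r_coset_hom_Mod N.factorgroup_is_group
    by (simp add: group_hom_def group_hom_axioms_def group_axioms)
  show "generate G (N \<union> S) \<subseteq> carrier G" using S N.subset by (intro generate_incl) auto
  show "carrier G \<subseteq> generate G (N \<union> S)"
  proof
    fix g assume g: "g \<in> carrier G"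
    then have "N #> g \<in> (\<lambda>x. N #> x) ` generate G S"
      using h.generate_img[OF S(1)] S(2) by (auto simp: carrier_FactGroup)
    then obtain s where s: "s \<in> generate G S" "N #> g = N #> s" by blast
    have sG: "s \<in> carrier G" using s(1) generate_in_carrier[OF S(1)] by blast
    have "g \<in> N #> s" using s(2) rcos_self[OF g N.subgroup_axioms] by simp
    then obtain x where "x \<in> N" "g = x \<otimes> s" by (auto simp: r_coset_def)
    moreover have "s \<in> generate G (N \<union> S)" using s(1) mono_generate[of S "N \<union> S"] by blast
    ultimately show "g \<in> generate G (N \<union> S)" by (auto intro: generate.eng generate.incl)
  qed
qed

lemma (in group) generate_single_nat_pow:
  assumes "c \<in> carrier G" "c [^] (k::nat) = \<one>" "0 < k" "d \<in> generate G {c}"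
  obtains s :: nat where "d = c [^] s"
proof -
  obtain i :: int where i: "d = c [^] i" using generate_pow[OF assms(1)] assms(4) by auto
  have "c [^] i = (c [^] int k) [^] (i div int k) \<otimes> c [^] (i mod int k)"
    using assms(1) int_pow_mult[OF assms(1), of "int k * (i div int k)" "i mod int k"]
    by (simp add: int_pow_pow)
  also have "\<dots> = c [^] int (nat (i mod int k))" using assms by (simp add: int_pow_int)
  finally show thesis using that[of "nat (i mod int k)"] i unfolding int_pow_int by simp
qed

text \<open>The case \<open>[G, G] = {1, z}\<close> with \<open>z\<close> a central involution. The
  assumption \<open>z_4th\<close> is the form that \<open>[G, G] \<le> G^4\<close> takes
  here.\<close>

locale comm2 = group G for G (structure) + fixes z and n :: nat
  assumes z: "z \<in> carrier G" "z \<noteq> \<one>" "z \<otimes> z = \<one>"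
    and z_central: "\<And>g. g \<in> carrier G \<Longrightarrow> z \<otimes> g = g \<otimes> z"
    and grp_comm_z: "\<And>x y. x \<in> carrier G \<Longrightarrow> y \<in> carrier G \<Longrightarrow> grp_comm G x y \<in> {\<one>, z}"
    and not_comm: "\<not> comm_group G"
    and z_4th: "\<exists>g\<in>carrier G. g [^] (4::nat) = z"
    and ord: "order G = 2 ^ n"
begin

section \<open>The commutator form and powers of products\<close>

lemma finite_carrier: "finite (carrier G)"
  using ord by (metis card.infinite order_def power_not_zero zero_neq_numeral)

text \<open>The commutator form as a relation: truth stands for 1 in the field with two elements,
  and \<open>\<noteq>\<close> between truth values is its addition. Bilinearity thus becomes
  \<open>B_mult_left\<close> and \<open>B_mult_right\<close>.\<close>

definition B where "B x y \<longleftrightarrow> x \<otimes> y \<noteq> y \<otimes> x"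

lemma grp_comm_B: "x \<in> carrier G \<Longrightarrow> y \<in> carrier G \<Longrightarrow> grp_comm G x y = (if B x y then z else \<one>)"
  using grp_comm_z[of x y] grp_comm_eq_one_iff[of x y] by (auto simp: B_def)

lemma B_self [simp]: "\<not> B x x" by (simp add: B_def)

lemma B_sym: "B x y \<longleftrightarrow> B y x" by (auto simp: B_def)

lemma z_pow: "z [^] (k::nat) = (if even k then \<one> else z)"
  using z by (induction k) auto

lemma mult_swap:
  assumes "x \<in> carrier G" "y \<in> carrier G"
  shows "x \<otimes> y = y \<otimes> x \<otimes> (if B x y then z else \<one>)"
  using mult_grp_comm[OF assms] grp_comm_B[OF assms] by simp

lemma B_mult_left:
  assumes "x \<in> carrier G" "y \<in> carrier G" "t \<in> carrier G"
  shows "B (x \<otimes> y) t \<longleftrightarrow> B x t \<noteq> B y t"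
proof -
  let ?c = "\<lambda>b. if b then z else \<one>"
  have c: "?c b \<in> carrier G" "?c b \<otimes> g = g \<otimes> ?c b" if "g \<in> carrier G" for b g
    using z z_central[OF that] that by simp_all
  have "x \<otimes> y \<otimes> t = x \<otimes> (y \<otimes> t)" using assms by (simp add: m_assoc)
  also have "y \<otimes> t = t \<otimes> y \<otimes> ?c (B y t)" using assms by (intro mult_swap)
  also have "x \<otimes> (t \<otimes> y \<otimes> ?c (B y t)) = (x \<otimes> t) \<otimes> y \<otimes> ?c (B y t)"
    using assms c(1)[OF assms(1)] by (simp add: m_assoc)
  also have "x \<otimes> t = t \<otimes> x \<otimes> ?c (B x t)" using assms by (intro mult_swap)
  also have "t \<otimes> x \<otimes> ?c (B x t) \<otimes> y \<otimes> ?c (B y t) = t \<otimes> x \<otimes> (?c (B x t) \<otimes> y) \<otimes> ?c (B y t)"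
    using assms c(1)[OF assms(1)] by (simp add: m_assoc)
  also have "\<dots> = t \<otimes> x \<otimes> y \<otimes> (?c (B x t) \<otimes> ?c (B y t))"
    unfolding c(2)[OF assms(2)] using assms c[of x] by (simp add: m_assoc)
  finally have "x \<otimes> y \<otimes> t = t \<otimes> (x \<otimes> y) \<otimes> (?c (B x t) \<otimes> ?c (B y t))" using assms by (simp add: m_assoc)
  moreover have "?c (B x t) \<otimes> ?c (B y t) = ?c (B x t \<noteq> B y t)" using z by auto
  ultimately have "x \<otimes> y \<otimes> t = t \<otimes> (x \<otimes> y) \<otimes> ?c (B x t \<noteq> B y t)" by simp
  moreover have "t \<otimes> (x \<otimes> y) \<otimes> z \<noteq> t \<otimes> (x \<otimes> y)" using z assms by simp
  ultimately show ?thesis using assms unfolding B_def[of "x \<otimes> y"] by auto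
qed

lemma B_mult_right:
  assumes "x \<in> carrier G" "y \<in> carrier G" "t \<in> carrier G"
  shows "B t (x \<otimes> y) \<longleftrightarrow> B t x \<noteq> B t y"
  using B_mult_left[OF assms] by (simp add: B_sym[of t])

lemma B_one [simp]: "x \<in> carrier G \<Longrightarrow> \<not> B \<one> x" "x \<in> carrier G \<Longrightarrow> \<not> B x \<one>"
  by (simp_all add: B_def)

lemma B_pow:
  "x \<in> carrier G \<Longrightarrow> t \<in> carrier G \<Longrightarrow> B (x [^] (k::nat)) t \<longleftrightarrow> odd k \<and> B x t"
  by (induction k) (auto simp: B_mult_left)

lemma B_pow_right:
  "x \<in> carrier G \<Longrightarrow> t \<in> carrier G \<Longrightarrow> B t (x [^] (k::nat)) \<longleftrightarrow> odd k \<and> B t x"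
  using B_pow by (simp add: B_sym[of t])

lemma pow_mult:
  assumes "x \<in> carrier G" "y \<in> carrier G"
  shows "(x \<otimes> y) [^] (k::nat) = x [^] k \<otimes> y [^] k \<otimes> (if B x y \<and> odd (k choose 2) then z else \<one>)"
proof -
  let ?d = "if B x y then z else \<one>"
  have d: "?d = grp_comm G y x" using grp_comm_B[OF assms(2,1)] B_sym[of x y] by simp
  have "?d \<otimes> g = g \<otimes> ?d" if "g \<in> carrier G" for g using z_central[OF that] that by simp
  then have "(x \<otimes> y) [^] k = x [^] k \<otimes> y [^] k \<otimes> ?d [^] (k choose 2)"
    using assms by (intro pow_mult_class2[OF assms d]) blast+
  then show ?thesis using z_pow[of "k choose 2"] by auto
qed

text \<open>Among the powers of 2 only 2 itself has an odd binomial coefficient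
  \<open>k choose 2\<close>. This is why squares, and no higher powers, need corrections by
  \<open>z\<close>.\<close>

lemma even_choose_two: "4 dvd k \<Longrightarrow> even (k choose 2)"
  by (auto simp: choose_two elim!: dvdE)

lemma pow_mult_4:
  assumes "x \<in> carrier G" "y \<in> carrier G" "4 dvd k"
  shows "(x \<otimes> y) [^] (k::nat) = x [^] k \<otimes> y [^] k"
  using pow_mult[OF assms(1,2), of k] even_choose_two[OF assms(3)] assms by simp

lemma pow_mult_2:
  assumes "x \<in> carrier G" "y \<in> carrier G"
  shows "(x \<otimes> y) [^] (2::nat) = x [^] (2::nat) \<otimes> y [^] (2::nat) \<otimes> (if B x y then z else \<one>)"
  using pow_mult[OF assms, of 2] by simp

lemma pow_4_dvd:
  "4 dvd (2::nat) ^ e \<longleftrightarrow> 2 \<le> e"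
proof -
  have "(4::nat) = 2 ^ 2" by simp
  then show ?thesis using power_dvd_imp_le[of "2::nat" 2 e] le_imp_power_dvd[of 2 e "2::nat"] by auto
qed

lemma pow_z_pow:
  assumes "x [^] ((2::nat) ^ k) = z" "x \<in> carrier G"
  shows "x [^] ((2::nat) ^ Suc k) = \<one>"
  using assms z_pow[of 2] nat_pow_pow[of x "2 ^ k" 2] by (simp add: mult.commute)

text \<open>The key choice is a \<open>c\<close> whose \<open>2\<^sup>k\<close>-th power is \<open>z\<close> with \<open>k\<close> maximal: then \<open>\<langle>c\<rangle>\<close> is pure
  modulo \<open>\<langle>z\<rangle>\<close>, so a basis of the abelian group \<open>G / \<langle>c\<rangle>\<close> lifts to elements of the same order.\<close>

lemma exists_pure_cyclic_basis:
  obtains c k ys es where "c \<in> carrier G" "2 \<le> k" "c [^] ((2::nat) ^ k) = z"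
    "set ys \<subseteq> carrier G" "list_all2 (\<lambda>y e. y [^] ((2::nat) ^ e) = \<one>) ys es"
    "generate G (insert c (set ys)) = carrier G" "k < n" "es \<in> set (desc_parts (n - Suc k) (n - Suc k))"
proof -
  define K where "K k \<longleftrightarrow> (\<exists>c\<in>carrier G. c [^] ((2::nat) ^ k) = z)" for k
  have K_less: "k < n" if Kk: "K k" for k
  proof (rule ccontr)
    assume "\<not> k < n"
    obtain c where c: "c \<in> carrier G" "c [^] ((2::nat) ^ k) = z" using Kk by (auto simp: K_def)
    have "c [^] ((2::nat) ^ k) = (c [^] order G) [^] ((2::nat) ^ (k - n))"
      using c \<open>\<not> k < n\<close> by (simp add: ord nat_pow_pow flip: power_add)
    then show False using c z by (simp add: pow_order_eq_1)
  qed
  have K2: "K 2" using z_4th by (simp add: K_def)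
  define k where "k = Max {k. K k}"
  have fin: "finite {k. K k}" using K_less by (intro finite_subset[of "{k. K k}" "{..<n}"]) auto
  have Kk: "K k" and k_max: "\<And>j. K j \<Longrightarrow> j \<le> k"
    unfolding k_def using Max_in[OF fin] K2 Max_ge[OF fin] by auto
  have k2: "2 \<le> k" using k_max[OF K2] .
  have kn: "k < n" using K_less[OF Kk] .
  obtain c where c: "c \<in> carrier G" "c [^] ((2::nat) ^ k) = z" using Kk by (auto simp: K_def)
  have c1: "c [^] ((2::nat) ^ Suc k) = \<one>" using pow_z_pow c by blast
  have c_dvd: "2 ^ Suc k dvd j" if "c [^] (j::nat) = \<one>" for j
  proof (rule pow_in_subgroup_dvd[OF triv_subgroup c(1)])
    show "c [^] ((2::nat) ^ Suc k) \<in> {\<one>}" "c [^] j \<in> {\<one>}" using c1 that by auto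
    fix i assume "i < Suc k"
    then have "c [^] ((2::nat) ^ k) = (c [^] ((2::nat) ^ i)) [^] ((2::nat) ^ (k - i))"
      using c by (simp add: nat_pow_pow flip: power_add)
    then show "c [^] ((2::nat) ^ i) \<notin> {\<one>}" using c z by auto
  qed
  define D where "D = generate G {c}"
  have Dsub: "subgroup D G" unfolding D_def using c by (intro generate_is_subgroup) auto
  have cD: "c \<in> D" unfolding D_def by (auto intro: generate.incl)
  have zD: "z \<in> D" using nat_pow_in_subgroup[OF Dsub cD, of "2 ^ k"] c by simp
  have commD: "grp_comm G x y \<in> D" if "x \<in> carrier G" "y \<in> carrier G" for x y
    using grp_comm_z[OF that] zD subgroup.one_closed[OF Dsub] by auto
  have N: "D \<lhd> G" using normal_if_commutators[OF Dsub commD] .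
  have D_ins: "D = generate G (insert c {\<one>})"
  proof
    show "D \<subseteq> generate G (insert c {\<one>})" unfolding D_def by (rule mono_generate) auto
    show "generate G (insert c {\<one>}) \<subseteq> D" using cD subgroup.one_closed[OF Dsub] Dsub
      by (intro generate_subgroup_incl) auto
  qed
  have D_elem: "\<exists>s::nat. d = c [^] s" if "d \<in> D" for d
    using generate_single_nat_pow[OF c(1) c1] that unfolding D_def by auto
  have cardD: "card D = 2 ^ Suc k"
    unfolding D_ins
  proof (subst card_generate_insert_normal[OF one_is_normal c(1), of "2 ^ Suc k"])
    fix j :: nat assume "0 < j" "j < 2 ^ Suc k"
    then show "c [^] j \<notin> {\<one>}" using c_dvd[of j] by (meson dvd_imp_le not_less singletonD)
  qed (use c1 in auto)
  interpret D: normal D G by (rule N)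
  interpret Q: comm_group "G Mod D" using comm_group_Mod_iff[OF N] commD by blast
  have finQ: "finite (carrier (G Mod D))" using finite_carrier by (simp add: carrier_FactGroup)
  have "order (G Mod D) * 2 ^ Suc k = 2 ^ n"
    using lagrange[OF Dsub] ord by (simp add: cardD order_def FactGroup_def)
  also have "(2::nat) ^ n = 2 ^ (n - Suc k) * 2 ^ Suc k" using kn by (metis Suc_leI le_add_diff_inverse2 power_add)
  finally have ordQ: "order (G Mod D) = 2 ^ (n - Suc k)" by simp
  obtain Xs es where b: "basis_modulo (G Mod D) {\<one>\<^bsub>G Mod D\<^esub>} Xs es"
    and es: "es \<in> set (desc_parts (n - Suc k) (n - Suc k))"
    using Q.exists_basis[OF finQ ordQ] by blast
  have len: "length Xs = length es" using b by (auto simp: basis_modulo_def dest: list_all2_lengthD)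
  define P where "P i y d \<longleftrightarrow> y \<in> carrier G \<and> d \<in> D \<and> y [^] ((2::nat) ^ (es ! i)) = \<one> \<and>
    Xs ! i = D #> (y \<otimes> d)" for i y d
  have ex: "\<exists>y\<in>carrier G. \<exists>d\<in>D. y [^] ((2::nat) ^ (es ! i)) = \<one> \<and> Xs ! i = D #> (y \<otimes> d)"
    if i: "i < length es" for i
  proof -
    let ?e = "es ! i"
    have "Xs ! i \<in> carrier (G Mod D)" using b i len by (auto simp: basis_modulo_def subset_iff)
    then obtain y where y: "y \<in> carrier G" "Xs ! i = D #> y" by (auto simp: carrier_FactGroup)
    have e: "0 < ?e" using b i by (auto simp: basis_modulo_def)
    have "(D #> y) [^]\<^bsub>G Mod D\<^esub> ((2::nat) ^ ?e) = D"
      using b i len y by (auto simp: basis_modulo_def list_all2_conv_all_nth)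
    then have "D #> y [^] ((2::nat) ^ ?e) = D" using D.FactGroup_pow[OF y(1)] by simp
    then have "y [^] ((2::nat) ^ ?e) \<in> D" using rcos_self[OF _ Dsub, of "y [^] ((2::nat) ^ ?e)"] y by simp
    then obtain s :: nat where s: "y [^] ((2::nat) ^ ?e) = c [^] s" using D_elem by blast
    \<comment> \<open>For \<open>c^s \<noteq> 1\<close> let \<open>2^j\<close> be the gcd of
      \<open>s\<close> and the order of \<open>c\<close>. Then \<open>c^(2^j)\<close> is a power of
      \<open>y^(2^e)\<close>, so a power of \<open>y\<close> has \<open>z\<close> as its power of
      exponent \<open>2^(e + k - j)\<close>. Maximality of \<open>k\<close> gives
      \<open>e \<le> j\<close>, and \<open>2^e\<close> divides \<open>s\<close>.\<close>
    have "\<exists>t::nat. c [^] s = c [^] (2 ^ ?e * t)"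
    proof (cases "c [^] s = \<one>")
      case True
      then show ?thesis by (intro exI[of _ 0]) simp
    next
      case False
      have "gcd s (2 ^ Suc k) dvd 2 ^ Suc k" by simp
      then obtain j where j: "j \<le> Suc k" "gcd s (2 ^ Suc k) = 2 ^ j"
        unfolding divides_primepow_nat[OF two_is_prime_nat] by blast
      have "j \<noteq> Suc k"
      proof
        assume "j = Suc k"
        then have "2 ^ Suc k dvd s" using j(2) by (metis gcd_dvd1)
        then obtain r where "s = 2 ^ Suc k * r" by blast
        then have "c [^] s = \<one>" using c c1 nat_pow_pow[OF c(1), of "2 ^ Suc k" r] by simp
        then show False using False by simp
      qed
      then have jk: "j \<le> k" using j by simp
      have "subgroup (generate G {c [^] s}) G" using c by (intro generate_is_subgroup) auto
      then have "c [^] gcd s (2 ^ Suc k) \<in> generate G {c [^] s}"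
        using c c1 by (intro pow_gcd_in_subgroup) (auto intro: generate.incl generate.one)
      then obtain u :: int where u: "c [^] ((2::nat) ^ j) = (c [^] s) [^] u"
        using generate_pow[of "c [^] s"] c j(2) by auto
      have "z = (c [^] ((2::nat) ^ j)) [^] ((2::nat) ^ (k - j))"
        using c jk by (simp add: nat_pow_pow flip: power_add)
      also have "\<dots> = (y [^] u) [^] ((2::nat) ^ (?e + (k - j)))"
        unfolding u s[symmetric] using y(1)
        by (simp add: int_pow_pow power_add mult_ac flip: int_pow_int)
      finally have "K (?e + (k - j))" using y(1) unfolding K_def by (intro bexI[of _ "y [^] u"]) auto
      then have "?e \<le> j" using k_max jk by fastforce
      then have "2 ^ ?e dvd s" using j(2) by (metis dvd_trans gcd_dvd1 le_imp_power_dvd)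
      then show ?thesis by (auto elim: dvdE)
    qed
    then obtain t :: nat where t: "y [^] ((2::nat) ^ ?e) = c [^] (2 ^ ?e * t)" using s by auto
    define y1 where "y1 = y \<otimes> inv (c [^] t)"
    have y1: "y1 \<in> carrier G" "y = y1 \<otimes> c [^] t" using y(1) c by (simp_all add: y1_def m_assoc)
    have inv_pow: "inv (c [^] t) [^] ((2::nat) ^ ?e) = inv (c [^] (2 ^ ?e * t))"
      using c by (simp add: nat_pow_inv nat_pow_pow mult.commute)
    have y1_pow: "y1 [^] ((2::nat) ^ ?e) = (if B y (inv (c [^] t)) \<and> odd (2 ^ ?e choose 2) then z else \<one>)"
      using pow_mult[of y "inv (c [^] t)" "2 ^ ?e"] y(1) c z unfolding y1_def inv_pow t by simp
    show ?thesis
    proof (cases "y1 [^] ((2::nat) ^ ?e) = \<one>")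
      case True
      then show ?thesis using y1 y(2) nat_pow_in_subgroup[OF Dsub cD] by blast
    next
      case False
      then have yz: "y1 [^] ((2::nat) ^ ?e) = z" and "odd ((2::nat) ^ ?e choose 2)"
        using y1_pow by (auto split: if_splits)
      then have "\<not> 2 \<le> ?e" using even_choose_two[of "2 ^ ?e"] pow_4_dvd[of ?e] by blast
      then have e1: "?e = 1" using e by simp
      \<comment> \<open>A square root of \<open>z\<close> in \<open>D\<close>. Since
        \<open>2 \<le> k\<close> it is an even power of \<open>c\<close> and so commutes with
        \<open>y1\<close>; multiplying by it changes the square from \<open>z\<close> to 1 without
        leaving the coset.\<close>
      define c' where "c' = c [^] ((2::nat) ^ (k - 1))"
      have c': "c' \<in> carrier G" "c' \<in> D" using c nat_pow_in_subgroup[OF Dsub cD] by (auto simp: c'_def)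
      have "c' [^] (2::nat) = c [^] ((2::nat) ^ Suc (k - 1))"
        using c by (simp add: c'_def nat_pow_pow mult.commute)
      also have "Suc (k - 1) = k" using k2 by simp
      finally have c'2: "c' [^] (2::nat) = z" using c by simp
      have "\<not> B y1 c'" using k2 c y1 by (simp add: c'_def B_pow_right)
      then have "(y1 \<otimes> c') [^] (2::nat) = \<one>"
        using y1 c' z yz e1 by (simp add: pow_mult_2 c'2)
      moreover have "y = (y1 \<otimes> c') \<otimes> (inv c' \<otimes> c [^] t)"
        using y1 c' c by (simp add: group_word_simps)
      moreover have "inv c' \<otimes> c [^] t \<in> D"
        using c' nat_pow_in_subgroup[OF Dsub cD] by simp
      moreover have "y1 \<otimes> c' \<in> carrier G" using y1(1) c'(1) by simp
      ultimately show ?thesis unfolding y(2) e1 power_one_right by metis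
    qed
  qed
  have "\<exists>y d. i < length es \<longrightarrow> P i y d" for i
    unfolding P_def by (cases "i < length es") (use ex[of i] in blast)+
  then obtain y d where "\<And>i. i < length es \<longrightarrow> P i (y i) (d i)" by metis
  then have yd: "y i \<in> carrier G \<and> d i \<in> D \<and>
      y i [^] ((2::nat) ^ (es ! i)) = \<one> \<and> Xs ! i = D #> (y i \<otimes> d i)" if "i < length es" for i
    using that by (simp add: P_def)
  define ys where "ys = map y [0..<length es]"
  have ysc: "set ys \<subseteq> carrier G" using yd by (auto simp: ys_def)
  have Xs_eq: "Xs ! i = D #> y i" if i: "i < length es" for i
  proof -
    have g: "y i \<in> carrier G" "d i \<in> carrier G" using yd[OF i] D.subset by auto
    have "y i \<otimes> d i = (y i \<otimes> d i \<otimes> inv (y i)) \<otimes> y i" using g by (simp add: group_word_simps)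
    moreover have "y i \<otimes> d i \<otimes> inv (y i) \<in> D" using yd[OF i] D.inv_op_closed2 by blast
    ultimately have "y i \<otimes> d i \<in> D #> y i" by (auto simp: r_coset_def)
    then show ?thesis using yd[OF i] repr_independence[OF _ g(1) Dsub] by simp
  qed
  have "generate G (D \<union> set ys) = carrier G"
  proof (rule generate_coset_lift[OF N ysc])
    have "Xs = map (\<lambda>x. D #> x) ys"
      by (rule nth_equalityI) (simp_all add: ys_def len Xs_eq)
    then have "(\<lambda>x. D #> x) ` set ys = set Xs" by simp
    moreover have "generate (G Mod D) (set Xs) = carrier (G Mod D)"
    proof (rule Q.generate_eqI)
      show "generate (G Mod D) ({\<one>\<^bsub>G Mod D\<^esub>} \<union> set Xs) = carrier (G Mod D)" using b by (simp add: basis_modulo_def)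
      show "set Xs \<subseteq> carrier (G Mod D)" using b by (simp add: basis_modulo_def)
      show "{\<one>\<^bsub>G Mod D\<^esub>} \<union> set Xs \<subseteq> generate (G Mod D) (set Xs)"
        using generate.one[of "G Mod D" "set Xs"] by (auto intro: generate.incl)
    qed
    ultimately show "generate (G Mod D) ((\<lambda>x. D #> x) ` set ys) = carrier (G Mod D)" by simp
  qed
  then have gen: "generate G (insert c (set ys)) = carrier G"
  proof (rule generate_eqI)
    show "insert c (set ys) \<subseteq> carrier G" using c ysc by simp
    have "D \<subseteq> generate G (insert c (set ys))" unfolding D_def by (rule mono_generate) auto
    then show "D \<union> set ys \<subseteq> generate G (insert c (set ys))" by (auto intro: generate.incl)
  qed
  have "list_all2 (\<lambda>y e. y [^] ((2::nat) ^ e) = \<one>) ys es"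
    using yd by (simp add: list_all2_conv_all_nth ys_def)
  from that[OF c(1) k2 c(2) ysc this gen kn es] show thesis .
qed

end

section \<open>Normal forms for the generators\<close>

definition gen_case :: "'a \<Rightarrow> 'a \<Rightarrow> 'a \<Rightarrow> 'a \<Rightarrow> gen \<Rightarrow> 'a" where
  "gen_case a b c d x = (case x of ga \<Rightarrow> a | gb \<Rightarrow> b | gc \<Rightarrow> c | gd \<Rightarrow> d)"

lemma gen_case_simps [simp]:
  "gen_case a b c d ga = a" "gen_case a b c d gb = b" "gen_case a b c d gc = c" "gen_case a b c d gd = d"
  by (simp_all add: gen_case_def)

lemma (in group) iso_pc_to_group:
  assumes "pc_valid d" "pc_order d = order G" "pc_sat (fst d) (fst (snd d)) G f"
  shows "G \<cong> pc_to_group d"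
proof -
  obtain ps cs c w where d: "d = (ps, cs, c, w)" by (cases d) auto
  interpret pc_data ps cs c w using assms(1) by unfold_locales (simp add: d)
  have "pc_group ps cs \<cong> G"
    using assms by (intro iso_pc_group_if_pc_sat(1)[where f = f]) (auto simp: d prod_ord group_axioms)
  then show ?thesis using group.iso_sym[OF group_pc_group] by (simp add: d)
qed

context comm2
begin

lemma pc_satI:
  assumes f: "\<forall>x\<in>fst ` set ps. f x \<in> carrier G"
    and pow: "\<forall>(x, k)\<in>set ps. f x [^] k = \<one>"
    and cs: "\<forall>((x, y), (c, k))\<in>set cs. x \<in> fst ` set ps \<and> y \<in> fst ` set ps \<and> B (f x) (f y) \<and> f c [^] k = z"
    and B: "\<forall>x\<in>fst ` set ps. \<forall>y\<in>fst ` set ps. (x, y) \<notin> fst ` set cs \<longrightarrow> (y, x) \<notin> fst ` set cs \<longrightarrow>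
      \<not> B (f x) (f y)"
    and gen: "generate G (f ` fst ` set ps) = carrier G"
  shows "pc_sat ps cs G f"
proof -
  have "grp_comm G (f x) (f y) = f c [^] k" if "((x, y), (c, k)) \<in> set cs" for x y c k
  proof -
    have *: "x \<in> fst ` set ps \<and> y \<in> fst ` set ps \<and> B (f x) (f y) \<and> f c [^] k = z"
      using bspec[OF cs that] by simp
    then have "f x \<in> carrier G" "f y \<in> carrier G" using f by blast+
    then show ?thesis using * by (simp add: grp_comm_B)
  qed
  then have "\<forall>((x, y), (c, k))\<in>set cs. grp_comm G (f x) (f y) = f c [^] k" by blast
  moreover have "grp_comm G (f x) (f y) = \<one>" if "x \<in> fst ` set ps" "y \<in> fst ` set ps"
    "(x, y) \<notin> fst ` set cs" "(y, x) \<notin> fst ` set cs" for x y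
  proof -
    have "\<not> B (f x) (f y)" using B that by blast
    moreover have "f x \<in> carrier G" "f y \<in> carrier G" using that(1,2) f by blast+
    ultimately show ?thesis by (simp add: grp_comm_B)
  qed
  ultimately show ?thesis unfolding pc_sat_def using f pow gen by blast
qed

section \<open>Changes of generators\<close>

lemma exists_B:
  assumes "S \<subseteq> carrier G" "generate G S = carrier G"
  shows "\<exists>x\<in>S. \<exists>y\<in>S. B x y"
  using comm_groupI_generate[OF assms] not_comm by (auto simp: B_def)

lemma generate_replace:
  assumes "insert x T \<subseteq> carrier G" "generate G (insert x T) = carrier G" "p \<in> generate G T"
  shows "generate G (insert (x \<otimes> p) T) = carrier G"
proof (rule generate_eqI[OF assms(2)])
  have p: "p \<in> carrier G" using assms generate_in_carrier[of T p] by auto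
  show T: "insert (x \<otimes> p) T \<subseteq> carrier G" using assms p by auto
  let ?H = "generate G (insert (x \<otimes> p) T)"
  have H: "subgroup ?H G" by (rule generate_is_subgroup[OF T])
  have "p \<in> ?H" using assms(3) mono_generate[of T "insert (x \<otimes> p) T"] by blast
  moreover have "x \<otimes> p \<in> ?H" by (simp add: generate.incl)
  ultimately have "x \<otimes> p \<otimes> inv p \<in> ?H" using subgroup.m_closed[OF H] subgroup.m_inv_closed[OF H] by blast
  then have "x \<in> ?H" using assms p by (simp add: m_assoc)
  then show "insert x T \<subseteq> ?H" by (auto intro: generate.incl)
qed

text \<open>The form is nondegenerate on the span of \<open>a\<close> and \<open>b\<close>, so every
  \<open>x\<close> can be moved into the orthogonal complement by a product of these two.\<close>

lemma exists_commuting_multiple: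
  assumes "a \<in> carrier G" "b \<in> carrier G" "x \<in> carrier G" "B a b"
  obtains p where "p \<in> {\<one>, a, b, a \<otimes> b}" "\<not> B a (x \<otimes> p)" "\<not> B b (x \<otimes> p)"
proof -
  define p where "p = (if B b x then (if B a x then a \<otimes> b else a) else (if B a x then b else \<one>))"
  have ba: "B b a" using assms by (simp add: B_sym)
  have "p \<in> {\<one>, a, b, a \<otimes> b}" by (simp add: p_def)
  moreover have "\<not> B a (x \<otimes> p)" "\<not> B b (x \<otimes> p)"
    using assms ba by (auto simp: p_def B_mult_right)
  ultimately show thesis by (rule that)
qed

text \<open>The three outcomes differ in which generator commutes with both others:
  \<open>c'\<close>, \<open>b'\<close> or \<open>a\<close>. Divisibility of \<open>2 ^ k\<close> by
  \<open>\<beta>\<close> lets \<open>c\<close> absorb products of \<open>a\<close> and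
  \<open>b\<close> without changing its \<open>2 ^ k\<close>-th power; evenness of
  \<open>\<beta>\<close> lets \<open>b\<close> absorb \<open>a\<close> when the two commute.\<close>

lemma rank3_normal_form:
  assumes G: "a \<in> carrier G" "b \<in> carrier G" "c \<in> carrier G"
    and a: "a [^] (2::nat) = \<one>" and b: "b [^] (\<beta>::nat) = \<one>" "even \<beta>" "\<beta> dvd 2 ^ k"
    and c: "c [^] ((2::nat) ^ k) = z" "2 \<le> k"
    and gen: "generate G {a, b, c} = carrier G"
  obtains b' c' where "b' \<in> carrier G" "c' \<in> carrier G" "b' [^] \<beta> = \<one>" "c' [^] ((2::nat) ^ k) = z"
    "generate G {a, b', c'} = carrier G"
    "B a b' \<and> \<not> B a c' \<and> \<not> B b' c' \<or> \<not> B a b' \<and> B a c' \<and> \<not> B b' c' \<or> \<not> B a b' \<and> \<not> B a c' \<and> B b' c'"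
proof -
  have a_even: "a [^] m = \<one>" if "even m" for m :: nat
    using that a G nat_pow_pow[of a 2] by (auto elim!: evenE)
  have b_dvd: "b [^] m = \<one>" if "\<beta> dvd m" for m :: nat
    using that b G nat_pow_pow[of b \<beta>] by (auto elim!: dvdE)
  have k4: "4 dvd (2::nat) ^ k" using pow_4_dvd c by simp
  then have k2: "even ((2::nat) ^ k)" using c by simp
  show thesis
  proof (cases "B a b")
    case True
    obtain p where p: "p \<in> {\<one>, a, b, a \<otimes> b}" "\<not> B a (c \<otimes> p)" "\<not> B b (c \<otimes> p)"
      using exists_commuting_multiple[OF G True] .
    have pG: "p \<in> carrier G" using p G by auto
    have "p [^] ((2::nat) ^ k) = \<one>"
      using p(1) G pow_mult_4[OF G(1,2) k4] a_even[OF k2] b_dvd[OF b(3)] by auto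
    then have "(c \<otimes> p) [^] ((2::nat) ^ k) = z"
      using pow_mult_4[OF G(3) pG k4] c z by simp
    moreover have "p \<in> generate G {a, b}" using p(1) by (auto intro: generate.one generate.incl generate.eng)
    then have "generate G {c \<otimes> p, a, b} = carrier G"
      using gen G by (intro generate_replace) (auto simp: insert_commute)
    ultimately show thesis
      using that[of b "c \<otimes> p"] G pG b p True by (simp add: insert_commute)
  next
    case ab: False
    then have ba: "\<not> B b a" by (simp add: B_sym)
    show thesis
    proof (cases "B a c")
      case True
      define b' where "b' = b \<otimes> (if B b c then a else \<one>)"
      have b': "b' \<in> carrier G" using G by (simp add: b'_def)
      have "b' [^] \<beta> = \<one>"
        using b a_even[OF b(2)] G pow_mult[OF G(2,1), of \<beta>] ba by (simp add: b'_def)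
      moreover have "\<not> B b' c" "\<not> B a b'"
        using G True ab by (simp_all add: b'_def B_mult_left B_mult_right)
      moreover have "generate G {b', a, c} = carrier G"
        unfolding b'_def using gen G
        by (intro generate_replace) (auto simp: insert_commute intro: generate.one generate.incl)
      ultimately show thesis using that[of b' c] b' G c True by (simp add: insert_commute)
    next
      case False
      have "B b c" using exists_B[OF _ gen] G ab False by (auto simp: B_sym)
      then show thesis using that[of b c] G b c gen ab False by simp
    qed
  qed
qed

text \<open>The hyperbolic plane of \<open>a\<close> and \<open>b\<close> is split off by moving
  \<open>x\<close> and \<open>d\<close> into its orthogonal complement.\<close>

lemma rank4_normal_form_aux:
  assumes G: "a \<in> carrier G" "b \<in> carrier G" "x \<in> carrier G" "d \<in> carrier G"
    and sq: "a [^] (2::nat) = \<one>" "b [^] (2::nat) = \<one>" "x [^] (2::nat) = \<one>" and d: "d [^] (4::nat) = z"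
    and gen: "generate G {a, b, x, d} = carrier G" and ab: "B a b"
  obtains c d' where "c \<in> carrier G" "d' \<in> carrier G" "c [^] (2::nat) = \<one>" "d' [^] (4::nat) = z"
    "generate G {a, b, c, d'} = carrier G" "\<not> B a c" "\<not> B b c" "\<not> B a d'" "\<not> B b d'"
proof -
  have a4: "a [^] (4::nat) = \<one>" "b [^] (4::nat) = \<one>"
  proof -
    have "a [^] (4::nat) = (a [^] (2::nat)) [^] (2::nat)" "b [^] (4::nat) = (b [^] (2::nat)) [^] (2::nat)"
      using G by (simp_all add: nat_pow_pow)
    then show "a [^] (4::nat) = \<one>" "b [^] (4::nat) = \<one>" by (simp_all only: sq nat_pow_one)
  qed
  obtain p where p: "p \<in> {\<one>, a, b, a \<otimes> b}" "\<not> B a (x \<otimes> p)" "\<not> B b (x \<otimes> p)"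
    using exists_commuting_multiple[OF G(1,2,3) ab] .
  obtain q where q: "q \<in> {\<one>, a, b, a \<otimes> b}" "\<not> B a (d \<otimes> q)" "\<not> B b (d \<otimes> q)"
    using exists_commuting_multiple[OF G(1,2,4) ab] .
  have pq: "p \<in> carrier G" "q \<in> carrier G" using p q G by auto
  have "q [^] (4::nat) = \<one>"
    using q(1) G pow_mult_4[OF G(1,2), of 4] a4 by auto
  then have d': "(d \<otimes> q) [^] (4::nat) = z" using pow_mult_4[OF G(4) pq(2), of 4] d z by simp
  have gen1: "generate G {d \<otimes> q, a, b, x} = carrier G"
    using gen G q(1) by (intro generate_replace)
      (auto simp: insert_commute intro: generate.one generate.incl generate.eng)
  \<comment> \<open>Moving \<open>x\<close> may have turned its square into \<open>z\<close>. The
    element \<open>(d q)^2\<close> is a square, hence commutes with everything, and its own square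
    is \<open>z\<close>; multiplying by it restores an involution.\<close>
  define c where "c = x \<otimes> (p \<otimes> (if (x \<otimes> p) [^] (2::nat) = \<one> then \<one> else (d \<otimes> q) [^] (2::nat)))"
  have c_alt: "c = (x \<otimes> p) \<otimes> (if (x \<otimes> p) [^] (2::nat) = \<one> then \<one> else (d \<otimes> q) [^] (2::nat))"
    using G pq by (simp add: c_def m_assoc)
  have cG: "c \<in> carrier G" using G pq by (simp add: c_def)
  have gen2: "generate G {c, d \<otimes> q, a, b} = carrier G"
    unfolding c_def
  proof (rule generate_replace)
    show "insert x {d \<otimes> q, a, b} \<subseteq> carrier G" using G pq by auto
    show "generate G (insert x {d \<otimes> q, a, b}) = carrier G" using gen1 by (simp add: insert_commute)
    have H: "subgroup (generate G {d \<otimes> q, a, b}) G" using G pq by (intro generate_is_subgroup) auto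
    have "(d \<otimes> q) [^] (2::nat) \<in> generate G {d \<otimes> q, a, b}"
      by (intro nat_pow_in_subgroup[OF H] generate.incl) auto
    then show "p \<otimes> (if (x \<otimes> p) [^] (2::nat) = \<one> then \<one> else (d \<otimes> q) [^] (2::nat))
        \<in> generate G {d \<otimes> q, a, b}"
      using p(1) by (intro generate.eng) (auto intro: generate.one generate.incl generate.eng)
  qed
  have "(x \<otimes> p) [^] (2::nat) \<in> {\<one>, z}"
  proof -
    have "p [^] (2::nat) \<in> {\<one>, z}" using p(1) sq G z by (auto simp: pow_mult_2)
    then show ?thesis using pow_mult_2[OF G(3) pq(1)] sq z by auto
  qed
  moreover have "((d \<otimes> q) [^] (2::nat)) [^] (2::nat) = z" using d' G pq by (simp add: nat_pow_pow)
  moreover have "\<not> B (x \<otimes> p) ((d \<otimes> q) [^] (2::nat))" using G pq by (simp add: B_pow_right)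
  ultimately have "c [^] (2::nat) = \<one>"
    using G pq z unfolding c_alt by (auto simp: pow_mult_2)
  moreover have "\<not> B a c" "\<not> B b c"
    unfolding c_alt using G pq p by (auto simp: B_mult_right B_pow_right)
  ultimately show thesis
    using that[of c "d \<otimes> q"] cG G pq d' q gen2 by (simp add: insert_commute)
qed

text \<open>If two of the involutions do not commute, their plane is split off. Otherwise one
  involution fails to commute with \<open>d\<close>, and the other two are multiplied by it where
  necessary so that they commute with \<open>d\<close>.\<close>

lemma rank4_normal_form:
  assumes G: "a1 \<in> carrier G" "a2 \<in> carrier G" "a3 \<in> carrier G" "d \<in> carrier G"
    and sq: "a1 [^] (2::nat) = \<one>" "a2 [^] (2::nat) = \<one>" "a3 [^] (2::nat) = \<one>" and d: "d [^] (4::nat) = z"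
    and gen: "generate G {a1, a2, a3, d} = carrier G"
  obtains a b c d' where "{a, b, c, d'} \<subseteq> carrier G"
    "a [^] (2::nat) = \<one>" "b [^] (2::nat) = \<one>" "c [^] (2::nat) = \<one>" "d' [^] (4::nat) = z"
    "generate G {a, b, c, d'} = carrier G" "\<not> B a c" "\<not> B b c" "\<not> B b d'"
    "B a b \<and> \<not> B a d' \<or> \<not> B a b \<and> B a d' \<and> \<not> B c d'"
proof -
  note goal = that
  have noncomm: thesis if x123: "{x1, x2, x3} = {a1, a2, a3}" and x12: "B x1 x2" for x1 x2 x3
  proof -
    have x: "x1 \<in> {a1, a2, a3}" "x2 \<in> {a1, a2, a3}" "x3 \<in> {a1, a2, a3}" using x123 by blast+
    have "{x1, x2, x3, d} = {a1, a2, a3, d}" using x123 by blast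
    then have g: "generate G {x1, x2, x3, d} = carrier G" using gen by simp
    have xG: "x1 \<in> carrier G" "x2 \<in> carrier G" "x3 \<in> carrier G"
      and xs: "x1 [^] (2::nat) = \<one>" "x2 [^] (2::nat) = \<one>" "x3 [^] (2::nat) = \<one>"
      using x G sq by auto
    obtain c d' where "c \<in> carrier G" "d' \<in> carrier G" "c [^] (2::nat) = \<one>" "d' [^] (4::nat) = z"
      "generate G {x1, x2, c, d'} = carrier G" "\<not> B x1 c" "\<not> B x2 c" "\<not> B x1 d'" "\<not> B x2 d'"
      using rank4_normal_form_aux[OF xG G(4) xs d g x12] by metis
    then show thesis using x12 xG xs goal[of x1 x2 c d'] by simp
  qed
  have comm: thesis if x: "{x1, x2, x3} = {a1, a2, a3}" "B x1 d"
    and n: "\<not> B a1 a2" "\<not> B a1 a3" "\<not> B a2 a3" for x1 x2 x3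
  proof -
    have x': "x1 \<in> {a1, a2, a3}" "x2 \<in> {a1, a2, a3}" "x3 \<in> {a1, a2, a3}" using x(1) by blast+
    have xG: "x1 \<in> carrier G" "x2 \<in> carrier G" "x3 \<in> carrier G"
      and xs: "x1 [^] (2::nat) = \<one>" "x2 [^] (2::nat) = \<one>" "x3 [^] (2::nat) = \<one>"
      using x' G sq by auto
    have nx: "\<not> B u v" if "u \<in> {x1, x2, x3}" "v \<in> {x1, x2, x3}" for u v
      using that n unfolding x(1) by (auto simp: B_sym)
    define b where "b = x2 \<otimes> (if B x2 d then x1 else \<one>)"
    define c where "c = x3 \<otimes> (if B x3 d then x1 else \<one>)"
    have bc: "b \<in> carrier G" "c \<in> carrier G" using xG by (auto simp: b_def c_def)
    have sq: "b [^] (2::nat) = \<one>" "c [^] (2::nat) = \<one>"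
      using xG xs nx by (auto simp: b_def c_def pow_mult_2)
    have B: "\<not> B b d" "\<not> B c d" "\<not> B x1 b" "\<not> B x1 c" "\<not> B b c"
      using xG G x(2) nx by (auto simp: b_def c_def B_mult_left B_mult_right)
    have "{x2, x1, x3, d} = {a1, a2, a3, d}" using x(1) by blast
    then have "generate G {x2, x1, x3, d} = carrier G" using gen by simp
    then have "generate G {b, x1, x3, d} = carrier G"
      unfolding b_def using xG G by (intro generate_replace) (auto intro: generate.one generate.incl)
    then have "generate G {x3, x1, b, d} = carrier G" by (simp add: insert_commute)
    then have "generate G {c, x1, b, d} = carrier G"
      unfolding c_def using xG G bc by (intro generate_replace) (auto intro: generate.one generate.incl)
    then show thesis
      using goal[of x1 b c d] bc xG G xs sq d B x(2) by (simp add: insert_commute)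
  qed
  consider "B a1 a2" | "B a1 a3" | "B a2 a3" | "\<not> B a1 a2" "\<not> B a1 a3" "\<not> B a2 a3" by blast
  then show thesis
  proof cases
    case 1 then show thesis by (intro noncomm[of a1 a2 a3]) auto
  next
    case 2 then show thesis by (intro noncomm[of a1 a3 a2]) auto
  next
    case 3 then show thesis by (intro noncomm[of a2 a3 a1]) auto
  next
    case 4
    obtain u v where "u \<in> {a1, a2, a3, d}" "v \<in> {a1, a2, a3, d}" "B u v" using exists_B[OF _ gen] G by auto
    then consider "B a1 d" | "B a2 d" | "B a3 d" using 4 by (auto simp: B_sym)
    then show thesis
    proof cases
      case 1 then show thesis using 4 by (intro comm[of a1 a2 a3]) auto
    next
      case 2 then show thesis using 4 by (intro comm[of a2 a1 a3]) auto
    next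
      case 3 then show thesis using 4 by (intro comm[of a3 a1 a2]) auto
    qed
  qed
qed

section \<open>From normal forms to the listed presentations\<close>

lemma rank2_pc_sat:
  assumes "c \<in> carrier G" "c [^] ((2::nat) ^ k) = z" "y \<in> carrier G" "y [^] \<beta> = \<one>"
    "generate G {c, y} = carrier G"
  shows "pc_sat [(ga, 2 ^ Suc k), (gb, \<beta>)] [((ga, gb), (ga, 2 ^ k))] G (gen_case c y \<one> \<one>)"
proof -
  have "B c y" using exists_B[OF _ assms(5)] assms by (auto simp: B_sym)
  then show ?thesis
    using assms pow_z_pow[OF assms(2,1)] by (intro pc_satI) (simp_all add: B_sym[of y c])
qed

text \<open>For \<open>\<beta> = 2\<close> the generators \<open>a\<close> and \<open>b\<close> have
  the same order and may be exchanged, which turns the case of noncommuting \<open>b'\<close> and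
  \<open>c'\<close> into that of \<open>a\<close> and \<open>c'\<close>.\<close>

lemma rank3_pc_sat:
  assumes G: "a \<in> carrier G" "b \<in> carrier G" "c \<in> carrier G"
    and a: "a [^] (2::nat) = \<one>" and b: "b [^] (\<beta>::nat) = \<one>" "even \<beta>" "\<beta> dvd 2 ^ k"
    and c: "c [^] ((2::nat) ^ k) = z" "2 \<le> k"
    and gen: "generate G {a, b, c} = carrier G"
  obtains f p where "p \<in> {(ga, gb), (ga, gc), (gb, gc)}"
    "pc_sat [(ga, 2), (gb, \<beta>), (gc, 2 ^ Suc k)] [(p, (gc, 2 ^ k))] G f" "\<beta> = 2 \<Longrightarrow> p \<noteq> (gb, gc)"
proof -
  obtain b' c' where bc: "b' \<in> carrier G" "c' \<in> carrier G" "b' [^] \<beta> = \<one>" "c' [^] ((2::nat) ^ k) = z"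
    "generate G {a, b', c'} = carrier G" and B:
    "B a b' \<and> \<not> B a c' \<and> \<not> B b' c' \<or> \<not> B a b' \<and> B a c' \<and> \<not> B b' c' \<or> \<not> B a b' \<and> \<not> B a c' \<and> B b' c'"
    using rank3_normal_form[OF assms] by metis
  note c1 = pow_z_pow[OF bc(4,2)]
  note sym = B_sym[of b' a] B_sym[of c' a] B_sym[of c' b']
  from B consider "B a b'" "\<not> B a c'" "\<not> B b' c'" | "\<not> B a b'" "B a c'" "\<not> B b' c'"
    | "\<not> B a b'" "\<not> B a c'" "B b' c'" "\<beta> \<noteq> 2" | "\<not> B a b'" "\<not> B a c'" "B b' c'" "\<beta> = 2"
    by blast
  then show thesis
  proof cases
    case 1
    then have "pc_sat [(ga, 2), (gb, \<beta>), (gc, 2 ^ Suc k)] [((ga, gb), (gc, 2 ^ k))] G (gen_case a b' c' \<one>)"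
      using G a bc c1 by (intro pc_satI) (simp_all add: sym)
    then show thesis by (rule that[rotated]) auto
  next
    case 2
    then have "pc_sat [(ga, 2), (gb, \<beta>), (gc, 2 ^ Suc k)] [((ga, gc), (gc, 2 ^ k))] G (gen_case a b' c' \<one>)"
      using G a bc c1 by (intro pc_satI) (simp_all add: sym)
    then show thesis by (rule that[rotated]) auto
  next
    case 3
    then have "pc_sat [(ga, 2), (gb, \<beta>), (gc, 2 ^ Suc k)] [((gb, gc), (gc, 2 ^ k))] G (gen_case a b' c' \<one>)"
      using G a bc c1 by (intro pc_satI) (simp_all add: sym)
    then show thesis using 3 by (intro that[rotated]) auto
  next
    case 4
    have "generate G {b', a, c'} = carrier G" using bc by (simp add: insert_commute)
    with 4 have "pc_sat [(ga, 2), (gb, \<beta>), (gc, 2 ^ Suc k)] [((ga, gc), (gc, 2 ^ k))] G (gen_case b' a c' \<one>)"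
      using G a bc c1 by (intro pc_satI) (simp_all add: sym)
    then show thesis by (rule that[rotated]) auto
  qed
qed

lemma rank4_pc_sat:
  assumes G: "a1 \<in> carrier G" "a2 \<in> carrier G" "a3 \<in> carrier G" "d \<in> carrier G"
    and sq: "a1 [^] (2::nat) = \<one>" "a2 [^] (2::nat) = \<one>" "a3 [^] (2::nat) = \<one>" and d: "d [^] (4::nat) = z"
    and gen: "generate G {a1, a2, a3, d} = carrier G"
  obtains f cs where "cs \<in> {[((ga, gb), (gd, 4))], [((ga, gd), (gd, 4))], [((ga, gb), (gd, 4)), ((gc, gd), (gd, 4))]}"
    "pc_sat [(ga, 2), (gb, 2), (gc, 2), (gd, 8)] cs G f"
proof -
  obtain a b c d' where G': "{a, b, c, d'} \<subseteq> carrier G" and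
    p: "a [^] (2::nat) = \<one>" "b [^] (2::nat) = \<one>" "c [^] (2::nat) = \<one>" "d' [^] (4::nat) = z" and
    gen': "generate G {a, b, c, d'} = carrier G" and n: "\<not> B a c" "\<not> B b c" "\<not> B b d'" and
    B: "B a b \<and> \<not> B a d' \<or> \<not> B a b \<and> B a d' \<and> \<not> B c d'"
    using rank4_normal_form[OF assms] by metis
  have d8: "d' [^] (8::nat) = \<one>" using pow_z_pow[of d' 2] p G' by simp
  note sym = B_sym[of b a] B_sym[of c a] B_sym[of d' a] B_sym[of c b] B_sym[of d' b] B_sym[of d' c]
  let ?f = "gen_case a b c d'" and ?ps = "[(ga, 2), (gb, 2), (gc, 2), (gd, 8)]"
  from B consider "B a b" "\<not> B a d'" "\<not> B c d'" | "B a b" "\<not> B a d'" "B c d'" | "\<not> B a b" "B a d'" "\<not> B c d'"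
    by blast
  then show thesis
  proof cases
    case 1
    then have "pc_sat ?ps [((ga, gb), (gd, 4))] G ?f"
      using G' p gen' n d8 by (intro pc_satI) (simp_all add: sym)
    then show thesis by (rule that[rotated]) auto
  next
    case 2
    then have "pc_sat ?ps [((ga, gb), (gd, 4)), ((gc, gd), (gd, 4))] G ?f"
      using G' p gen' n d8 by (intro pc_satI) (simp_all add: sym)
    then show thesis by (rule that[rotated]) auto
  next
    case 3
    then have "pc_sat ?ps [((ga, gd), (gd, 4))] G ?f"
      using G' p gen' n d8 by (intro pc_satI) (simp_all add: sym)
    then show thesis by (rule that[rotated]) auto
  qed
qed

end

section \<open>Reduction to commutator subgroups of order two\<close>

lemma (in group) mult_commutes:
  assumes "a \<in> carrier G" "b \<in> carrier G" "g \<in> carrier G" "a \<otimes> g = g \<otimes> a" "b \<otimes> g = g \<otimes> b"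
  shows "a \<otimes> b \<otimes> g = g \<otimes> (a \<otimes> b)"
proof -
  have "a \<otimes> b \<otimes> g = a \<otimes> (g \<otimes> b)" using assms(1-3) by (simp add: m_assoc assms(5))
  also have "\<dots> = (g \<otimes> a) \<otimes> b" using assms(1-3) by (simp add: assms(4) flip: m_assoc)
  finally show ?thesis using assms(1-3) by (simp add: m_assoc)
qed

lemma (in group) not_comm_groupE:
  assumes "\<not> comm_group G"
  obtains x y where "x \<in> carrier G" "y \<in> carrier G" "grp_comm G x y \<noteq> \<one>"
  using group_comm_groupI assms grp_comm_eq_one_iff by blast

lemma (in group) subgroup_comm_subgroup: "subgroup (comm_subgroup G (carrier G) (carrier G)) G"
  unfolding comm_subgroup_def by (intro generate_is_subgroup) auto

lemma (in group) grp_comm_in_comm_subgroup: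
  "x \<in> A \<Longrightarrow> y \<in> B \<Longrightarrow> grp_comm G x y \<in> comm_subgroup G A B"
  unfolding comm_subgroup_def by (rule generate.incl) blast

text \<open>Take the first \<open>H i\<close> that meets \<open>[G, G]\<close> nontrivially and
  \<open>x\<close> in the intersection. The commutators of \<open>x\<close> lie in
  \<open>H (i - 1)\<close> and in \<open>[G, G]\<close>, so they are trivial by minimality. Thus
  \<open>x\<close> is central, and a power of it is an involution.\<close>

lemma (in group) exists_central_involution:
  assumes pn: "powerfully_nilpotent G" and nc: "\<not> comm_group G"
  obtains u where "u \<in> comm_subgroup G (carrier G) (carrier G)" "u \<in> carrier G" "u \<noteq> \<one>" "u \<otimes> u = \<one>"
    "\<And>g. g \<in> carrier G \<Longrightarrow> u \<otimes> g = g \<otimes> u"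
proof -
  let ?K = "comm_subgroup G (carrier G) (carrier G)"
  have K: "subgroup ?K G" by (rule subgroup_comm_subgroup)
  obtain n H where chain: "pn_chain G n H" using pn by (auto simp: powerfully_nilpotent_iff)
  define P where "P i \<longleftrightarrow> i \<le> n \<and> (\<exists>x\<in>H i \<inter> ?K. x \<noteq> \<one>)" for i
  obtain a b where ab: "a \<in> carrier G" "b \<in> carrier G" "grp_comm G a b \<noteq> \<one>"
    using not_comm_groupE[OF nc] .
  then have "P n" using chain grp_comm_in_comm_subgroup[OF ab(1,2)] by (auto simp: P_def pn_chain_def)
  define i where "i = (LEAST i. P i)"
  have Pi: "P i" unfolding i_def using \<open>P n\<close> by (rule LeastI)
  have not_P: "\<not> P j" if "j < i" for j using not_less_Least that by (auto simp: i_def)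
  have "i \<noteq> 0" using Pi chain by (auto simp: P_def pn_chain_def)
  then have i: "i \<in> {1..n}" "i - 1 < i" "i - 1 \<le> n" using Pi by (auto simp: P_def)
  obtain x where x: "x \<in> H i" "x \<in> ?K" "x \<noteq> \<one>" using Pi by (auto simp: P_def)
  have xG: "x \<in> carrier G" using subgroup.mem_carrier[OF K x(2)] .
  have sub: "subgroup (H (i - 1)) G" using chain i by (simp add: pn_chain_def)
  have cen: "x \<otimes> g = g \<otimes> x" if g: "g \<in> carrier G" for g
  proof -
    have "power_subgroup G (H (i - 1)) 2 \<subseteq> H (i - 1)"
      unfolding power_subgroup_def using nat_pow_in_subgroup[OF sub]
      by (intro generate_subgroup_incl[OF _ sub]) auto
    moreover have "grp_comm G x g \<in> power_subgroup G (H (i - 1)) 2"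
      using chain i grp_comm_in_comm_subgroup[OF x(1) g] unfolding pn_chain_def by blast
    ultimately have "grp_comm G x g \<in> H (i - 1) \<inter> ?K"
      using grp_comm_in_comm_subgroup[OF xG g] by blast
    then have "grp_comm G x g = \<one>" using not_P[OF i(2)] i(3) by (auto simp: P_def)
    then show ?thesis using xG g by (simp add: grp_comm_eq_one_iff)
  qed
  obtain m where m: "order G = 2 ^ m" using powerfully_nilpotentD(3)[OF pn] by blast
  define j where "j = (LEAST j. x [^] ((2::nat) ^ j) = \<one>)"
  have "x [^] ((2::nat) ^ m) = \<one>" using pow_order_eq_1[OF xG] m by simp
  then have j: "x [^] ((2::nat) ^ j) = \<one>" unfolding j_def by (rule LeastI)
  then have j0: "j \<noteq> 0" using x(3) xG by (metis nat_pow_eone power_0)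
  define u where "u = x [^] ((2::nat) ^ (j - 1))"
  have "u \<noteq> \<one>" unfolding u_def using not_less_Least[of "j - 1" "\<lambda>j. x [^] ((2::nat) ^ j) = \<one>"] j0
    by (auto simp: j_def[symmetric])
  moreover have "u \<otimes> u = x [^] ((2::nat) ^ Suc (j - 1))" using xG by (simp add: u_def nat_pow_mult mult_2)
  then have "u \<otimes> u = \<one>" using j j0 by simp
  moreover have "u \<in> ?K" unfolding u_def by (rule nat_pow_in_subgroup[OF K x(2)])
  moreover have uG: "u \<in> carrier G" using xG by (simp add: u_def)
  moreover have "u \<otimes> g = g \<otimes> u" if g: "g \<in> carrier G" for g
  proof -
    have "grp_comm G x g = \<one>" using cen[OF g] xG g by (simp add: grp_comm_eq_one_iff)
    then have "grp_comm G u g = \<one>" using grp_comm_nat_pow[OF xG g] xG by (simp add: u_def)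
    then show ?thesis using uG g by (simp add: grp_comm_eq_one_iff)
  qed
  ultimately show thesis using that by blast
qed

lemma (in group) central_involution_normal:
  assumes "u \<in> carrier G" "u \<otimes> u = \<one>" "\<And>g. g \<in> carrier G \<Longrightarrow> u \<otimes> g = g \<otimes> u"
  shows "{\<one>, u} \<lhd> G"
proof (rule normal_invI)
  have "inv u = u" using assms(1,2) by (intro inv_equality) auto
  then show "subgroup {\<one>, u} G" using assms(1,2) by (intro subgroupI) auto
  fix x h assume x: "x \<in> carrier G" and h: "h \<in> {\<one>, u}"
  have "x \<otimes> h \<otimes> inv x = h" using x h assms(1) assms(3)[OF x, symmetric] by (auto simp: m_assoc)
  then show "x \<otimes> h \<otimes> inv x \<in> {\<one>, u}" using h by simp
qed

lemma (in group) pow_mult_4_if_comm_sq: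
  assumes "x \<in> carrier G" "y \<in> carrier G" "grp_comm G y x \<otimes> grp_comm G y x = \<one>"
    and "\<And>g. g \<in> carrier G \<Longrightarrow> grp_comm G y x \<otimes> g = g \<otimes> grp_comm G y x"
  shows "(x \<otimes> y) [^] (4::nat) = x [^] (4::nat) \<otimes> y [^] (4::nat)"
proof -
  let ?d = "grp_comm G y x"
  have "?d [^] (6::nat) = (?d [^] (2::nat)) [^] (3::nat)" using assms(1,2) by (simp add: nat_pow_pow)
  also have "?d [^] (2::nat) = \<one>" using assms(1-3) by (simp add: numeral_2_eq_2)
  finally have "?d [^] (4 choose 2 :: nat) = \<one>" by (simp add: choose_two)
  then show ?thesis
    using pow_mult_class2[OF assms(1,2) HOL.refl assms(4)[OF assms(1)] assms(4)[OF assms(2)], of 4] assms(1,2)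
    by simp
qed

text \<open>Fourth powering is a homomorphism by assumption, so the elements with fourth power in
  \<open>D\<close> form a subgroup and it suffices to test generators.\<close>

lemma (in group) power_subgroup_4_subset:
  assumes D: "subgroup D G" and S: "S \<subseteq> carrier G" "generate G S = carrier G"
    and m: "\<And>x y. x \<in> carrier G \<Longrightarrow> y \<in> carrier G \<Longrightarrow> (x \<otimes> y) [^] (4::nat) = x [^] (4::nat) \<otimes> y [^] (4::nat)"
    and g: "\<And>s. s \<in> S \<Longrightarrow> s [^] (4::nat) \<in> D"
  shows "power_subgroup G (carrier G) 4 \<subseteq> D"
proof -
  have "subgroup {x \<in> carrier G. x [^] (4::nat) \<in> D} G"
  proof (rule subgroupI)
    have "\<one> \<in> {x \<in> carrier G. x [^] (4::nat) \<in> D}" using subgroup.one_closed[OF D] by simp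
    then show "{x \<in> carrier G. x [^] (4::nat) \<in> D} \<noteq> {}" by blast
  qed (use D in \<open>auto simp: m nat_pow_inv subgroup.m_inv_closed subgroup.m_closed\<close>)
  then have "generate G S \<subseteq> {x \<in> carrier G. x [^] (4::nat) \<in> D}"
    using S(1) g by (intro generate_subgroup_incl) auto
  then show ?thesis unfolding power_subgroup_def using S(2)
    by (intro generate_subgroup_incl[OF _ D]) auto
qed

text \<open>Fourth powering is a homomorphism here, so the set of fourth powers is already a
  subgroup. Membership of \<open>u\<close> in \<open>G^4\<close> therefore gives a single element
  with fourth power \<open>u\<close>.\<close>

lemma (in group) comm2I:
  assumes pn: "powerfully_nilpotent G" and nc: "\<not> comm_group G" and ord: "order G = 2 ^ n"
    and u: "u \<in> carrier G" "u \<otimes> u = \<one>" "\<And>g. g \<in> carrier G \<Longrightarrow> u \<otimes> g = g \<otimes> u"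
    and comm: "\<And>x y. x \<in> carrier G \<Longrightarrow> y \<in> carrier G \<Longrightarrow> grp_comm G x y \<in> {\<one>, u}"
  shows "comm2 G u n"
proof -
  obtain a b where ab: "a \<in> carrier G" "b \<in> carrier G" "grp_comm G a b \<noteq> \<one>"
    using not_comm_groupE[OF nc] .
  then have uab: "u = grp_comm G a b" "u \<noteq> \<one>" using comm by auto
  have m4: "(x \<otimes> y) [^] (4::nat) = x [^] (4::nat) \<otimes> y [^] (4::nat)"
    if xy: "x \<in> carrier G" "y \<in> carrier G" for x y
  proof (rule pow_mult_4_if_comm_sq[OF xy])
    have d: "grp_comm G y x \<in> {\<one>, u}" using comm xy by blast
    then show "grp_comm G y x \<otimes> grp_comm G y x = \<one>" using u(1,2) by auto
    show "grp_comm G y x \<otimes> g = g \<otimes> grp_comm G y x" if "g \<in> carrier G" for g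
      using d u(3)[OF that] that by auto
  qed
  define D where "D = (\<lambda>x. x [^] (4::nat)) ` carrier G"
  have "subgroup D G"
  proof (rule subgroupI)
    fix x y assume "x \<in> D" "y \<in> D"
    then obtain a b where "a \<in> carrier G" "b \<in> carrier G" "x = a [^] (4::nat)" "y = b [^] (4::nat)"
      by (auto simp: D_def)
    then show "inv x \<in> D" "x \<otimes> y \<in> D"
      unfolding D_def by (auto simp: m4[symmetric] nat_pow_inv[symmetric] intro!: imageI)
  qed (auto simp: D_def)
  then have "power_subgroup G (carrier G) 4 \<subseteq> D"
    by (rule power_subgroup_4_subset[of D "carrier G"])
      (auto simp: m4 D_def generate_incl intro: generate.incl subsetD[OF generate_incl])
  moreover have "u \<in> power_subgroup G (carrier G) 4"
    using powerfully_nilpotentD(4)[OF pn] grp_comm_in_comm_subgroup[OF ab(1,2)] uab(1) by blast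
  ultimately have "\<exists>g\<in>carrier G. g [^] (4::nat) = u" by (auto simp: D_def)
  then show ?thesis
    by unfold_locales (assumption | rule u(1) uab(2) u(2) u(3) comm nc ord | fact)+
qed

text \<open>If \<open>u\<close> is a central involution in the commutator subgroup, the structure of \<open>G / \<langle>u\<rangle>\<close> is known. Unless it is \<open>C\<^sub>8 \<rtimes> C\<^sub>4\<close>, all fourth powers lie in
  a cyclic group \<open>\<langle>c\<rangle>\<close> that would have to contain two different involutions.\<close>

lemma (in group) comm2_or_exceptional:
  assumes pn: "powerfully_nilpotent G" and nc: "\<not> comm_group G" and ord: "order G = 2 ^ Suc m"
    and m: "Suc m \<le> 6"
    and IH: "\<And>H :: 'a set monoid. powerfully_nilpotent H \<Longrightarrow> \<not> comm_group H \<Longrightarrow> order H = 2 ^ m \<Longrightarrow>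
      \<exists>z. comm2 H z m"
  shows "(\<exists>z. comm2 G z (Suc m)) \<or>
    Suc m = 6 \<and> (\<exists>f. pc_sat [(ga, 16), (gb, 4)] [((ga, gb), (ga, 4))] G f)"
proof -
  obtain u where uK: "u \<in> comm_subgroup G (carrier G) (carrier G)" and u: "u \<in> carrier G" "u \<noteq> \<one>"
    "u \<otimes> u = \<one>" "\<And>g. g \<in> carrier G \<Longrightarrow> u \<otimes> g = g \<otimes> u"
    using exists_central_involution[OF pn nc] by blast
  define N where "N = {\<one>, u}"
  have Nn: "N \<lhd> G" unfolding N_def by (rule central_involution_normal[OF u(1,3,4)])
  interpret N: normal N G by (rule Nn)
  interpret h: group_hom G "G Mod N" "\<lambda>x. N #> x"
    using N.r_coset_hom_Mod N.factorgroup_is_group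
    by (simp add: group_hom_def group_hom_axioms_def group_axioms)
  have im: "(\<lambda>x. N #> x) ` carrier G = carrier (G Mod N)" by (simp add: carrier_FactGroup)
  have pnH: "powerfully_nilpotent (G Mod N)"
    by (rule powerfully_nilpotent_hom_image[OF pn N.factorgroup_is_group N.r_coset_hom_Mod im])
  have "card N = 2" using u(2) by (auto simp: N_def card_insert_if)
  then have ordH: "order (G Mod N) = 2 ^ m"
    using lagrange[OF N.subgroup_axioms] ord by (simp add: order_def FactGroup_def)
  have mem_N: "N #> x = N \<longleftrightarrow> x \<in> N" if "x \<in> carrier G" for x
    using that rcos_self[OF that N.subgroup_axioms] coset_join2[OF that N.subgroup_axioms] by metis
  show ?thesis
  proof (cases "comm_group (G Mod N)")
    case True
    then have "comm2 G u (Suc m)"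
      using comm_group_Mod_iff[OF Nn] by (intro comm2I[OF pn nc ord u(1,3,4)]) (auto simp: N_def)
    then show ?thesis by blast
  next
    case ncH: False
    obtain z where "comm2 (G Mod N) z m" using IH[OF pnH ncH ordH] by blast
    then interpret H: comm2 "G Mod N" z m .
    obtain c' k ys' es where c'G: "c' \<in> carrier (G Mod N)" and k2: "2 \<le> k"
      and c'k: "c' [^]\<^bsub>G Mod N\<^esub> ((2::nat) ^ k) = z" and ys': "set ys' \<subseteq> carrier (G Mod N)"
      "list_all2 (\<lambda>y e. y [^]\<^bsub>G Mod N\<^esub> ((2::nat) ^ e) = \<one>\<^bsub>G Mod N\<^esub>) ys' es"
      and genH: "generate (G Mod N) (insert c' (set ys')) = carrier (G Mod N)" and km: "k < m"
      and es: "es \<in> set (desc_parts (m - Suc k) (m - Suc k))"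
      by (rule H.exists_pure_cyclic_basis)
    note c' = c'G c'k and k = k2 km
    obtain c where c: "c \<in> carrier G" "c' = N #> c" using c'(1) by (auto simp: carrier_FactGroup)
    have "ys' \<in> lists ((\<lambda>x. N #> x) ` carrier G)" using ys'(1) im by auto
    then obtain ys where ys: "set ys \<subseteq> carrier G" "ys' = map (\<lambda>x. N #> x) ys"
      unfolding lists_image by auto
    have ys_pow: "list_all2 (\<lambda>y e. y [^] ((2::nat) ^ e) \<in> N) ys es"
      unfolding list_all2_conv_all_nth
    proof (intro conjI allI impI)
      show "length ys = length es" using list_all2_lengthD[OF ys'(2)] by (simp add: ys(2))
      fix i assume i: "i < length ys"
      then have yG: "ys ! i \<in> carrier G" using ys(1) by auto
      have "(N #> ys ! i) [^]\<^bsub>G Mod N\<^esub> ((2::nat) ^ (es ! i)) = N"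
        using ys'(2) i by (simp add: ys(2) list_all2_conv_all_nth)
      then show "ys ! i [^] ((2::nat) ^ (es ! i)) \<in> N"
        using mem_N yG by (simp add: N.FactGroup_pow)
    qed
    define q where "q = c [^] ((2::nat) ^ k)"
    have qG: "q \<in> carrier G" using c by (simp add: q_def)
    have zq: "z = N #> q" using c'(2) c by (simp add: q_def N.FactGroup_pow)
    have qN: "q \<notin> N" using H.z(2) mem_N[OF qG] by (simp add: zq)
    have "N #> (q \<otimes> q) = N" using H.z(3) N.rcos_sum[OF qG qG] unfolding zq by (simp del: h.hom_mult)
    then have q2: "q \<otimes> q \<in> N" using mem_N[OF m_closed[OF qG qG]] by blast
    \<comment> \<open>The preimage in \<open>G\<close> of the commutator subgroup
      \<open>{1, z}\<close> of the quotient.\<close>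
    have commV: "grp_comm G x y \<in> {\<one>, u, q, u \<otimes> q}" if "x \<in> carrier G" "y \<in> carrier G" for x y
    proof -
      have "N #> grp_comm G x y = grp_comm (G Mod N) (N #> x) (N #> y)"
        using that by (simp add: grp_comm_def del: mult_FactGroup)
      also have "\<dots> \<in> {N, N #> q}" using H.grp_comm_z[of "N #> x" "N #> y"] that im by (auto simp: zq)
      finally have "grp_comm G x y \<in> N \<union> (N #> q)" using rcos_self[OF _ N.subgroup_axioms, of "grp_comm G x y"] that by auto
      then show ?thesis using qG u(1) by (auto simp: N_def r_coset_def)
    qed
    have q4: "q [^] (4::nat) = \<one>"
    proof -
      have "q [^] (4::nat) = (q \<otimes> q) \<otimes> (q \<otimes> q)" using qG by (simp add: numeral_eq_Suc m_assoc)
      then show ?thesis using q2 u(1-3) by (auto simp: N_def)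
    qed
    have uq_pow: "(u \<otimes> q) [^] (i::nat) = u [^] i \<otimes> q [^] i" for i
      using pow_mult_distrib[OF u(4)[OF qG] u(1) qG] .
    have u_even: "u [^] i = \<one>" if "even i" for i :: nat
      using that u(1-3) nat_pow_pow[of u 2] by (auto elim!: evenE simp: numeral_2_eq_2)
    \<comment> \<open>The commutator \<open>[c, x]\<close> commutes with \<open>c\<close> and has
      fourth power 1. Since 4 divides \<open>2 ^ k\<close>, it follows that
      \<open>[q, x] = [c, x]^(2^k) = 1\<close>.\<close>
    have q_cen: "q \<otimes> x = x \<otimes> q" if x: "x \<in> carrier G" for x
    proof -
      let ?d = "grp_comm G c x"
      have d: "?d \<in> {\<one>, u, q, u \<otimes> q}" using commV c x by blast
      have qc: "q \<otimes> c = c \<otimes> q" using c nat_pow_comm[of c "2 ^ k" 1] by (simp add: q_def)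
      have uc: "u \<otimes> c = c \<otimes> u" using c(1) by (rule u(4))
      have "u \<otimes> q \<otimes> c = c \<otimes> (u \<otimes> q)" by (rule mult_commutes[OF u(1) qG c(1) uc qc])
      then have cd: "c \<otimes> ?d = ?d \<otimes> c" using d c(1) qc uc by auto
      have "(2::nat) ^ k = 2 ^ (2 + (k - 2))" using k(1) by (metis le_add_diff_inverse)
      also have "\<dots> = 4 * 2 ^ (k - 2)" by (simp only: power_add) simp
      finally have k': "(2::nat) ^ k = 4 * 2 ^ (k - 2)" .
      have "?d [^] (4::nat) = \<one>" using d q4 u_even[of 4] u(1-3) qG uq_pow[of 4] by auto
      then have "?d [^] ((2::nat) ^ k) = \<one>"
        unfolding k' using nat_pow_pow[of ?d 4] c x by (metis grp_comm_closed nat_pow_one)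
      then have "grp_comm G q x = \<one>" using grp_comm_nat_pow[OF c(1) x cd] by (simp add: q_def)
      then show ?thesis using qG x by (simp add: grp_comm_eq_one_iff)
    qed
    have V_cen: "v \<otimes> g = g \<otimes> v" if "v \<in> {\<one>, u, q, u \<otimes> q}" "g \<in> carrier G" for v g
      using that u(1-3) q_cen[OF that(2)] u(4)[OF that(2)] qG by (auto simp: m_assoc) (metis m_assoc)
    have comm_cen: "grp_comm G x y \<otimes> g = g \<otimes> grp_comm G x y"
      if "x \<in> carrier G" "y \<in> carrier G" "g \<in> carrier G" for x y g
      using V_cen commV that by blast
    have comm_pow: "grp_comm G (x [^] (i::nat)) y = grp_comm G x y [^] i"
      if "x \<in> carrier G" "y \<in> carrier G" for x y i
      using that comm_cen[OF that that(1)] by (intro grp_comm_nat_pow) auto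
    define S where "S = insert u (insert c (set ys))"
    have SG: "S \<subseteq> carrier G" using u(1-3) c ys by (auto simp: S_def)
    have genS: "generate G S = carrier G"
    proof (rule generate_eqI[OF generate_coset_lift[OF Nn]])
      show "insert c (set ys) \<subseteq> carrier G" using c ys by simp
      show "generate (G Mod N) ((\<lambda>x. N #> x) ` insert c (set ys)) = carrier (G Mod N)"
        using genH c ys by simp
      show "N \<union> insert c (set ys) \<subseteq> generate G S"
        by (auto simp: N_def S_def intro: generate.one generate.incl)
    qed (rule SG)
    obtain a b where ab: "a \<in> carrier G" "b \<in> carrier G" "grp_comm G a b \<notin> N"
      using ncH comm_group_Mod_iff[OF Nn] by blast
    have u_comm: "grp_comm G u x = \<one>" "grp_comm G x u = \<one>" if "x \<in> carrier G" for x
      using u(1) u(4)[OF that] that by (simp_all add: grp_comm_eq_one_iff)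
    show ?thesis
    proof (cases "\<forall>e\<in>set es. e = 1")
      case True
      \<comment> \<open>The central elements of square 1. Placing all commutators in
        \<open>W\<close> yields \<open>q^2 = 1\<close> and makes fourth powering a
        homomorphism.\<close>
      define W where "W = {w \<in> carrier G. w \<otimes> w = \<one> \<and> (\<forall>g\<in>carrier G. w \<otimes> g = g \<otimes> w)}"
      have WG: "w \<in> carrier G" and W2: "w \<otimes> w = \<one>" if "w \<in> W" for w
        using that unfolding W_def by blast+
      have WC: "w \<otimes> g = g \<otimes> w" if "w \<in> W" "g \<in> carrier G" for w g
        using that unfolding W_def by blast
      have W: "W \<lhd> G"
      proof (rule normal_invI)
        show "subgroup W G"
        proof (rule subgroupI)
          fix v w assume v: "v \<in> W" and w: "w \<in> W"
          have "inv v = v" by (rule inv_equality[OF W2[OF v] WG[OF v] WG[OF v]])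
          then show "inv v \<in> W" using v by simp
          have vw: "v \<in> carrier G" "w \<in> carrier G" "w \<otimes> v = v \<otimes> w"
            using WG[OF v] WG[OF w] WC[OF w WG[OF v]] by blast+
          have "v \<otimes> w \<otimes> (v \<otimes> w) = v \<otimes> (w \<otimes> v) \<otimes> w" using vw(1,2) by (simp add: m_assoc)
          also have "\<dots> = (v \<otimes> v) \<otimes> (w \<otimes> w)" unfolding vw(3) using vw(1,2) by (simp add: m_assoc)
          finally have "v \<otimes> w \<otimes> (v \<otimes> w) = \<one>" using W2[OF v] W2[OF w] by simp
          moreover have "v \<otimes> w \<otimes> g = g \<otimes> (v \<otimes> w)" if g: "g \<in> carrier G" for g
          proof -
            have "v \<otimes> w \<otimes> g = v \<otimes> (g \<otimes> w)" using vw(1,2) g WC[OF w g] by (simp add: m_assoc)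
            also have "\<dots> = (v \<otimes> g) \<otimes> w" using vw(1,2) g by (simp add: m_assoc)
            also have "\<dots> = g \<otimes> (v \<otimes> w)" unfolding WC[OF v g] using vw(1,2) g by (simp add: m_assoc)
            finally show ?thesis .
          qed
          ultimately show "v \<otimes> w \<in> W" using vw(1,2) unfolding W_def by blast
        next
          have "\<one> \<in> W" by (simp add: W_def)
          then show "W \<noteq> {}" by blast
        qed (auto simp: W_def)
        fix x w assume x: "x \<in> carrier G" and w: "w \<in> W"
        have "x \<otimes> w \<otimes> inv x = w \<otimes> x \<otimes> inv x" using WC[OF w x] by simp
        also have "\<dots> = w" using x WG[OF w] by (simp add: m_assoc)
        finally show "x \<otimes> w \<otimes> inv x \<in> W" using w by simp
      qed
      \<comment> \<open>Here \<open>y^2\<close> lies in the central subgroup \<open>N\<close>, so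
        \<open>[y, x]^2 = [y^2, x] = 1\<close>.\<close>
      have yW: "grp_comm G y x \<in> W" "grp_comm G x y \<in> W" if y: "y \<in> set ys" and x: "x \<in> carrier G" for x y
      proof -
        have yG: "y \<in> carrier G" using y ys by blast
        obtain i where "i < length ys" "y = ys ! i" using y by (auto simp: in_set_conv_nth)
        then have "y [^] ((2::nat) ^ (es ! i)) \<in> N" "es ! i = 1"
          using ys_pow True by (auto simp: list_all2_conv_all_nth)
        then have y2: "y [^] (2::nat) \<in> N" by simp
        have "grp_comm G y x \<otimes> grp_comm G y x = grp_comm G (y [^] (2::nat)) x"
          using comm_pow[OF yG x, of 2] yG x by (simp add: numeral_2_eq_2)
        also have "\<dots> = \<one>" using y2 u_comm(1)[OF x] x grp_comm_eq_one_iff[of \<one> x] by (auto simp: N_def)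
        finally show "grp_comm G y x \<in> W"
          unfolding W_def using comm_cen[OF yG x] grp_comm_closed[OF yG x] by blast
        then have "inv (grp_comm G y x) \<in> W" using subgroup.m_inv_closed[OF normal_imp_subgroup[OF W]] by blast
        then show "grp_comm G x y \<in> W" using grp_comm_swap[OF yG x] by simp
      qed
      have oneW: "\<one> \<in> W" by (simp add: W_def)
      have commW: "grp_comm G x y \<in> W" if "x \<in> carrier G" "y \<in> carrier G" for x y
      proof (rule grp_comm_in_normal_if_generators[OF W SG genS _ that])
        fix s t assume st: "s \<in> S" "t \<in> S"
        then have stG: "s \<in> carrier G" "t \<in> carrier G" using SG by auto
        consider "s = u" | "t = u" | "s \<in> set ys" | "t \<in> set ys" | "s = c" "t = c" using st by (auto simp: S_def)
        then show "grp_comm G s t \<in> W"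
          by cases (use stG yW u_comm oneW grp_comm_eq_one_iff[of c c] in auto)
      qed
      have qq: "q \<otimes> q = \<one>"
      proof -
        have "grp_comm G a b \<in> {q, u \<otimes> q}" using commV[OF ab(1,2)] ab(3) by (auto simp: N_def)
        moreover have "grp_comm G a b \<otimes> grp_comm G a b = \<one>" using commW[OF ab(1,2)] by (simp add: W_def)
        moreover have "(u \<otimes> q) \<otimes> (u \<otimes> q) = (u \<otimes> u) \<otimes> (q \<otimes> q)"
          using u(1) qG q_cen[OF u(1)] by (simp add: m_assoc) (metis m_assoc)
        ultimately show ?thesis using u(1-3) qG by auto
      qed
      have m4: "(x \<otimes> y) [^] (4::nat) = x [^] (4::nat) \<otimes> y [^] (4::nat)"
        if "x \<in> carrier G" "y \<in> carrier G" for x y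
        using that commW[OF that(2,1)] by (intro pow_mult_4_if_comm_sq) (auto simp: W_def)
      have D: "subgroup (generate G {c}) G" using c by (intro generate_is_subgroup) auto
      have "power_subgroup G (carrier G) 4 \<subseteq> generate G {c}"
      proof (rule power_subgroup_4_subset[OF D SG genS m4])
        fix s assume "s \<in> S"
        then consider "s = u" | "s = c" | "s \<in> set ys" by (auto simp: S_def)
        then show "s [^] (4::nat) \<in> generate G {c}"
        proof cases
          case 1 then show ?thesis using u_even[of 4] by (simp add: generate.one)
        next
          case 2 then show ?thesis by (intro nat_pow_in_subgroup[OF D] generate.incl) simp
        next
          case 3
          then obtain i where "i < length ys" "s = ys ! i" by (auto simp: in_set_conv_nth)
          then have "s [^] ((2::nat) ^ (es ! i)) \<in> N" "es ! i = 1"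
            using ys_pow True by (auto simp: list_all2_conv_all_nth)
          then have "s [^] (2::nat) \<in> N" by simp
          then have "(s [^] (2::nat)) [^] (2::nat) = \<one>" using u(1-3) by (auto simp: N_def numeral_2_eq_2)
          moreover have "s \<in> carrier G" using 3 ys by blast
          ultimately have "s [^] (4::nat) = \<one>" using nat_pow_pow[of s 2 2] by simp
          then show ?thesis by (simp add: generate.one)
        qed
      qed
      \<comment> \<open>This is the contradiction: \<open>\<langle>c\<rangle>\<close> is cyclic of
        order \<open>2^(k + 1)\<close> with \<open>q\<close> as its only involution, while
        \<open>u\<close> is an involution and \<open>q\<close> lies outside
        \<open>N\<close>.\<close>
      then have "u \<in> generate G {c}" using uK powerfully_nilpotentD(4)[OF pn] by blast
      moreover have c1: "c [^] ((2::nat) ^ Suc k) = \<one>"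
        using qq c nat_pow_mult[of c "2 ^ k" "2 ^ k"] by (simp add: q_def mult_2)
      ultimately obtain j :: nat where j: "u = c [^] j"
        using generate_single_nat_pow[OF c(1) c1] by auto
      have "2 ^ Suc k dvd j + j"
      proof (rule pow_in_subgroup_dvd[OF triv_subgroup c(1)])
        show "c [^] ((2::nat) ^ Suc k) \<in> {\<one>}" using c1 by simp
        show "c [^] (j + j) \<in> {\<one>}" using u(3) c by (simp add: j nat_pow_mult)
        fix i assume "i < Suc k"
        then have "q = (c [^] ((2::nat) ^ i)) [^] ((2::nat) ^ (k - i))"
          using c by (simp add: q_def nat_pow_pow flip: power_add)
        then show "c [^] ((2::nat) ^ i) \<notin> {\<one>}" using qN by (auto simp: N_def)
      qed
      then have "2 ^ k dvd j" by (simp flip: mult_2)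
      then obtain t where "j = 2 ^ k * t" by blast
      then have "u = q [^] t" using j c by (simp add: q_def nat_pow_pow)
      moreover have "q [^] t \<in> {\<one>, q}" using qq qG by (induction t) auto
      ultimately have False using u(1-3) qN by (auto simp: N_def)
      then show ?thesis ..
    next
      case False
      \<comment> \<open>From \<open>m \<le> 5\<close> and \<open>2 \<le> k\<close> at most 2 remains
        to be partitioned. The only partition with a part other than 1 is \<open>[2]\<close>, which
        forces \<open>m = 5\<close> and \<open>k = 2\<close>.\<close>
      have parts: "desc_parts 0 0 = [[]]" "desc_parts 1 1 = [[1]]" "desc_parts 2 2 = [[1, 1], [2]]"
        by code_simp+
      have "m - Suc k = 0 \<or> m - Suc k = 1 \<or> m - Suc k = 2" using k m by auto
      then have es2: "es = [2]" "m - Suc k = 2" using es False parts by auto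
      then have mk: "m = 5" "k = 2" using k m by auto
      obtain y where y: "ys = [y]" "y [^] (4::nat) \<in> N"
        using ys_pow es2 by (auto simp: list_all2_Cons2)
      have yG: "y \<in> carrier G" using ys y by simp
      have q_def': "q = c [^] (4::nat)" by (simp add: q_def mk)
      have S: "S = {u, c, y}" by (simp add: S_def y)
      define w where "w = grp_comm G c y"
      have wG: "w \<in> carrier G" using c yG by (simp add: w_def)
      have w_gens: "grp_comm G s t \<in> {\<one>, w, inv w}" if "s \<in> S" "t \<in> S" for s t
      proof -
        have "grp_comm G y c = inv w" unfolding w_def by (rule grp_comm_swap[OF c(1) yG])
        moreover have "grp_comm G c c = \<one>" "grp_comm G y y = \<one>"
          using c yG by (simp_all add: grp_comm_eq_one_iff)
        ultimately show ?thesis using that u_comm c(1) yG u(1) by (auto simp: S w_def)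
      qed
      have wN: "w \<notin> N"
      proof
        assume "w \<in> N"
        then have "grp_comm G s t \<in> N" if "s \<in> S" "t \<in> S" for s t using w_gens[OF that] by auto
        then have "grp_comm G a b \<in> N"
          using grp_comm_in_normal_if_generators[OF Nn SG genS _ ab(1,2)] by blast
        then show False using ab(3) by simp
      qed
      then have w: "w \<in> {q, u \<otimes> q}" using commV[OF c(1) yG] by (auto simp: w_def N_def)
      have w2: "w \<otimes> w = q \<otimes> q"
      proof -
        have "(u \<otimes> q) \<otimes> (u \<otimes> q) = (u \<otimes> u) \<otimes> (q \<otimes> q)"
          using u(1) qG q_cen[OF u(1)] by (simp add: m_assoc) (metis m_assoc)
        then show ?thesis using w u(1-3) qG by auto
      qed
      \<comment> \<open>If \<open>q^2\<close> were 1, then \<open>w\<close> would be a central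
        involution with \<open>[G, G] = {1, w}\<close>. This group contains \<open>u\<close>, so
        \<open>u = w\<close>, although \<open>w\<close> is not in \<open>N\<close>.\<close>
      have q2u: "q \<otimes> q = u"
      proof (rule ccontr)
        assume "q \<otimes> q \<noteq> u"
        then have "q \<otimes> q = \<one>" using q2 by (simp add: N_def)
        then have ww: "w \<otimes> w = \<one>" using w2 by simp
        then have inv_w: "inv w = w" using wG by (intro inv_equality) auto
        have Nw: "{\<one>, w} \<lhd> G"
          by (rule central_involution_normal[OF wG ww comm_cen[OF c(1) yG, folded w_def]])
        have "grp_comm G x y \<in> {\<one>, w}" if "x \<in> carrier G" "y \<in> carrier G" for x y
          using w_gens inv_w by (intro grp_comm_in_normal_if_generators[OF Nw SG genS _ that]) auto
        then have "comm_subgroup G (carrier G) (carrier G) \<subseteq> {\<one>, w}"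
          unfolding comm_subgroup_def
          by (intro generate_subgroup_incl[OF _ normal_imp_subgroup[OF Nw]]) auto
        then have "u = w" using uK u(1-3) by auto
        then show False using wN by (simp add: N_def)
      qed
      have c8: "c [^] (8::nat) = u" using q2u c nat_pow_mult[of c 4 4] by (simp add: q_def')
      have c16: "c [^] (16::nat) = \<one>" using u(3) c c8 nat_pow_mult[of c 8 8] by simp
      \<comment> \<open>Since \<open>q^2 = u\<close>, the element \<open>u q\<close> is the inverse
        of \<open>q\<close>. Inverting \<open>y\<close> turns the commutator \<open>u q\<close> into
        \<open>q = c^4\<close>.\<close>
      define y1 where "y1 = (if w = q then y else inv y)"
      have y1G: "y1 \<in> carrier G" using yG by (simp add: y1_def)
      have comm1: "grp_comm G c y1 = q"
      proof (cases "w = q")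
        case True then show ?thesis by (simp add: y1_def w_def)
      next
        case False
        then have wuq: "w = u \<otimes> q" using w by simp
        have "grp_comm G y c \<otimes> y = y \<otimes> grp_comm G y c" using comm_cen c yG by blast
        then have "grp_comm G (inv y) c = inv (grp_comm G y c)"
          using grp_comm_int_pow[of y c "-1"] yG c by (simp add: int_pow_neg)
        then have "inv (grp_comm G (inv y) c) = grp_comm G y c" using c yG by simp
        moreover have "grp_comm G c (inv y) = inv (grp_comm G (inv y) c)"
          using c yG by (intro grp_comm_swap) auto
        moreover have "grp_comm G y c = inv w" unfolding w_def by (rule grp_comm_swap[OF c(1) yG])
        ultimately have "grp_comm G c (inv y) = inv w" by simp
        also have "inv w = q"
        proof (rule inv_equality)
          have "q \<otimes> (u \<otimes> q) = u \<otimes> (q \<otimes> q)" using u(1) qG q_cen[OF u(1)] by (metis m_assoc)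
          then show "q \<otimes> w = \<one>" using q2u u(1-3) by (simp add: wuq)
        qed (use wG qG in auto)
        finally show ?thesis using False by (simp add: y1_def)
      qed
      have y14: "y1 [^] (4::nat) \<in> {\<one>, u}"
      proof -
        have "inv u = u" using u(1-3) by (intro inv_equality) auto
        then show ?thesis using y(2) yG by (auto simp: y1_def N_def nat_pow_inv)
      qed
      \<comment> \<open>If \<open>y1^4 = u\<close>, the factor \<open>c^2\<close> with
        \<open>(c^2)^4 = c^8 = u\<close> compensates; fourth powers multiply because
        \<open>[c^2, y1] = u\<close> is central of square 1. The commutator with \<open>c\<close> is
        unaffected.\<close>
      define y2 where "y2 = (if y1 [^] (4::nat) = \<one> then y1 else y1 \<otimes> c [^] (2::nat))"
      have y2G: "y2 \<in> carrier G" using y1G c by (simp add: y2_def)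
      have d: "grp_comm G (c [^] (2::nat)) y1 = u"
        using comm_pow[OF c(1) y1G, of 2] comm1 q2u qG by (simp add: numeral_2_eq_2)
      have y24: "y2 [^] (4::nat) = \<one>"
      proof (cases "y1 [^] (4::nat) = \<one>")
        case True then show ?thesis by (simp add: y2_def)
      next
        case False
        have "(y1 \<otimes> c [^] (2::nat)) [^] (4::nat) = y1 [^] (4::nat) \<otimes> (c [^] (2::nat)) [^] (4::nat)"
        proof (rule pow_mult_4_if_comm_sq)
          show "grp_comm G (c [^] (2::nat)) y1 \<otimes> grp_comm G (c [^] (2::nat)) y1 = \<one>"
            unfolding d by (rule u(3))
          show "grp_comm G (c [^] (2::nat)) y1 \<otimes> g = g \<otimes> grp_comm G (c [^] (2::nat)) y1"
            if "g \<in> carrier G" for g unfolding d using that by (rule u(4))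
        qed (use y1G c in auto)
        also have "\<dots> = u \<otimes> u" using False y14 c c8 by (simp add: nat_pow_pow)
        finally show ?thesis using False u(1-3) by (simp add: y2_def)
      qed
      have comm2: "grp_comm G c y2 = c [^] (4::nat)"
      proof (cases "y1 [^] (4::nat) = \<one>")
        case True then show ?thesis using comm1 by (simp add: y2_def q_def')
      next
        case False
        have "c \<otimes> (y1 \<otimes> c [^] (2::nat)) = (c \<otimes> y1) \<otimes> c [^] (2::nat)" using y1G c by (simp add: m_assoc)
        also have "\<dots> = (y1 \<otimes> c \<otimes> q) \<otimes> c [^] (2::nat)" using mult_grp_comm[OF c(1) y1G] comm1 by simp
        also have "\<dots> = y1 \<otimes> c \<otimes> (c [^] (2::nat) \<otimes> q)" using q_cen[of "c [^] (2::nat)"] c y1G qG by (simp add: m_assoc)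
        also have "\<dots> = (y1 \<otimes> c [^] (2::nat)) \<otimes> c \<otimes> q"
          using c y1G qG nat_pow_comm[of c 1 2] by (simp add: m_assoc) (metis m_assoc nat_pow_closed)
        finally show ?thesis using False y1G c qG by (simp add: y2_def q_def'[symmetric] grp_comm_eqI)
      qed
      have gen: "generate G {c, y2} = carrier G"
      proof (rule generate_eqI[OF genS])
        show T: "{c, y2} \<subseteq> carrier G" using c y2G by simp
        have P: "subgroup (generate G {c, y2}) G" by (rule generate_is_subgroup[OF T])
        have cP: "c \<in> generate G {c, y2}" "y2 \<in> generate G {c, y2}" by (auto intro: generate.incl)
        have "y1 = y2 \<or> y1 = y2 \<otimes> inv (c [^] (2::nat))"
          using y1G c by (simp add: y2_def m_assoc)
        then have y1P: "y1 \<in> generate G {c, y2}"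
          using cP nat_pow_in_subgroup[OF P cP(1)] subgroup.m_closed[OF P] subgroup.m_inv_closed[OF P] by metis
        then have "y \<in> generate G {c, y2}"
          using subgroup.m_inv_closed[OF P y1P] yG by (auto simp: y1_def split: if_splits)
        moreover have "u \<in> generate G {c, y2}" using nat_pow_in_subgroup[OF P cP(1), of 8] c8 by simp
        ultimately show "S \<subseteq> generate G {c, y2}" using cP by (auto simp: S)
      qed
      have "pc_sat [(ga, 16), (gb, 4)] [((ga, gb), (ga, 4))] G (gen_case c y2 \<one> \<one>)"
        using c y2G c16 y24 comm2 gen by (simp add: pc_sat_def)
      then show ?thesis using mk by auto
    qed
  qed
qed

section \<open>The classification\<close>

lemma desc_parts_small:
  "desc_parts 0 0 = [[]]" "desc_parts 1 1 = [[1]]" "desc_parts 2 2 = [[1, 1], [2]]"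
  "desc_parts 3 3 = [[1, 1, 1], [2, 1], [3]]"
  by code_simp+

lemma (in comm2) iso_listed_group:
  assumes D: "n = 4 \<and> D = pcs16 \<or> n = 5 \<and> D = pcs32 \<or> n = 6 \<and> D = pcs64"
  shows "\<exists>d\<in>set D. G \<cong> pc_to_group d"
proof -
  have realize: ?thesis if d: "(ps, cs, c, w) \<in> set D" and sat: "pc_sat ps cs G f" for ps cs c w f
  proof -
    have "pc_valid (ps, cs, c, w)" "pc_order (ps, cs, c, w) = order G"
      using D d pcs_valid pcs_order ord by (auto simp: list_all_iff simp del: pc_valid.simps pc_order.simps)
    then have "G \<cong> pc_to_group (ps, cs, c, w)" using sat by (intro iso_pc_to_group[where f = f]) simp_all
    then show ?thesis using d by blast
  qed
  obtain c k ys es where cG: "c \<in> carrier G" and k2: "2 \<le> k" and ck: "c [^] ((2::nat) ^ k) = z"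
    and ys: "set ys \<subseteq> carrier G" "list_all2 (\<lambda>y e. y [^] ((2::nat) ^ e) = \<one>) ys es"
    and gen: "generate G (insert c (set ys)) = carrier G" and kn: "k < n"
    and es: "es \<in> set (desc_parts (n - Suc k) (n - Suc k))"
    by (rule exists_pure_cyclic_basis)
  note c = cG ck and k = k2 kn
  have "n \<le> 6" using D by auto
  \<comment> \<open>By \<open>2 \<le> k\<close> the group \<open>\<langle>c\<rangle>\<close> has
    order at least 8, so an exponent sum of 3 for the remaining basis occurs only with
    \<open>n = 6\<close> and \<open>k = 2\<close>.\<close>
  then consider "n - Suc k = 0" | "n - Suc k = 1" | "n - Suc k = 2" | "n - Suc k = 3" "n = 6" "k = 2"
    using k by linarith
  then consider "es = []" | e where "es = [e]" "n = Suc k + e" "0 < e"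
    | "es = [1, 1]" "n = k + 3" | "es = [2, 1]" "n = 6" "k = 2" | "es = [1, 1, 1]" "n = 6" "k = 2"
    by cases (use es k in \<open>auto simp: desc_parts_small desc_parts_small(2)[unfolded One_nat_def]\<close>)
  then show ?thesis
  proof cases
    case 1
    \<comment> \<open>Here \<open>G\<close> would be generated by \<open>c\<close> alone, so some
      element would have to fail to commute with itself.\<close>
    then have "ys = []" using ys(2) by simp
    then have "\<exists>x\<in>{c}. \<exists>y\<in>{c}. B x y" using exists_B[of "{c}"] c gen by simp
    then show ?thesis by simp
  next
    case (2 e)
    then obtain y where y: "ys = [y]" "y [^] ((2::nat) ^ e) = \<one>" using ys(2) by (auto simp: list_all2_Cons2)
    then have sat: "pc_sat [(ga, 2 ^ Suc k), (gb, 2 ^ e)] [((ga, gb), (ga, 2 ^ k))] G (gen_case c y \<one> \<one>)"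
      using ys(1) gen c by (intro rank2_pc_sat) auto
    \<comment> \<open>These six triples are the listed groups on two generators, apart from the
      exceptional one with \<open>[a, b] = a^4\<close> and \<open>a\<close> of order 16.\<close>
    have "k = 2 \<and> e = 1 \<and> n = 4 \<or> k = 2 \<and> e = 2 \<and> n = 5 \<or> k = 3 \<and> e = 1 \<and> n = 5 \<or>
        k = 2 \<and> e = 3 \<and> n = 6 \<or> k = 3 \<and> e = 2 \<and> n = 6 \<or> k = 4 \<and> e = 1 \<and> n = 6"
      using 2(2,3) k(1) \<open>n \<le> 6\<close> by presburger
    then have "([(ga, 2 ^ Suc k), (gb, 2 ^ e)], [((ga, gb), (ga, 2 ^ k))], ga, 2 ^ k) \<in> set D"
      using D by (elim disjE) (simp_all add: pcs16_def pcs32_def pcs64_def)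
    then show ?thesis using sat by (rule realize)
  next
    case 3
    then obtain a b where ab: "ys = [a, b]" "a [^] (2::nat) = \<one>" "b [^] (2::nat) = \<one>"
      using ys(2) by (auto simp: list_all2_Cons2)
    then have G: "a \<in> carrier G" "b \<in> carrier G" using ys by auto
    have "generate G {a, b, c} = carrier G" using gen ab by (simp add: insert_commute)
    moreover have "even (2::nat)" "2 dvd (2::nat) ^ k" using k(1) by auto
    ultimately obtain f p where fp: "p \<in> {(ga, gb), (ga, gc), (gb, gc)}"
      "pc_sat [(ga, 2), (gb, 2), (gc, 2 ^ Suc k)] [(p, (gc, 2 ^ k))] G f" "p \<noteq> (gb, gc)"
      using rank3_pc_sat[OF G c(1) ab(2,3) _ _ c(2) k(1)] by metis
    have "k = 2 \<and> n = 5 \<or> k = 3 \<and> n = 6" using 3 k \<open>n \<le> 6\<close> by presburger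
    then have "([(ga, 2), (gb, 2), (gc, 2 ^ Suc k)], [(p, (gc, 2 ^ k))], gc, 2 ^ k) \<in> set D"
      using D fp(1,3) by (elim disjE) (auto simp: pcs16_def pcs32_def pcs64_def)
    then show ?thesis using fp(2) by (rule realize)
  next
    case 4
    then obtain a b where ab: "ys = [b, a]" "a [^] (2::nat) = \<one>" "b [^] (4::nat) = \<one>"
      using ys(2) by (auto simp: list_all2_Cons2)
    then have G: "a \<in> carrier G" "b \<in> carrier G" using ys by auto
    have "generate G {a, b, c} = carrier G" using gen ab by (simp add: insert_commute)
    moreover have "even (4::nat)" "4 dvd (2::nat) ^ k" using 4 by auto
    ultimately obtain f p where fp: "p \<in> {(ga, gb), (ga, gc), (gb, gc)}"
      "pc_sat [(ga, 2), (gb, 4), (gc, 2 ^ Suc k)] [(p, (gc, 2 ^ k))] G f"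
      using rank3_pc_sat[OF G c(1) ab(2,3) _ _ c(2) k(1)] by metis
    then have "([(ga, 2), (gb, 4), (gc, 2 ^ Suc k)], [(p, (gc, 2 ^ k))], gc, 2 ^ k) \<in> set D"
      using D 4 by (auto simp: pcs64_def)
    then show ?thesis using fp(2) by (rule realize)
  next
    case 5
    then obtain a1 a2 a3 where a: "ys = [a1, a2, a3]" "a1 [^] (2::nat) = \<one>" "a2 [^] (2::nat) = \<one>"
      "a3 [^] (2::nat) = \<one>"
      using ys(2) by (auto simp: list_all2_Cons2)
    then have G: "a1 \<in> carrier G" "a2 \<in> carrier G" "a3 \<in> carrier G" using ys by auto
    have c4: "c [^] (4::nat) = z" using c(2) 5 by simp
    have "generate G {a1, a2, a3, c} = carrier G" using gen a by (simp add: insert_commute)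
    then obtain f cs where fcs:
      "cs \<in> {[((ga, gb), (gd, 4))], [((ga, gd), (gd, 4))], [((ga, gb), (gd, 4)), ((gc, gd), (gd, 4))]}"
      "pc_sat [(ga, 2), (gb, 2), (gc, 2), (gd, 8)] cs G f"
      using rank4_pc_sat[OF G c(1) a(2,3,4) c4] by metis
    then have "([(ga, 2), (gb, 2), (gc, 2), (gd, 8)], cs, gd, 4) \<in> set D"
      using D 5 by (auto simp: pcs64_def)
    then show ?thesis using fcs(2) by (rule realize)
  qed
qed

text \<open>The exceptional alternative of \<open>comm2_or_exceptional\<close> has order 64, so
  below that order the commutator subgroup always has order 2.\<close>

lemma comm2_step:
  fixes G :: "('a, 'b) monoid_scheme"
  assumes G: "powerfully_nilpotent G" "\<not> comm_group G" and ord: "order G = 2 ^ n" and n: "n = Suc m" "n < 6"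
    and IH: "\<And>H :: 'a set monoid. powerfully_nilpotent H \<Longrightarrow> \<not> comm_group H \<Longrightarrow> order H = 2 ^ m \<Longrightarrow>
      \<exists>z. comm2 H z m"
  shows "\<exists>z. comm2 G z n"
proof -
  have "(\<exists>z. comm2 G z (Suc m)) \<or>
    Suc m = 6 \<and> (\<exists>f. pc_sat [(ga, 16), (gb, 4)] [((ga, gb), (ga, 4))] G f)"
  proof (rule group.comm2_or_exceptional[OF powerfully_nilpotentD(1)[OF G(1)] G ord[unfolded n(1)]])
    show "Suc m \<le> 6" using n by simp
  qed (erule (2) IH)
  moreover have "Suc m \<noteq> 6" using n by simp
  ultimately show ?thesis unfolding n(1) by blast
qed

text \<open>The type of the group changes in each step, so the induction over the order is unrolled.\<close>

lemma comm2_order_1: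
  assumes "powerfully_nilpotent G" "\<not> comm_group G" "order G = 2 ^ 0"
  shows "\<exists>z. comm2 G z 0"
proof -
  interpret group G using powerfully_nilpotentD(1)[OF assms(1)] .
  have "carrier G = {\<one>\<^bsub>G\<^esub>}"
    using assms(3) one_closed by (metis card_1_singletonE order_def power_0 singletonD)
  then have "comm_group G" by (intro group_comm_groupI) simp
  then show ?thesis using assms(2) by simp
qed

lemma comm2_order_2:
  assumes "powerfully_nilpotent G" "\<not> comm_group G" "order G = 2 ^ 1"
  shows "\<exists>z. comm2 G z 1"
  by (rule comm2_step[OF assms, of 0]) (simp, simp, erule (2) comm2_order_1)

lemma comm2_order_4:
  assumes "powerfully_nilpotent G" "\<not> comm_group G" "order G = 2 ^ 2"
  shows "\<exists>z. comm2 G z 2"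
  by (rule comm2_step[OF assms, of 1]) (simp, simp, erule (2) comm2_order_2)

lemma comm2_order_8:
  assumes "powerfully_nilpotent G" "\<not> comm_group G" "order G = 2 ^ 3"
  shows "\<exists>z. comm2 G z 3"
  by (rule comm2_step[OF assms, of 2]) (simp, simp, erule (2) comm2_order_4)

lemma comm2_order_16:
  assumes "powerfully_nilpotent G" "\<not> comm_group G" "order G = 2 ^ 4"
  shows "\<exists>z. comm2 G z 4"
  by (rule comm2_step[OF assms, of 3]) (simp, simp, erule (2) comm2_order_8)

lemma comm2_order_32:
  assumes "powerfully_nilpotent G" "\<not> comm_group G" "order G = 2 ^ 5"
  shows "\<exists>z. comm2 G z 5"
  by (rule comm2_step[OF assms, of 4]) (simp, simp, erule (2) comm2_order_16)

lemma nonabelian_classification: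
  assumes pn: "powerfully_nilpotent G" and nc: "\<not> comm_group G" and ord: "order G = 2 ^ m"
    and D: "m = 4 \<and> D = pcs16 \<or> m = 5 \<and> D = pcs32 \<or> m = 6 \<and> D = pcs64"
  shows "\<exists>d\<in>set D. G \<cong> pc_to_group d"
proof -
  interpret group G using powerfully_nilpotentD(1)[OF pn] .
  from D consider "m = 4" | "m = 5" | "m = 6" by blast
  then have "(\<exists>z. comm2 G z m) \<or>
    m = 6 \<and> (\<exists>f. pc_sat [(ga, 16), (gb, 4)] [((ga, gb), (ga, 4))] G f)"
  proof cases
    case 1
    then show ?thesis using comm2_order_16[OF pn nc] ord by simp
  next
    case 2
    then show ?thesis using comm2_order_32[OF pn nc] ord by simp
  next
    case 3
    then have "order G = 2 ^ Suc 5" using ord by simp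
    then have "(\<exists>z. comm2 G z (Suc 5)) \<or>
      Suc 5 = 6 \<and> (\<exists>f. pc_sat [(ga, 16), (gb, 4)] [((ga, gb), (ga, 4))] G f)"
      by (rule comm2_or_exceptional[OF pn nc]) (simp, rule comm2_order_32)
    moreover have "Suc 5 = 6" by simp
    ultimately show ?thesis unfolding 3 by metis
  qed
  then show ?thesis
  proof (elim disjE exE conjE)
    fix z assume "comm2 G z m"
    then interpret comm2 G z m .
    show ?thesis using iso_listed_group[OF D] .
  next
    fix f assume m: "m = 6" and sat: "pc_sat [(ga, 16), (gb, 4)] [((ga, gb), (ga, 4))] G f"
    let ?d = "([(ga, 16), (gb, 4)], [((ga, gb), (ga, 4))], ga, 4)"
    have d: "?d \<in> set pcs64" by (simp add: pcs64_def)
    then have "pc_valid ?d" "pc_order ?d = order G"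
      using pcs_valid(3) pcs_order(3) ord m by (auto simp: list_all_iff simp del: pc_valid.simps pc_order.simps)
    then have "G \<cong> pc_to_group ?d" using sat by (intro iso_pc_to_group[where f = f]) simp_all
    moreover have "D = pcs64" using D m by auto
    ultimately show ?thesis using d by blast
  qed
qed

section \<open>Properties of the listed groups and the final counts\<close>

lemma pc_to_group_properties:
  assumes "pc_valid d"
  shows "group (pc_to_group d)" "order (pc_to_group d) = pc_order d" "grp_inv (pc_to_group d) = pc_invariant d"
    "pc_order d = 2 ^ m \<Longrightarrow> powerfully_nilpotent (pc_to_group d)"
proof -
  obtain ps cs c w where d: "d = (ps, cs, c, w)" by (cases d) auto
  interpret pc_data ps cs c w using assms by unfold_locales (simp add: d)
  interpret P: pc_sat_group ps cs c w "pc_group ps cs" "pc_gen ps cs" by (rule pc_sat_group_pc_group)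
  show "group (pc_to_group d)" by (simp add: d group_pc_group)
  show o: "order (pc_to_group d) = pc_order d" by (simp add: d order_pc_group)
  show "grp_inv (pc_to_group d) = pc_invariant d" by (simp add: d grp_inv_pc_group)
  show "powerfully_nilpotent (pc_to_group d)" if "pc_order d = 2 ^ m"
    using P.powerfully_nilpotent_if_pc_sat[of m] o that by (simp add: d)
qed

lemma comm_group_abelian_pcs:
  assumes "d \<in> set (abelian_pcs m)" "pc_valid d"
  shows "comm_group (pc_to_group d)"
proof -
  obtain ps c w where d: "d = (ps, [], c, w)" using assms(1) by (auto simp: abelian_pcs_def abelian_pc_def)
  interpret pc_data ps "[]" c w using assms(2) by unfold_locales (simp add: d)
  interpret P: pc_sat_group ps "[]" c w "pc_group ps []" "pc_gen ps []" by (rule pc_sat_group_pc_group)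
  have "x \<otimes>\<^bsub>pc_group ps []\<^esub> y = y \<otimes>\<^bsub>pc_group ps []\<^esub> x"
    if xy: "x \<in> pc_gen ps [] ` X" "y \<in> pc_gen ps [] ` X" for x y
  proof -
    have "x \<in> carrier (pc_group ps [])" "y \<in> carrier (pc_group ps [])" using xy P.f_closed by auto
    moreover have "x = y \<or> grp_comm (pc_group ps []) x y = \<one>\<^bsub>pc_group ps []\<^esub>"
    proof -
      obtain a b where "a \<in> X" "b \<in> X" "x = pc_gen ps [] a" "y = pc_gen ps [] b" using xy by blast
      then show ?thesis by (cases "a = b") (use P.sat in \<open>simp_all add: pc_sat_alt S_def\<close>)
    qed
    ultimately show ?thesis by (auto simp: P.grp_comm_eq_one_iff)
  qed
  then have "comm_group (pc_group ps [])"
    using P.comm_groupI_generate[OF P.f_gen(2,1)] by blast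
  then show ?thesis by (simp add: d)
qed

lemma not_comm_group_pc_to_group:
  assumes "pc_valid d" "hd (snd (pc_invariant d)) \<noteq> pc_order d"
  shows "\<not> comm_group (pc_to_group d)"
proof
  assume "comm_group (pc_to_group d)"
  then interpret comm_group "pc_to_group d" .
  have "central_root_count (pc_to_group d) 0 = order (pc_to_group d)"
  proof -
    have "\<forall>x\<in>carrier (pc_to_group d). x [^]\<^bsub>pc_to_group d\<^esub> (0::nat) = \<one>\<^bsub>pc_to_group d\<^esub> \<and>
        (\<forall>y\<in>carrier (pc_to_group d). x \<otimes>\<^bsub>pc_to_group d\<^esub> y = y \<otimes>\<^bsub>pc_to_group d\<^esub> x)"
      using m_comm by simp
    then show ?thesis unfolding central_root_count_def order_def by (intro arg_cong[where f = card]) blast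
  qed
  then show False
    using assms(2) pc_to_group_properties(2,3)[OF assms(1)] by (simp add: grp_inv_def flip: pc_to_group_properties(3)[OF assms(1)])
qed

text \<open>Counting happens in \<open>nat monoid\<close>; the copies keep the invariants of the
  listed groups and are isomorphic to the same groups.\<close>

lemma exists_nat_representatives:
  assumes "\<forall>d\<in>set ds. pc_valid d \<and> pc_order d = 2 ^ m"
  obtains Ns :: "nat monoid list" where "\<And>N. N \<in> set Ns \<Longrightarrow> group N"
    "map grp_inv Ns = map pc_invariant ds"
    "\<And>G :: nat monoid. group G \<Longrightarrow> (\<exists>N\<in>set Ns. G \<cong> N) \<longleftrightarrow> (\<exists>d\<in>set ds. G \<cong> pc_to_group d)"
proof -
  have "group P \<and> finite (carrier P)" if P: "P \<in> set (map pc_to_group ds)" for P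
  proof -
    obtain d where d: "d \<in> set ds" "P = pc_to_group d" using P unfolding set_map by (rule imageE)
    then have "order P = 2 ^ m" "group P" using pc_to_group_properties(1,2)[of d] assms by auto
    then show ?thesis by (metis card.infinite order_def power_not_zero zero_neq_numeral)
  qed
  from exists_nat_copies[OF this] obtain Ns :: "nat monoid list" where
    Ns: "list_all2 (\<lambda>P N. group N \<and> P \<cong> N) (map pc_to_group ds) Ns" by blast
  then have len: "length Ns = length ds" by (auto dest: list_all2_lengthD)
  have N: "group (Ns ! i)" "pc_to_group (ds ! i) \<cong> Ns ! i" "group (pc_to_group (ds ! i))" "pc_valid (ds ! i)"
    if "i < length ds" for i
    using Ns that assms pc_to_group_properties(1)[of "ds ! i"] by (auto simp: list_all2_conv_all_nth)
  have "grp_inv (Ns ! i) = pc_invariant (ds ! i)" if "i < length ds" for i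
    using grp_inv_iso[OF N(3,1,2)] pc_to_group_properties(3)[OF N(4)] that by simp
  then have "map grp_inv Ns = map pc_invariant ds" by (intro nth_equalityI) (simp_all add: len)
  moreover have "(\<exists>N\<in>set Ns. G \<cong> N) \<longleftrightarrow> (\<exists>d\<in>set ds. G \<cong> pc_to_group d)" for G :: "nat monoid"
  proof -
    have "G \<cong> Ns ! i \<longleftrightarrow> G \<cong> pc_to_group (ds ! i)" if "i < length ds" for i
      using iso_trans[of G "pc_to_group (ds ! i)" "Ns ! i"] iso_trans[of G "Ns ! i" "pc_to_group (ds ! i)"]
        N[OF that] group.iso_sym[OF N(3)[OF that] N(2)[OF that]] by blast
    then show ?thesis by (metis in_set_conv_nth len)
  qed
  moreover have "group N" if "N \<in> set Ns" for N using that N(1) by (auto simp: in_set_conv_nth len)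
  ultimately show thesis by (intro that[of Ns])
qed

lemma classification:
  assumes D: "m = 4 \<and> D = pcs16 \<or> m = 5 \<and> D = pcs32 \<or> m = 6 \<and> D = pcs64"
    and valid: "\<forall>d\<in>set D. pc_valid d \<and> pc_order d = 2 ^ m"
    and nonab: "\<forall>d\<in>set D. hd (snd (pc_invariant d)) \<noteq> pc_order d"
    and valid_ab: "\<forall>d\<in>set (abelian_pcs m). pc_valid d \<and> pc_order d = 2 ^ m"
    and dist: "distinct (map pc_invariant D @ map pc_invariant (abelian_pcs m))"
  shows "(\<forall>P\<in>set (map pc_to_group D). powerfully_nilpotent P \<and> \<not> comm_group P \<and> order P = 2 ^ m)
       \<and> sorted_wrt (\<lambda>P Q. \<not> P \<cong> Q) (map pc_to_group D)
       \<and> (\<forall>G :: ('a, 'b) monoid_scheme. powerfully_nilpotent G \<and> \<not> comm_group G \<and> order G = 2 ^ m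
            \<longrightarrow> (\<exists>P\<in>set (map pc_to_group D). G \<cong> P))
       \<and> num_iso_classes (\<lambda>G. powerfully_nilpotent G \<and> \<not> comm_group G \<and> order G = 2 ^ m) = length D
       \<and> num_iso_classes (\<lambda>G. comm_group G \<and> order G = 2 ^ m) = length (abelian_pcs m)
       \<and> num_iso_classes (\<lambda>G. powerfully_nilpotent G \<and> order G = 2 ^ m) = length D + length (abelian_pcs m)"
proof (intro conjI)
  have P: "group (pc_to_group d)" "powerfully_nilpotent (pc_to_group d)" "\<not> comm_group (pc_to_group d)"
    "order (pc_to_group d) = 2 ^ m" "grp_inv (pc_to_group d) = pc_invariant d" if "d \<in> set D" for d
    using that valid nonab pc_to_group_properties[of d] not_comm_group_pc_to_group[of d] by auto
  have A: "group (pc_to_group d)" "comm_group (pc_to_group d)" "order (pc_to_group d) = 2 ^ m"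
    "powerfully_nilpotent (pc_to_group d)" if "d \<in> set (abelian_pcs m)" for d
    using that valid_ab pc_to_group_properties[of d] comm_group_abelian_pcs[of d m] by auto
  show "\<forall>P\<in>set (map pc_to_group D). powerfully_nilpotent P \<and> \<not> comm_group P \<and> order P = 2 ^ m"
    using P by simp
  show "sorted_wrt (\<lambda>P Q. \<not> P \<cong> Q) (map pc_to_group D)"
    unfolding sorted_wrt_iff_nth_less
  proof (intro allI impI notI)
    fix i j assume ij: "i < j" "j < length (map pc_to_group D)"
      and iso: "map pc_to_group D ! i \<cong> map pc_to_group D ! j"
    then have "pc_invariant (D ! i) = pc_invariant (D ! j)"
      using grp_inv_iso[OF P(1) P(1), of "D ! i" "D ! j"] P(5)[of "D ! i"] P(5)[of "D ! j"] by simp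
    moreover have "distinct (map pc_invariant D)" using dist by simp
    ultimately show False using nth_eq_iff_index_eq[of "map pc_invariant D" i j] ij by simp
  qed
  have m: "0 < m" using D by auto
  \<comment> \<open>Stated for carrier types of its own, because the counts use it for
    \<open>nat monoid\<close> whatever \<open>'a\<close> is.\<close>
  have classify: "(powerfully_nilpotent G \<and> \<not> comm_group G \<and> order G = 2 ^ m) \<longleftrightarrow>
      (\<exists>d\<in>set D. G \<cong> pc_to_group d)" if G: "group G" for G :: "('x, 'y) monoid_scheme"
  proof
    assume "powerfully_nilpotent G \<and> \<not> comm_group G \<and> order G = 2 ^ m"
    then show "\<exists>d\<in>set D. G \<cong> pc_to_group d" using nonabelian_classification D by blast
  next
    assume "\<exists>d\<in>set D. G \<cong> pc_to_group d"
    then obtain d where d: "d \<in> set D" "G \<cong> pc_to_group d" by blast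
    have iso: "pc_to_group d \<cong> G" using group.iso_sym[OF G d(2)] .
    have "comm_group (pc_to_group d)" if "comm_group G"
      using comm_group.iso_imp_comm_group[OF that d(2)] P(1)[OF d(1)] group.is_monoid by blast
    then show "powerfully_nilpotent G \<and> \<not> comm_group G \<and> order G = 2 ^ m"
      using powerfully_nilpotent_iso[OF P(2)[OF d(1)] G iso] P(3,4)[OF d(1)] iso_same_card[OF d(2)]
      by (auto simp: order_def)
  qed
  have classify_ab: "comm_group G \<and> order G = 2 ^ m \<longleftrightarrow> (\<exists>d\<in>set (abelian_pcs m). G \<cong> pc_to_group d)"
    if G: "group G" for G :: "nat monoid"
  proof
    assume *: "comm_group G \<and> order G = 2 ^ m"
    then have "finite (carrier G)" by (metis card.infinite order_def power_not_zero zero_neq_numeral)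
    then show "\<exists>d\<in>set (abelian_pcs m). G \<cong> pc_to_group d"
      using comm_group.iso_abelian_pc_group[of G m] * m valid_ab by (auto simp: list_all_iff)
  next
    assume "\<exists>d\<in>set (abelian_pcs m). G \<cong> pc_to_group d"
    then obtain d where d: "d \<in> set (abelian_pcs m)" "G \<cong> pc_to_group d" by blast
    have iso: "pc_to_group d \<cong> G" using group.iso_sym[OF G d(2)] .
    have "comm_group G"
      using comm_group.iso_imp_comm_group[OF A(2)[OF d(1)] iso] G group.is_monoid by blast
    then show "comm_group G \<and> order G = 2 ^ m"
      using A(3)[OF d(1)] iso_same_card[OF d(2)] by (auto simp: order_def)
  qed
  show "\<forall>G :: ('a, 'b) monoid_scheme. powerfully_nilpotent G \<and> \<not> comm_group G \<and> order G = 2 ^ m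
      \<longrightarrow> (\<exists>P\<in>set (map pc_to_group D). G \<cong> P)"
    using nonabelian_classification D by (simp add: Bex_def) blast
  obtain Ns :: "nat monoid list" where Ns: "\<And>N. N \<in> set Ns \<Longrightarrow> group N" "map grp_inv Ns = map pc_invariant D"
    "\<And>G :: nat monoid. group G \<Longrightarrow> (\<exists>N\<in>set Ns. G \<cong> N) \<longleftrightarrow> (\<exists>d\<in>set D. G \<cong> pc_to_group d)"
    using exists_nat_representatives[OF valid] by blast
  obtain As :: "nat monoid list" where As: "\<And>N. N \<in> set As \<Longrightarrow> group N"
    "map grp_inv As = map pc_invariant (abelian_pcs m)"
    "\<And>G :: nat monoid. group G \<Longrightarrow> (\<exists>N\<in>set As. G \<cong> N) \<longleftrightarrow> (\<exists>d\<in>set (abelian_pcs m). G \<cong> pc_to_group d)"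
    using exists_nat_representatives[OF valid_ab] by blast
  have len: "length Ns = length D" "length As = length (abelian_pcs m)"
    using Ns(2) As(2) by (metis length_map)+
  show "num_iso_classes (\<lambda>G. powerfully_nilpotent G \<and> \<not> comm_group G \<and> order G = 2 ^ m) = length D"
    unfolding len(1)[symmetric]
  proof (rule num_iso_classes_eq_length[where \<phi> = grp_inv])
    show "distinct (map grp_inv Ns)" using dist Ns(2) by simp
    show "powerfully_nilpotent G \<and> \<not> comm_group G \<and> order G = 2 ^ m \<longleftrightarrow> (\<exists>N\<in>set Ns. G \<cong> N)"
      if "group G" for G :: "nat monoid"
      unfolding classify[OF that] Ns(3)[OF that] ..
  qed (use Ns(1) grp_inv_iso in blast)+
  show "num_iso_classes (\<lambda>G. comm_group G \<and> order G = 2 ^ m) = length (abelian_pcs m)"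
    unfolding len(2)[symmetric]
  proof (rule num_iso_classes_eq_length[where \<phi> = grp_inv])
    show "distinct (map grp_inv As)" using dist As(2) by simp
    show "comm_group G \<and> order G = 2 ^ m \<longleftrightarrow> (\<exists>N\<in>set As. G \<cong> N)" if "group G" for G :: "nat monoid"
      unfolding classify_ab[OF that] As(3)[OF that] ..
  qed (use As(1) grp_inv_iso in blast)+
  \<comment> \<open>Abelian groups of order \<open>2 ^ m\<close> are powerfully nilpotent, so the
    total is the disjoint union of the two lists.\<close>
  have "powerfully_nilpotent G \<and> order G = 2 ^ m \<longleftrightarrow> (\<exists>N\<in>set (Ns @ As). G \<cong> N)"
    if G: "group G" for G :: "nat monoid"
  proof -
    have "powerfully_nilpotent G" if "comm_group G" "order G = 2 ^ m"
    proof -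
      have "finite (carrier G)"
        using that(2) by (metis card.infinite order_def power_not_zero zero_neq_numeral)
      then show ?thesis
        using group.powerfully_nilpotentI_comm_group[OF G that(1)] that(2) G by (auto simp: finite_2group_def)
    qed
    then have "powerfully_nilpotent G \<and> order G = 2 ^ m \<longleftrightarrow>
        (powerfully_nilpotent G \<and> \<not> comm_group G \<and> order G = 2 ^ m) \<or> (comm_group G \<and> order G = 2 ^ m)" by blast
    also have "\<dots> \<longleftrightarrow> (\<exists>N\<in>set (Ns @ As). G \<cong> N)"
      unfolding classify[OF G] classify_ab[OF G] Ns(3)[OF G, symmetric] As(3)[OF G, symmetric] by auto
    finally show ?thesis .
  qed
  moreover have "distinct (map grp_inv (Ns @ As))" using dist Ns(2) As(2) by simp
  ultimately show "num_iso_classes (\<lambda>G. powerfully_nilpotent G \<and> order G = 2 ^ m) = length D + length (abelian_pcs m)"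
    using num_iso_classes_eq_length[of "Ns @ As" grp_inv "\<lambda>G. powerfully_nilpotent G \<and> order G = 2 ^ m"]
      Ns(1) As(1) grp_inv_iso by (auto simp: len)
qed

text \<open>The first central count is the order of the centre. The tables show it to be smaller
  than the order of the group, so the listed groups are nonabelian.\<close>

lemma pcs_noncentral:
  "\<forall>d\<in>set pcs16. hd (snd (pc_invariant d)) \<noteq> pc_order d"
  "\<forall>d\<in>set pcs32. hd (snd (pc_invariant d)) \<noteq> pc_order d"
  "\<forall>d\<in>set pcs64. hd (snd (pc_invariant d)) \<noteq> pc_order d"
proof -
  have "\<forall>i\<in>set (map pc_invariant pcs16). hd (snd i) \<noteq> 16" "\<forall>i\<in>set (map pc_invariant pcs32). hd (snd i) \<noteq> 32"
    "\<forall>i\<in>set (map pc_invariant pcs64). hd (snd i) \<noteq> 64"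
    unfolding pc_invariants_16 pc_invariants_32 pc_invariants_64 by simp_all
  then show "\<forall>d\<in>set pcs16. hd (snd (pc_invariant d)) \<noteq> pc_order d"
    "\<forall>d\<in>set pcs32. hd (snd (pc_invariant d)) \<noteq> pc_order d"
    "\<forall>d\<in>set pcs64. hd (snd (pc_invariant d)) \<noteq> pc_order d"
    using pcs_order by (simp_all add: list_all_iff del: pc_invariant.simps pc_order.simps)
qed

theorem mainTheorem7:
  fixes n :: nat and Ps :: "gen word set monoid list" and n_nonab n_ab n_total :: nat
  assumes "(n, Ps, n_nonab, n_ab, n_total)
             \<in> {(16, groups16, 1, 5, 6), (32, groups32, 4, 7, 11), (64, groups64, 12, 11, 23)}"
  shows "(\<forall>P\<in>set Ps. powerfully_nilpotent P \<and> \<not> comm_group P \<and> order P = n)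
       \<and> sorted_wrt (\<lambda>P Q. \<not> P \<cong> Q) Ps
       \<and> (\<forall>G :: ('a, 'b) monoid_scheme. powerfully_nilpotent G \<and> \<not> comm_group G \<and> order G = n
            \<longrightarrow> (\<exists>P\<in>set Ps. G \<cong> P))
       \<and> num_iso_classes (\<lambda>G. powerfully_nilpotent G \<and> \<not> comm_group G \<and> order G = n) = n_nonab
       \<and> num_iso_classes (\<lambda>G. comm_group G \<and> order G = n) = n_ab
       \<and> num_iso_classes (\<lambda>G. powerfully_nilpotent G \<and> order G = n) = n_total"
proof -
  have v: "\<forall>d\<in>set ds. pc_valid d \<and> pc_order d = k" if "list_all pc_valid ds" "list_all (\<lambda>d. pc_order d = k) ds"
    for ds :: "'g pc list" and k
    using that by (auto simp: list_all_iff)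
  have len: "length pcs16 = 1" "length pcs32 = 4" "length pcs64 = 12"
    by (simp_all add: pcs16_def pcs32_def pcs64_def)
  note 16 = classification[of 4 pcs16, where 'a = 'a and 'b = 'b]
  note 32 = classification[of 5 pcs32, where 'a = 'a and 'b = 'b]
  note 64 = classification[of 6 pcs64, where 'a = 'a and 'b = 'b]
  have pow: "(2::nat) ^ 4 = 16" "(2::nat) ^ 5 = 32" "(2::nat) ^ 6 = 64" by simp_all
  consider "n = 16" "Ps = groups16" "n_nonab = 1" "n_ab = 5" "n_total = 6"
    | "n = 32" "Ps = groups32" "n_nonab = 4" "n_ab = 7" "n_total = 11"
    | "n = 64" "Ps = groups64" "n_nonab = 12" "n_ab = 11" "n_total = 23"
    using assms by blast
  then show ?thesis
  proof cases
    case 1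
    from 16[unfolded pow len length_abelian_pcs, OF _ v[OF pcs_valid(1) pcs_order(1)] pcs_noncentral(1)
        v[OF abelian_pcs_valid(1) abelian_pcs_order(1)] distinct_pc_invariants(1)]
    show ?thesis unfolding 1 groups_eq_pcs by simp
  next
    case 2
    from 32[unfolded pow len length_abelian_pcs, OF _ v[OF pcs_valid(2) pcs_order(2)] pcs_noncentral(2)
        v[OF abelian_pcs_valid(2) abelian_pcs_order(2)] distinct_pc_invariants(2)]
    show ?thesis unfolding 2 groups_eq_pcs by simp
  next
    case 3
    from 64[unfolded pow len length_abelian_pcs, OF _ v[OF pcs_valid(3) pcs_order(3)] pcs_noncentral(3)
        v[OF abelian_pcs_valid(3) abelian_pcs_order(3)] distinct_pc_invariants(3)]
    show ?thesis unfolding 3 groups_eq_pcs by simp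
  qed
qed

end
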